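(* Let $$H=T+V:=\sum_{j,k}\tau_{j,k}A_j^\dagger A_k+\sum_{l,m}\nu_{l,m}N_lN_m$$ be an interacting-electronic Hamiltonian on $n$ spin orbitals, let $1\le\eta\le n$, and let $S_p(t)$ be a $p$th-order product formula splitting the evolutions under $T$ and $V$. Then $$\|S_p(t)-e^{-itH}\|_{\mathcal{W}_\eta}=\mathcal{O}\left(\left(|||\tau|||_1+|||\nu|||_{1,[\eta]}\right)^{p-1}\,|||\tau|||_1\,|||\nu|||_{1,[\eta]}\ \eta\ t^{p+1}\right).$$ Here $|||\tau|||_1$ and $|||\nu|||_{1,[\eta]}$ are the (restricted) induced $1$-norms $$|||\tau|||_1=\max_j\sum_k|\tau_{j,k}|,\qquad |||\nu|||_{1,[\eta]}=\max_j\ \max_{k_1<\cdots<k_\eta}\left(|\nu_{j,k_1}|+\cdots+|\nu_{j,k_\eta}|\right).$$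
   Context: $A_j^\dagger, A_j$ ($1\le j\le n$) are fermionic creation and annihilation operators satisfying the canonical anticommutation relations on the $2^n$-dimensional Fock space, and $N_l=A_l^\dagger A_l$ are the occupation-number operators; all sums run over the $n$ spin orbitals. The coefficient matrix $\tau$ is Hermitian and $\nu$ is real symmetric. $\mathcal{W}_\eta$ is the subspace with exactly $\eta$ particles (spanned by occupation basis states of Hamming weight $\eta$), and $$\|X\|_{\mathcal{W}_\eta}:=\max_{|\psi_\eta\rangle,|\phi_\eta\rangle\in\mathcal{W}_\eta}|\langle\phi_\eta|X|\psi_\eta\rangle|$$ with the maximum over normalized states. A $p$th-order product formula splitting the evolutions under $T$ and $V$ is a fixed product $S_p(t)=\prod_{s}e^{-itb_sV}e^{-ita_sT}$ with finitely many real coefficients $a_s,b_s$ (not depending on $H$) such that $S_p(t)=e^{-itH}+\mathcal{O}(t^{p+1})$ as $t\to0$ (e.g. Lie-Trotter-Suzuki formulas); $p$ is a fixed positive integer, $t\geq0$, and the constant in $\mathcal{O}(\cdot)$ depends only on the formula (in particular on $p$), not on $n,\eta,\tau,\nu,t$. *)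

theory Defs
  imports "Jordan_Normal_Form.Schur_Decomposition" "HOL-Library.Landau_Symbols"
begin

text \<open>Everything lives in complex matrices of size d, with d the dimension of the Hilbert space.\<close>

definition op_sum :: "nat \<Rightarrow> ('i \<Rightarrow> complex mat) \<Rightarrow> 'i set \<Rightarrow> complex mat" where
  "op_sum d F I = mat d d (\<lambda>rc. \<Sum>i\<in>I. F i $$ rc)"

definition mat_exp :: "complex mat \<Rightarrow> complex mat" where
  "mat_exp X = mat (dim_row X) (dim_row X) (\<lambda>rc. \<Sum>k. (X ^\<^sub>m k) $$ rc / fact k)"

definition evolution :: "real \<Rightarrow> complex mat \<Rightarrow> complex mat" where
  "evolution t H = mat_exp ((- \<i> * complex_of_real t) \<cdot>\<^sub>m H)"

text \<open>The inner product of the library is linear in its first argument, so the matrix element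
  of X between the bra of \<phi> and the ket of \<psi> is \<open>(X *\<^sub>v \<psi>) \<bullet>c \<phi>\<close>. For a nonzero subspace W of a
  finite-dimensional space the supremum is a maximum, by compactness.\<close>

definition restricted_norm :: "complex vec set \<Rightarrow> complex mat \<Rightarrow> real" where
  "restricted_norm W X =
     Sup {cmod ((X *\<^sub>v \<psi>) \<bullet>c \<phi>) | \<psi> \<phi>. \<psi> \<in> W \<and> \<phi> \<in> W \<and> \<psi> \<bullet>c \<psi> = 1 \<and> \<phi> \<bullet>c \<phi> = 1}"

subsection \<open>Fermionic modes\<close>

text \<open>The modes are \<open>0, ..., n - 1\<close>, and \<open>A j\<close> is the annihilation operator of mode j. No particular
  representation is fixed. The relation between two creation operators is the adjoint of the
  second relation below.\<close>

definition fermionic_modes :: "nat \<Rightarrow> (nat \<Rightarrow> complex mat) \<Rightarrow> bool" where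
  "fermionic_modes n A \<longleftrightarrow>
     (\<forall>j<n. A j \<in> carrier_mat (2 ^ n) (2 ^ n)) \<and>
     (\<forall>j<n. \<forall>k<n. A j * mat_adjoint (A k) + mat_adjoint (A k) * A j
        = (if j = k then 1\<^sub>m (2 ^ n) else 0\<^sub>m (2 ^ n) (2 ^ n))) \<and>
     (\<forall>j<n. \<forall>k<n. A j * A k + A k * A j = 0\<^sub>m (2 ^ n) (2 ^ n))"

definition number_op :: "(nat \<Rightarrow> complex mat) \<Rightarrow> nat \<Rightarrow> complex mat" where
  "number_op A l = mat_adjoint (A l) * A l"

text \<open>Normalized states in which precisely the modes in S are occupied; each is determined
  by S up to a phase.\<close>

definition occupation_state :: "nat \<Rightarrow> (nat \<Rightarrow> complex mat) \<Rightarrow> nat set \<Rightarrow> complex vec \<Rightarrow> bool" where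
  "occupation_state n A S v \<longleftrightarrow> v \<in> carrier_vec (2 ^ n) \<and> v \<bullet>c v = 1 \<and>
     (\<forall>l<n. number_op A l *\<^sub>v v = (if l \<in> S then 1 else 0) \<cdot>\<^sub>v v)"

definition particle_sector :: "nat \<Rightarrow> (nat \<Rightarrow> complex mat) \<Rightarrow> nat \<Rightarrow> complex vec set" where
  "particle_sector n A \<eta> =
     LinearCombinations.module.span class_ring (module_vec TYPE(complex) (2 ^ n))
       {v. \<exists>S. S \<subseteq> {..<n} \<and> card S = \<eta> \<and> occupation_state n A S v}"

subsection \<open>Interacting-electronic Hamiltonians\<close>

definition kinetic :: "nat \<Rightarrow> (nat \<Rightarrow> complex mat) \<Rightarrow> complex mat \<Rightarrow> complex mat" where
  "kinetic n A \<tau> = op_sum (2 ^ n) (\<lambda>(j, k). \<tau> $$ (j, k) \<cdot>\<^sub>m (mat_adjoint (A j) * A k)) ({..<n} \<times> {..<n})"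

definition potential :: "nat \<Rightarrow> (nat \<Rightarrow> complex mat) \<Rightarrow> real mat \<Rightarrow> complex mat" where
  "potential n A \<nu> =
     op_sum (2 ^ n) (\<lambda>(l, m). complex_of_real (\<nu> $$ (l, m)) \<cdot>\<^sub>m (number_op A l * number_op A m))
       ({..<n} \<times> {..<n})"

definition electronic_data ::
    "nat \<Rightarrow> (nat \<Rightarrow> complex mat) \<Rightarrow> complex mat \<Rightarrow> real mat \<Rightarrow> bool" where
  "electronic_data n A \<tau> \<nu> \<longleftrightarrow> fermionic_modes n A \<and>
     \<tau> \<in> carrier_mat n n \<and> mat_adjoint \<tau> = \<tau> \<and>
     \<nu> \<in> carrier_mat n n \<and> transpose_mat \<nu> = \<nu>"

definition induced_1norm :: "nat \<Rightarrow> complex mat \<Rightarrow> real" where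
  "induced_1norm n \<tau> = (MAX j\<in>{..<n}. \<Sum>k<n. cmod (\<tau> $$ (j, k)))"

definition restricted_1norm :: "nat \<Rightarrow> nat \<Rightarrow> real mat \<Rightarrow> real" where
  "restricted_1norm n \<eta> \<nu> =
     (MAX j\<in>{..<n}. MAX K\<in>{K. K \<subseteq> {..<n} \<and> card K = \<eta>}. \<Sum>k\<in>K. \<bar>\<nu> $$ (j, k)\<bar>)"

subsection \<open>Product formulas\<close>

text \<open>A splitting formula is the list of its coefficient pairs \<open>(a, b)\<close>, in the order in which the
  factors appear in the product, from left to right.\<close>

definition split_product :: "(real \<times> real) list \<Rightarrow> complex mat \<Rightarrow> complex mat \<Rightarrow> real \<Rightarrow> complex mat" where
  "split_product cs T V t =
     foldr (\<lambda>(a, b) M. evolution (t * b) V * evolution (t * a) T * M) cs (1\<^sub>m (dim_row T))"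

text \<open>The constant implicit in the order condition may depend on the Hamiltonian. On the whole
  space, the restricted norm is the spectral norm.\<close>

definition product_formula_of_order :: "nat \<Rightarrow> (real \<times> real) list \<Rightarrow> bool" where
  "product_formula_of_order p cs \<longleftrightarrow>
     (\<forall>n A \<tau> \<nu>. electronic_data n A \<tau> \<nu> \<longrightarrow>
        (\<lambda>t. restricted_norm (carrier_vec (2 ^ n))
               (split_product cs (kinetic n A \<tau>) (potential n A \<nu>) t
                - evolution t (kinetic n A \<tau> + potential n A \<nu>)))
          \<in> O[at 0](\<lambda>t. t ^ (p + 1)))"

end

theory Submission
  imports "HOL-Analysis.Derivative" Defs
begin

text \<open>The generator of the error is \<open>F(t) = S(t)\<^sup>-\<^sup>1 S'(t) + i S(t)\<^sup>-\<^sup>1 H S(t)\<close>: with \<open>G(t) = e\<^sup>i\<^sup>t\<^sup>H S(t)\<close>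
  one has \<open>G' = G F\<close>. It is a sum of generators conjugated by products of exponentials. Expanding one
  exponential at a time, the innermost conjugation first, gives a polynomial of degree below p plus remainders that are
  conjugates of p-fold nested commutators of T and V, with all exponentials on the outside. The order condition
  for the given Hamiltonian forces the polynomial to vanish, so the error is at most a constant times
  \<open>t\<^sup>p\<^sup>+\<^sup>1\<close> times the largest nested commutator on the sector.

  To bound those, write operators as \<open>\<Gamma>(M) = \<Sum> A\<^sub>j\<^sup>\<dagger> M\<^sub>j\<^sub>k A\<^sub>k\<close> with operator entries. Commuting with T or V
  turns M into \<open>[R, M]\<close> plus the entrywise commutator, where R is the matrix \<open>\<tau>\<close> for T, and for V the diagonal
  matrix with entries \<open>2 \<Phi>\<^sub>k + \<nu>\<^sub>k\<^sub>k\<close>, \<open>\<Phi>\<^sub>k = \<Sum>\<^sub>m \<nu>\<^sub>k\<^sub>m N\<^sub>m\<close>. Thus \<open>[V, T]\<close> is \<open>\<Gamma>\<close> of \<open>[R\<^sub>V, \<tau>]\<close>, the factor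
  \<open>\<eta>\<close> is paid once for \<open>\<Gamma>\<close>, and every further commutator costs a constant times the sum of the two norms,
  provided the nested commutators of \<open>\<Phi>\<^sub>k\<close> are controlled by the restricted norm of \<open>\<nu>\<close>. As \<open>\<Phi>\<^sub>k\<close> is itself
  \<open>\<Gamma>\<close> of a diagonal matrix, this follows by induction on the number of commutators.\<close>

text \<open>The order condition holds with a constant and a radius that depend on the Hamiltonian,
  so it cannot supply the estimate. It serves only to show that the polynomial part has vanishing
  matrix elements; the final constant comes from the remainders and depends on p and the
  coefficients of the formula alone. The obstacle in the commutator estimate is that
  \<open>\<nu>\<close> is controlled on \<open>\<eta>\<close> indices at a time, so full row sums of
  \<open>\<nu>\<close> are out of reach. What helps is that \<open>\<Gamma> M\<close> is tested
  against the numbers ||A_j x||, each at most ||x||, with squares summing to at most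
  \<open>\<eta>\<close> times the square of ||x||. Products of two such families are, after scaling,
  weights between 0 and 1 of total at most \<open>\<eta>\<close>, and a row of \<open>\<nu>\<close>
  paired with them costs just the restricted norm. Hence two notions of size for operator-valued
  matrices: a Schur bound by row and column sums for the multipliers R, and a pairing bound against
  such weights for what stands inside \<open>\<Gamma>\<close>. The first yields the second at the
  price of a factor \<open>\<eta>\<close>.\<close>

section \<open>Linear operators on sequences\<close>

text \<open>Matrices of all sizes act on the same space of sequences, so that they become elements of one ring
  and can be summed; a matrix of size d acts on the first d coordinates, and \<open>proj d\<close> plays the role of the identity.\<close>

typedef op = "{f :: (nat \<Rightarrow> complex) \<Rightarrow> nat \<Rightarrow> complex.
    \<forall>x y c. f (\<lambda>i. x i + c * y i) = (\<lambda>i. f x i + c * f y i)}"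
  morphisms app Op
  by (rule exI[of _ "\<lambda>x. x"]) simp

setup_lifting type_definition_op

instantiation op :: ring_1
begin
lift_definition zero_op :: op is "\<lambda>x i. 0" by simp
lift_definition one_op :: op is "\<lambda>x. x" by simp
lift_definition plus_op :: "op \<Rightarrow> op \<Rightarrow> op" is "\<lambda>f g x i. f x i + g x i"
  by (simp add: algebra_simps)
lift_definition minus_op :: "op \<Rightarrow> op \<Rightarrow> op" is "\<lambda>f g x i. f x i - g x i"
  by (simp add: algebra_simps)
lift_definition uminus_op :: "op \<Rightarrow> op" is "\<lambda>f x i. - f x i"
  by (simp add: algebra_simps)
lift_definition times_op :: "op \<Rightarrow> op \<Rightarrow> op" is "\<lambda>f g x. f (g x)"
  by simp
instance
proof
  fix a b c :: op
  show "a * b * c = a * (b * c)" by transfer simp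
  show "a + b + c = a + (b + c)" by transfer (simp add: fun_eq_iff)
  show "a + b = b + a" by transfer (simp add: fun_eq_iff)
  show "0 + a = a" by transfer simp
  show "- a + a = 0" by transfer simp
  show "a - b = a + - b" by transfer simp
  show "1 * a = a" by transfer simp
  show "a * 1 = a" by transfer simp
  show "(a + b) * c = a * c + b * c" by transfer simp
  show "a * (b + c) = a * b + a * c"
  proof transfer
    fix a b c :: "(nat \<Rightarrow> complex) \<Rightarrow> nat \<Rightarrow> complex"
    assume "\<forall>x y c. a (\<lambda>i. x i + c * y i) = (\<lambda>i. a x i + c * a y i)"
    then have "a (\<lambda>i. b x i + 1 * c x i) = (\<lambda>i. a (b x) i + 1 * a (c x) i)" for x by blast
    then show "(\<lambda>x. a (\<lambda>i. b x i + c x i)) = (\<lambda>x i. a (b x) i + a (c x) i)" by simp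
  qed
  have "(\<lambda>x i. 0) \<noteq> (\<lambda>x :: nat \<Rightarrow> complex. x)"
  proof
    assume "(\<lambda>x i. 0) = (\<lambda>x :: nat \<Rightarrow> complex. x)"
    then have "(\<lambda>i :: nat. 0 :: complex) = (\<lambda>i. 1)" by (rule fun_cong)
    then have "(0 :: complex) = 1" by (rule fun_cong)
    then show False by simp
  qed
  then show "(0::op) \<noteq> 1" by transfer
qed
end

lift_definition scal :: "complex \<Rightarrow> op" is "\<lambda>c x i. c * x i"
  by (simp add: algebra_simps)

lift_definition mat_op :: "nat \<Rightarrow> complex mat \<Rightarrow> op" is
  "\<lambda>d M x i. if i < d then \<Sum>j<d. M $$ (i, j) * x j else 0"
  by (auto simp: fun_eq_iff sum.distrib sum_distrib_left algebra_simps)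

lemma app_linear: "app X (\<lambda>i. x i + c * y i) = (\<lambda>i. app X x i + c * app X y i)"
  using app[of X] by blast

lemma app_add: "app (X + Y) x = (\<lambda>i. app X x i + app Y x i)" by transfer simp
lemma app_diff: "app (X - Y) x = (\<lambda>i. app X x i - app Y x i)" by transfer simp
lemma app_zero [simp]: "app 0 x = (\<lambda>i. 0)" by transfer simp
lemma app_one [simp]: "app 1 x = x" by transfer simp
lemma app_uminus: "app (- X) x = (\<lambda>i. - app X x i)" by transfer simp
lemma app_mult: "app (X * Y) x = app X (app Y x)" by transfer simp
lemma app_scalar: "app (scal c) x = (\<lambda>i. c * x i)" by transfer simp

lemma app_vec_add: "app X (\<lambda>i. x i + y i) = (\<lambda>i. app X x i + app X y i)"
  using app_linear[of X x 1 y] by simp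
lemma app_vec_zero [simp]: "app X (\<lambda>i. 0) = (\<lambda>i. 0)"
  using app_linear[of X "\<lambda>i. 0" 1 "\<lambda>i. 0"] by (simp add: fun_eq_iff)
lemma app_vec_smult: "app X (\<lambda>i. c * y i) = (\<lambda>i. c * app X y i)"
  using app_linear[of X "\<lambda>i. 0" c y] by simp
lemma app_vec_sum: "app X (\<lambda>i. \<Sum>k\<in>A. f k i) = (\<lambda>i. \<Sum>k\<in>A. app X (f k) i)"
  by (induction A rule: infinite_finite_induct) (auto simp: app_vec_add)
lemma app_sum: "app (\<Sum>k\<in>A. F k) x = (\<lambda>i. \<Sum>k\<in>A. app (F k) x i)"
  by (induction A rule: infinite_finite_induct) (auto simp: app_add)

lemma op_eqI: "(\<And>x. app X x = app Y x) \<Longrightarrow> X = Y"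
  by (metis app_inject ext)

lemma scal_0 [simp]: "scal 0 = 0" by transfer simp
lemma scal_1 [simp]: "scal 1 = 1" by transfer simp
lemma scal_minus: "scal (- a) = - scal a"
  by transfer simp
lemma scal_mult: "scal (a * b) = scal a * scal b"
  by transfer (simp add: algebra_simps)
lemma scal_commute: "X * scal c = scal c * X"
  by (rule op_eqI) (simp add: app_mult app_scalar app_vec_smult)
lemma scal_left_commute: "X * (scal c * Y) = scal c * (X * Y)"
  by (simp add: scal_commute flip: mult.assoc)

section \<open>Inner product and norm on the first d coordinates\<close>

definition ip :: "nat \<Rightarrow> (nat \<Rightarrow> complex) \<Rightarrow> (nat \<Rightarrow> complex) \<Rightarrow> complex" where
  "ip d x y = (\<Sum>i<d. x i * cnj (y i))"

definition nrm :: "nat \<Rightarrow> (nat \<Rightarrow> complex) \<Rightarrow> real" where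
  "nrm d x = L2_set (\<lambda>i. cmod (x i)) {..<d}"

lemma ip_add_left: "ip d (\<lambda>i. x i + y i) z = ip d x z + ip d y z"
  by (simp add: ip_def algebra_simps sum.distrib)
lemma ip_diff_left: "ip d (\<lambda>i. x i - y i) z = ip d x z - ip d y z"
  by (simp add: ip_def algebra_simps sum_subtractf)
lemma ip_uminus_left: "ip d (\<lambda>i. - x i) z = - ip d x z"
  by (simp add: ip_def sum_negf)
lemma ip_smult_left: "ip d (\<lambda>i. c * x i) z = c * ip d x z"
  by (simp add: ip_def sum_distrib_left mult.assoc)
lemma ip_zero_left [simp]: "ip d (\<lambda>i. 0) z = 0" by (simp add: ip_def)
lemma ip_sum_left: "ip d (\<lambda>i. \<Sum>k\<in>A. f k i) z = (\<Sum>k\<in>A. ip d (f k) z)"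
  by (induction A rule: infinite_finite_induct) (auto simp: ip_add_left)
lemma ip_cnj: "cnj (ip d x y) = ip d y x"
  by (simp add: ip_def mult.commute)

lemma ip_add_right: "ip d x (\<lambda>i. y i + z i) = ip d x y + ip d x z"
  by (simp add: ip_def algebra_simps sum.distrib)
lemma ip_smult_right: "ip d x (\<lambda>i. c * y i) = cnj c * ip d x y"
  by (simp add: ip_def sum_distrib_left mult_ac)
lemma ip_zero_right [simp]: "ip d x (\<lambda>i. 0) = 0" by (simp add: ip_def)
lemma ip_sum_right: "ip d x (\<lambda>i. \<Sum>k\<in>A. f k i) = (\<Sum>k\<in>A. ip d x (f k))"
  by (induction A rule: infinite_finite_induct) (auto simp: ip_add_right)

lemmas ip_app = app_add app_diff app_uminus app_mult app_scalar app_sum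
  ip_add_left ip_diff_left ip_uminus_left ip_smult_left ip_sum_left

lemma nrm_nonneg [simp]: "0 \<le> nrm d x" by (simp add: nrm_def)

lemma ip_self: "ip d x x = complex_of_real ((nrm d x)\<^sup>2)"
  by (simp add: ip_def nrm_def L2_set_def sum_nonneg complex_mult_cnj cmod_def)

lemma cmod_ip_le: "cmod (ip d x y) \<le> nrm d x * nrm d y"
proof -
  have "cmod (ip d x y) \<le> (\<Sum>i<d. \<bar>cmod (x i)\<bar> * \<bar>cmod (y i)\<bar>)"
    unfolding ip_def by (rule sum_norm_le) (simp add: norm_mult)
  also have "\<dots> \<le> nrm d x * nrm d y"
    unfolding nrm_def by (rule L2_set_mult_ineq)
  finally show ?thesis .
qed

lemma nrm_eq_1: "ip d x x = 1 \<Longrightarrow> nrm d x = 1"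
  using nrm_nonneg[of d x] by (simp only: ip_self of_real_eq_1_iff power2_eq_1_iff) linarith

lemma nrm_triangle: "nrm d (\<lambda>i. x i + y i) \<le> nrm d x + nrm d y"
proof -
  have "nrm d (\<lambda>i. x i + y i) \<le> L2_set (\<lambda>i. cmod (x i) + cmod (y i)) {..<d}"
    unfolding nrm_def by (rule L2_set_mono) (auto intro: norm_triangle_ineq)
  also have "\<dots> \<le> nrm d x + nrm d y" unfolding nrm_def by (rule L2_set_triangle_ineq)
  finally show ?thesis .
qed

lemma nrm_smult: "nrm d (\<lambda>i. c * x i) = cmod c * nrm d x"
  by (simp add: nrm_def L2_set_right_distrib norm_mult)
lemma nrm_zero [simp]: "nrm d (\<lambda>i. 0) = 0"
  by (simp add: nrm_def L2_set_def)
lemma nrm_uminus: "nrm d (\<lambda>i. - x i) = nrm d x"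
  by (simp add: nrm_def)

text \<open>The vector is tested against itself and its norm is cancelled, which needs the norm to
  be nonzero; the sign of K covers the other case.\<close>

lemma nrm_le_of_ip:
  assumes "cmod (ip d x x) \<le> K * nrm d x" "0 \<le> K"
  shows "nrm d x \<le> K"
proof (cases "nrm d x = 0")
  case False
  then have p: "nrm d x > 0" using nrm_nonneg[of d x] by linarith
  have "nrm d x * nrm d x \<le> K * nrm d x"
    using assms(1) by (simp add: ip_self norm_power power2_eq_square norm_mult)
  then show ?thesis using p by simp
qed (use assms in simp)

definition proj :: "nat \<Rightarrow> op" where "proj d = mat_op d (1\<^sub>m d)"

lemma app_mat_op: "app (mat_op d M) x = (\<lambda>i. if i < d then \<Sum>j<d. M $$ (i, j) * x j else 0)"
  by (simp add: mat_op.rep_eq)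

lemma app_proj: "app (proj d) x = (\<lambda>i. if i < d then x i else 0)"
proof -
  have "(\<Sum>j<d. 1\<^sub>m d $$ (i, j) * x j) = x i" if "i < d" for i
  proof -
    have "(\<Sum>j<d. 1\<^sub>m d $$ (i, j) * x j) = (\<Sum>j<d. if j = i then x j else 0)"
      using that by (intro sum.cong) auto
    then show ?thesis using that by simp
  qed
  then show ?thesis by (auto simp: proj_def app_mat_op)
qed

lemma ip_proj [simp]: "ip d (app (proj d) x) y = ip d x y" "ip d x (app (proj d) y) = ip d x y"
  by (simp_all add: ip_def app_proj)
lemma nrm_proj [simp]: "nrm d (app (proj d) x) = nrm d x"
  by (simp add: nrm_def L2_set_def app_proj)

lemma proj_mat_op [simp]: "proj d * mat_op d M = mat_op d M"
  by (rule op_eqI) (simp add: app_mult app_proj app_mat_op fun_eq_iff)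
lemma mat_op_proj [simp]: "mat_op d M * proj d = mat_op d M"
  by (rule op_eqI) (simp add: app_mult app_proj app_mat_op fun_eq_iff)
lemma proj_proj [simp]: "proj d * proj d = proj d"
  by (metis proj_def proj_mat_op)

lemma mat_op_cong: "(\<And>i j. i < d \<Longrightarrow> j < d \<Longrightarrow> M $$ (i,j) = M' $$ (i,j)) \<Longrightarrow> mat_op d M = mat_op d M'"
  by (rule op_eqI) (simp add: app_mat_op fun_eq_iff)

lemma mat_op_mult:
  assumes "M \<in> carrier_mat d d" "M' \<in> carrier_mat d d"
  shows "mat_op d (M * M') = mat_op d M * mat_op d M'"
proof (rule op_eqI)
  fix x
  have "(\<Sum>j<d. (M * M') $$ (i, j) * x j) = (\<Sum>k<d. M $$ (i, k) * (\<Sum>j<d. M' $$ (k, j) * x j))"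
    if i: "i < d" for i
  proof -
    have "(\<Sum>j<d. (M * M') $$ (i, j) * x j) = (\<Sum>j<d. \<Sum>k<d. M $$ (i, k) * M' $$ (k, j) * x j)"
      using assms i by (intro sum.cong refl)
        (auto simp: scalar_prod_def sum_distrib_right atLeast0LessThan intro!: sum.cong)
    also have "\<dots> = (\<Sum>k<d. M $$ (i, k) * (\<Sum>j<d. M' $$ (k, j) * x j))"
      by (subst sum.swap) (simp add: sum_distrib_left mult.assoc)
    finally show ?thesis .
  qed
  then show "app (mat_op d (M * M')) x = app (mat_op d M * mat_op d M') x"
    by (auto simp: app_mult app_mat_op fun_eq_iff)
qed

lemma mat_op_add:
  assumes "M \<in> carrier_mat d d" "M' \<in> carrier_mat d d"
  shows "mat_op d (M + M') = mat_op d M + mat_op d M'"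
  using assms by (intro op_eqI) (auto simp: app_mat_op app_add fun_eq_iff sum.distrib algebra_simps)

lemma mat_op_diff:
  assumes "M \<in> carrier_mat d d" "M' \<in> carrier_mat d d"
  shows "mat_op d (M - M') = mat_op d M - mat_op d M'"
  using assms by (intro op_eqI) (auto simp: app_mat_op app_diff fun_eq_iff sum_subtractf algebra_simps)

lemma mat_op_smult:
  assumes "M \<in> carrier_mat d d"
  shows "mat_op d (c \<cdot>\<^sub>m M) = scal c * mat_op d M"
  using assms by (intro op_eqI) (auto simp: app_mat_op app_mult app_scalar fun_eq_iff sum_distrib_left mult.assoc)

lemma mat_op_zero: "mat_op d (0\<^sub>m d d) = 0"
  by (intro op_eqI) (auto simp: app_mat_op fun_eq_iff)

lemma mat_op_op_sum: "mat_op d (op_sum d F I) = (\<Sum>i\<in>I. mat_op d (F i))"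
proof (rule op_eqI)
  fix x
  have "(\<Sum>j<d. op_sum d F I $$ (r, j) * x j) = (\<Sum>i\<in>I. \<Sum>j<d. F i $$ (r, j) * x j)" if "r < d" for r
    using that by (subst sum.swap) (simp add: op_sum_def sum_distrib_right)
  then show "app (mat_op d (op_sum d F I)) x = app (\<Sum>i\<in>I. mat_op d (F i)) x"
    by (auto simp: app_mat_op app_sum fun_eq_iff)
qed

lemma mat_adjoint_index:
  "M \<in> carrier_mat d d \<Longrightarrow> i < d \<Longrightarrow> j < d \<Longrightarrow> mat_adjoint M $$ (i, j) = cnj (M $$ (j, i))"
  by (simp add: mat_adjoint_def mat_of_rows_def)

lemma mat_adjoint_carrier: "M \<in> carrier_mat d d \<Longrightarrow> mat_adjoint M \<in> carrier_mat d d"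
  by (auto simp: mat_adjoint_def mat_of_rows_def)

text \<open>The adjoint is given entrywise rather than through \<open>mat_adjoint\<close>: for the
  exponential, the matrix to appear on the right is the evolution for \<open>- s\<close>.\<close>

lemma ip_adjoint_mat_op:
  assumes "\<And>i j. i < d \<Longrightarrow> j < d \<Longrightarrow> M' $$ (i, j) = cnj (M $$ (j, i))"
  shows "ip d (app (mat_op d M) x) y = ip d x (app (mat_op d M') y)"
proof -
  have "ip d (app (mat_op d M) x) y = (\<Sum>i<d. \<Sum>j<d. M $$ (i, j) * x j * cnj (y i))"
    by (simp add: ip_def app_mat_op sum_distrib_right)
  also have "\<dots> = (\<Sum>j<d. x j * cnj (\<Sum>i<d. M' $$ (j, i) * y i))"
    by (subst sum.swap) (simp add: assms sum_distrib_left algebra_simps)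
  also have "\<dots> = ip d x (app (mat_op d M') y)"
    by (simp add: ip_def app_mat_op)
  finally show ?thesis .
qed

definition vec_seq :: "complex vec \<Rightarrow> nat \<Rightarrow> complex" where
  "vec_seq v i = (if i < dim_vec v then v $ i else 0)"

lemma vec_seq_mult:
  assumes "M \<in> carrier_mat d d" "v \<in> carrier_vec d"
  shows "vec_seq (M *\<^sub>v v) = app (mat_op d M) (vec_seq v)"
  using assms by (auto simp: vec_seq_def app_mat_op fun_eq_iff scalar_prod_def atLeast0LessThan)

lemma ip_vec_seq:
  assumes "v \<in> carrier_vec d" "w \<in> carrier_vec d"
  shows "v \<bullet>c w = ip d (vec_seq v) (vec_seq w)"
  using assms by (auto simp: vec_seq_def ip_def scalar_prod_def atLeast0LessThan intro!: sum.cong)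

section \<open>One-parameter unitary groups\<close>

text \<open>The mean value inequality. It replaces integration throughout: remainders are never
  written as integrals, only their derivatives are bounded.\<close>

lemma vector_derivative_bound:
  fixes f :: "real \<Rightarrow> complex"
  assumes "a \<le> b" and D: "\<And>s. a \<le> s \<Longrightarrow> s \<le> b \<Longrightarrow> (f has_vector_derivative f' s) (at s)"
    and B: "\<And>s. a \<le> s \<Longrightarrow> s \<le> b \<Longrightarrow> cmod (f' s) \<le> B"
  shows "cmod (f b - f a) \<le> B * (b - a)"
proof (cases "a = b")
  case False
  have "cmod (f b - f a) \<le> B * b - B * a"
  proof (rule differentiable_bound_general[where f' = f' and \<phi>' = "\<lambda>_. B"])
    show "continuous_on {a..b} f"
      using D by (intro continuous_at_imp_continuous_on ballI) (auto dest: has_vector_derivative_continuous)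
    show "((\<lambda>x. B * x) has_vector_derivative B) (at x)" for x
      unfolding has_real_derivative_iff_has_vector_derivative[symmetric]
      by (auto intro!: derivative_eq_intros)
  qed (use assms False in \<open>auto intro!: continuous_intros\<close>)
  then show ?thesis by (simp add: right_diff_distrib)
qed simp

text \<open>The type \<open>op\<close> carries no topology, so the derivative is the weak one,
  through matrix elements. Only the first d output coordinates are seen, which loses nothing for
  operators fixed by left multiplication with \<open>proj d\<close>.\<close>

definition op_deriv :: "nat \<Rightarrow> (real \<Rightarrow> op) \<Rightarrow> op \<Rightarrow> real \<Rightarrow> bool" where
  "op_deriv d X X' t \<longleftrightarrow> (\<forall>x y. ((\<lambda>s. ip d (app (X s) x) y) has_vector_derivative ip d (app X' x) y) (at t))"

lemma op_deriv_const: "op_deriv d (\<lambda>_. X) 0 t" by (simp add: op_deriv_def)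

lemma op_deriv_scale:
  assumes "op_deriv d X X' (c * t)"
  shows "op_deriv d (\<lambda>s. X (c * s)) (scal c * X') t"
  unfolding op_deriv_def
proof (intro allI)
  fix x y
  have "((\<lambda>s. ip d (app (X s) x) y) has_derivative (\<lambda>h. h *\<^sub>R ip d (app X' x) y)) (at (c * t))"
    using assms by (simp add: op_deriv_def has_vector_derivative_def)
  moreover have "((\<lambda>s. c * s) has_derivative (\<lambda>h. c * h)) (at t)"
    by (intro derivative_eq_intros) auto
  ultimately have "((\<lambda>s. ip d (app (X (c * s)) x) y) has_derivative (\<lambda>h. (c * h) *\<^sub>R ip d (app X' x) y)) (at t)"
    by (rule has_derivative_compose[rotated])
  then show "((\<lambda>s. ip d (app (X (c * s)) x) y) has_vector_derivative ip d (app (scal c * X') x) y) (at t)"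
    by (simp add: has_vector_derivative_def ip_app scaleR_conv_of_real mult_ac)
qed

definition unit_seq :: "nat \<Rightarrow> nat \<Rightarrow> complex" where "unit_seq k = (\<lambda>i. if i = k then 1 else 0)"

lemma ip_unit_seq: "k < d \<Longrightarrow> ip d x (unit_seq k) = x k"
proof -
  assume "k < d"
  have "ip d x (unit_seq k) = (\<Sum>i<d. if i = k then x i else 0)"
    unfolding ip_def by (intro sum.cong) (auto simp: unit_seq_def)
  then show ?thesis using \<open>k < d\<close> by simp
qed

text \<open>A resolution of the identity is inserted between the factors; X has to absorb
  \<open>proj d\<close> because Y may leave the first d coordinates. The sum is finite, so the
  scalar product rule can be applied term by term.\<close>

lemma ip_mult_expand:
  assumes "X * proj d = X"
  shows "ip d (app (X * Y) x) y = (\<Sum>k<d. ip d (app X (unit_seq k)) y * ip d (app Y x) (unit_seq k))"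
proof -
  have "app (proj d) (app Y x) = (\<lambda>i. \<Sum>k<d. app Y x k * unit_seq k i)"
  proof
    fix i
    have "(\<Sum>k<d. app Y x k * unit_seq k i) = (\<Sum>k<d. if k = i then app Y x k else 0)"
      by (intro sum.cong) (auto simp: unit_seq_def)
    then show "app (proj d) (app Y x) i = (\<Sum>k<d. app Y x k * unit_seq k i)" by (simp add: app_proj)
  qed
  moreover have "app X (\<lambda>i. \<Sum>k<d. app Y x k * unit_seq k i)
      = (\<lambda>i. \<Sum>k<d. app X (\<lambda>i. app Y x k * unit_seq k i) i)"
    by (rule app_vec_sum)
  moreover have "app (X * Y) x = app X (app (proj d) (app Y x))"
    using app_mult[of X "proj d"] by (simp add: assms app_mult)
  ultimately have "app (X * Y) x = (\<lambda>i. \<Sum>k<d. app Y x k * app X (unit_seq k) i)"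
    by (simp add: app_vec_smult)
  then show ?thesis by (simp add: ip_sum_left ip_smult_left ip_unit_seq mult.commute)
qed

lemma op_deriv_mult:
  assumes X: "op_deriv d X X' t" and Y: "op_deriv d Y Y' t" and P: "\<And>s. X s * proj d = X s" "X' * proj d = X'"
  shows "op_deriv d (\<lambda>s. X s * Y s) (X' * Y t + X t * Y') t"
  unfolding op_deriv_def
proof (intro allI)
  fix x y
  let ?D = "\<lambda>k. ip d (app (X t) (unit_seq k)) y * ip d (app Y' x) (unit_seq k)
              + ip d (app X' (unit_seq k)) y * ip d (app (Y t) x) (unit_seq k)"
  have "((\<lambda>s. \<Sum>k<d. ip d (app (X s) (unit_seq k)) y * ip d (app (Y s) x) (unit_seq k))
      has_vector_derivative (\<Sum>k<d. ?D k)) (at t)"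
    by (intro has_vector_derivative_sum has_vector_derivative_mult)
       (use X Y in \<open>auto simp: op_deriv_def\<close>)
  moreover have "(\<Sum>k<d. ?D k) = ip d (app (X' * Y t + X t * Y') x) y"
    using P by (simp add: app_add ip_add_left ip_mult_expand sum.distrib)
  ultimately show "((\<lambda>s. ip d (app (X s * Y s) x) y) has_vector_derivative
      ip d (app (X' * Y t + X t * Y') x) y) (at t)"
    using P by (simp add: ip_mult_expand)
qed

lemma op_eq_of_ip:
  assumes "\<And>x y. ip d (app X x) y = ip d (app Y x) y"
  shows "proj d * X = proj d * Y"
proof (rule op_eqI)
  fix x
  show "app (proj d * X) x = app (proj d * Y) x"
  proof
    fix i
    show "app (proj d * X) x i = app (proj d * Y) x i"
      using assms[of x "unit_seq i"] by (cases "i < d") (simp_all add: app_mult app_proj ip_unit_seq)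
  qed
qed

lemma op_deriv_0_const:
  assumes "\<And>s. op_deriv d X 0 s"
  shows "proj d * X t = proj d * X 0"
proof (rule op_eq_of_ip)
  fix x y
  have *: "cmod (ip d (app (X b) x) y - ip d (app (X a) x) y) \<le> 0 * (b - a)" if "a \<le> b" for a b
    using that assms by (intro vector_derivative_bound[where f' = "\<lambda>_. 0"]) (auto simp: op_deriv_def)
  show "ip d (app (X t) x) y = ip d (app (X 0) x) y"
    using *[of "min t 0" "max t 0"] by (cases "t \<le> 0") (simp_all add: min_def max_def)
qed

text \<open>The differential equation is demanded with the generator on either side, because
  differentiating \<open>U (- s) * X * U s\<close> takes one form for each exponential.
  Invertibility then follows from the constancy of \<open>U (- s) * U s\<close>, and with the
  adjoint relation it gives unitarity.\<close>

definition unitary_group :: "nat \<Rightarrow> op \<Rightarrow> (real \<Rightarrow> op) \<Rightarrow> bool" where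
  "unitary_group d h U \<longleftrightarrow> proj d * h = h \<and> h * proj d = h \<and> (\<forall>s. proj d * U s = U s \<and> U s * proj d = U s) \<and> U 0 = proj d \<and>
     (\<forall>s. op_deriv d U (scal (-\<i>) * (h * U s)) s) \<and> (\<forall>s. op_deriv d U (scal (-\<i>) * (U s * h)) s) \<and>
     (\<forall>s x y. ip d (app (U s) x) y = ip d x (app (U (- s)) y))"

lemma unitary_group_conj:
  assumes U: "unitary_group d h U"
  shows "op_deriv d (\<lambda>s. U (- (c * s)) * X * U (c * s))
           (scal (\<i> * c) * (U (- (c * t)) * (h * X - X * h) * U (c * t))) t"
proof -
  have P: "proj d * h = h" "h * proj d = h" "proj d * U s = U s" "U s * proj d = U s" for s
    using U by (simp_all add: unitary_group_def)
  have PZ: "proj d * (h * Z) = h * Z" "proj d * (U s * Z) = U s * Z" for s Z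
    using P by (simp_all flip: mult.assoc)
  have sa: "scal a * (scal b * Y) = scal (a * b) * Y" for a b Y
    by (simp add: scal_mult mult.assoc)
  have sc: "Y * scal a = scal a * Y" for Y a by (rule scal_commute)
  have 1: "op_deriv d (\<lambda>s. U ((-c) * s)) (scal (\<i> * c) * (U ((-c) * t) * h)) t"
  proof -
    have "op_deriv d (\<lambda>s. U ((-c) * s)) (scal (-c) * (scal (-\<i>) * (U ((-c) * t) * h))) t"
      using U op_deriv_scale[of d U _ "-c" t] unfolding unitary_group_def by simp
    then show ?thesis by (simp add: sa mult.commute)
  qed
  have 2: "op_deriv d (\<lambda>s. U (c * s)) (scal (- \<i> * c) * (h * U (c * t))) t"
  proof -
    have "op_deriv d (\<lambda>s. U (c * s)) (scal c * (scal (-\<i>) * (h * U (c * t)))) t"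
      using U op_deriv_scale[of d U _ "c" t] unfolding unitary_group_def by simp
    then show ?thesis by (simp add: sa mult.commute)
  qed
  let ?D1 = "(scal (\<i> * c) * (U ((-c) * t) * h)) * X * proj d"
  let ?D2 = "scal (- \<i> * c) * (h * U (c * t))"
  \<comment> \<open>The factor \<open>proj d\<close> is inserted so that this product absorbs it on
    the right, as the next use of the product rule requires; it disappears against
    \<open>U (c * t)\<close>.\<close>
  have 3: "op_deriv d (\<lambda>s. U ((-c) * s) * (X * proj d)) ?D1 t"
    using op_deriv_mult[OF 1 op_deriv_const[of d "X * proj d" t]] P by (simp add: mult.assoc)
  have 4: "op_deriv d (\<lambda>s. (U ((-c) * s) * (X * proj d)) * U (c * s))
      (?D1 * U (c * t) + (U ((-c) * t) * (X * proj d)) * ?D2) t"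
    by (rule op_deriv_mult[OF 3 2]) (simp_all add: mult.assoc)
  have "?D1 * U (c * t) = scal (\<i> * c) * (U (- (c * t)) * (h * X) * U (c * t))"
    by (simp add: mult.assoc P)
  moreover have "(U ((-c) * t) * (X * proj d)) * ?D2
      = - (scal (\<i> * c) * (U (- (c * t)) * (X * h) * U (c * t)))"
  proof -
    have "(U ((-c) * t) * (X * proj d)) * ?D2
       = scal (- \<i> * c) * ((U ((-c) * t) * (X * proj d)) * (h * U (c * t)))"
      by (rule scal_left_commute)
    then show ?thesis by (simp add: mult.assoc PZ scal_minus)
  qed
  ultimately have "?D1 * U (c * t) + (U ((-c) * t) * (X * proj d)) * ?D2
      = scal (\<i> * c) * (U (- (c * t)) * (h * X - X * h) * U (c * t))"
    by (simp only: right_diff_distrib left_diff_distrib) simp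
  moreover have "(U ((-c) * s) * (X * proj d)) * U (c * s) = U (- (c * s)) * X * U (c * s)" for s
    by (simp add: mult.assoc P)
  ultimately show ?thesis using 4 by simp
qed

lemma unitary_group_conj_const:
  assumes U: "unitary_group d h U" and c: "h * X = X * h"
  shows "U (- s) * X * U s = proj d * X * proj d"
proof -
  have "proj d * (U (- (1 * s)) * X * U (1 * s)) = proj d * (U (- (1 * 0)) * X * U (1 * 0))"
    by (rule op_deriv_0_const) (use unitary_group_conj[OF U, of 1 X] c in simp)
  moreover have "proj d * (U s * Y) = U s * Y" for s Y using U by (simp add: unitary_group_def flip: mult.assoc)
  ultimately show ?thesis using U by (simp add: unitary_group_def mult.assoc)
qed

text \<open>The identity commutes with h, so its conjugate keeps the value that it has at
  \<open>s = 0\<close>, which is \<open>proj d\<close>.\<close>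

lemma unitary_group_inverse:
  assumes U: "unitary_group d h U"
  shows "U (- s) * U s = proj d" "U s * U (- s) = proj d"
proof -
  have *: "U (- s) * U s = proj d" for s
    using unitary_group_conj_const[OF U, of 1 s] by simp
  show "U (- s) * U s = proj d" by (rule *)
  show "U s * U (- s) = proj d" using *[of "- s"] by simp
qed

lemma unitary_group_commute:
  assumes U: "unitary_group d h U" and c: "h * X = X * h" and P: "proj d * X = X" "X * proj d = X"
  shows "X * U s = U s * X"
proof -
  have "U s * (U (- s) * X * U s) = U s * (proj d * X * proj d)"
    by (simp only: unitary_group_conj_const[OF U c])
  then have "(U s * U (- s)) * X * U s = U s * X" by (simp add: P mult.assoc)
  then show ?thesis by (simp add: unitary_group_inverse[OF U] P)
qed

lemma unitary_group_nrm:
  assumes U: "unitary_group d h U"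
  shows "nrm d (app (U s) x) = nrm d x"
proof -
  have "ip d (app (U s) x) (app (U s) x) = ip d x (app (U (- s) * U s) x)"
    using U by (simp add: unitary_group_def app_mult)
  also have "\<dots> = ip d x x" by (simp add: unitary_group_inverse[OF U])
  finally have "(nrm d (app (U s) x))\<^sup>2 = (nrm d x)\<^sup>2" by (simp only: ip_self of_real_eq_iff)
  then show ?thesis by simp
qed

section \<open>The matrix exponential\<close>

lemma pow_mat_Suc_left:
  assumes "M \<in> carrier_mat d d"
  shows "M ^\<^sub>m Suc k = M * M ^\<^sub>m k"
proof (induction k)
  case 0
  then show ?case using assms by simp
next
  case (Suc k)
  have "M ^\<^sub>m Suc (Suc k) = (M * M ^\<^sub>m k) * M" using Suc by simp
  also have "\<dots> = M * M ^\<^sub>m Suc k"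
    using assms by (simp add: assoc_mult_mat[of _ d d _ d _ d])
  finally show ?case .
qed

lemma pow_smult_mat:
  assumes "(M :: complex mat) \<in> carrier_mat d d"
  shows "(c \<cdot>\<^sub>m M) ^\<^sub>m k = c ^ k \<cdot>\<^sub>m M ^\<^sub>m k"
proof (induction k)
  case (Suc k)
  have "(c \<cdot>\<^sub>m M) ^\<^sub>m Suc k = (c ^ k \<cdot>\<^sub>m M ^\<^sub>m k) * (c \<cdot>\<^sub>m M)" using Suc by simp
  also have "\<dots> = c ^ k \<cdot>\<^sub>m (M ^\<^sub>m k * (c \<cdot>\<^sub>m M))"
    by (rule mult_smult_assoc_mat[of _ d d _ d]) (use assms in auto)
  also have "M ^\<^sub>m k * (c \<cdot>\<^sub>m M) = c \<cdot>\<^sub>m (M ^\<^sub>m k * M)"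
    by (rule mult_smult_distrib[of _ d d _ d]) (use assms in auto)
  also have "c ^ k \<cdot>\<^sub>m (c \<cdot>\<^sub>m (M ^\<^sub>m k * M)) = c ^ Suc k \<cdot>\<^sub>m M ^\<^sub>m Suc k"
    by (intro eq_matI) auto
  finally show ?case .
qed (use assms in auto)

lemma mult_mat_index:
  assumes "A \<in> carrier_mat d d" "B \<in> carrier_mat d d" "i < d" "j < d"
  shows "(A * B) $$ (i, j) = (\<Sum>k<d. A $$ (i, k) * B $$ (k, j))"
  using assms by (auto simp: scalar_prod_def atLeast0LessThan intro!: sum.cong)

lemma pow_mat_index:
  assumes M: "M \<in> carrier_mat d d" and ij: "i < d" "j < d"
  shows "(M ^\<^sub>m Suc k) $$ (i, j) = (\<Sum>l<d. M $$ (i, l) * (M ^\<^sub>m k) $$ (l, j))"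
    and "(M ^\<^sub>m Suc k) $$ (i, j) = (\<Sum>l<d. (M ^\<^sub>m k) $$ (i, l) * M $$ (l, j))"
proof -
  show "(M ^\<^sub>m Suc k) $$ (i, j) = (\<Sum>l<d. M $$ (i, l) * (M ^\<^sub>m k) $$ (l, j))"
    unfolding pow_mat_Suc_left[OF M] by (rule mult_mat_index) (use assms in auto)
  show "(M ^\<^sub>m Suc k) $$ (i, j) = (\<Sum>l<d. (M ^\<^sub>m k) $$ (i, l) * M $$ (l, j))"
    unfolding pow_mat.simps by (rule mult_mat_index) (use assms in auto)
qed

text \<open>The sum of the moduli of all entries dominates every row sum, so each further
  multiplication by M costs at most this factor.\<close>

lemma pow_mat_bound:
  assumes M: "(M :: complex mat) \<in> carrier_mat d d" and ij: "i < d" "j < d"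
  shows "cmod ((M ^\<^sub>m k) $$ (i, j)) \<le> (\<Sum>i<d. \<Sum>j<d. cmod (M $$ (i, j))) ^ k"
  using ij
proof (induction k arbitrary: i j)
  case (Suc k)
  let ?B = "\<Sum>i<d. \<Sum>j<d. cmod (M $$ (i, j))"
  have "cmod ((M ^\<^sub>m Suc k) $$ (i, j)) = cmod (\<Sum>l<d. M $$ (i, l) * (M ^\<^sub>m k) $$ (l, j))"
    by (simp only: pow_mat_index(1)[OF M Suc.prems])
  also have "\<dots> \<le> (\<Sum>l<d. cmod (M $$ (i, l)) * ?B ^ k)"
    by (rule sum_norm_le) (use Suc in \<open>auto simp: norm_mult intro!: mult_left_mono\<close>)
  also have "\<dots> = (\<Sum>l<d. cmod (M $$ (i, l))) * ?B ^ k" by (simp add: sum_distrib_right)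
  also have "\<dots> \<le> ?B * ?B ^ k"
    using Suc.prems by (intro mult_right_mono member_le_sum[of i _ "\<lambda>i. \<Sum>l<d. cmod (M $$ (i, l))"])
      (auto intro!: sum_nonneg zero_le_power)
  finally show ?case by simp
qed (use M in auto)

abbreviation exp_term :: "complex mat \<Rightarrow> nat \<Rightarrow> nat \<Rightarrow> complex \<Rightarrow> nat \<Rightarrow> complex" where
  "exp_term M i j z k \<equiv> (M ^\<^sub>m k) $$ (i, j) / fact k * z ^ k"

text \<open>An entry of the exponential of zM as a power series in the scalar z. Such a series can
  be differentiated term by term, and the imaginary argument is put in afterwards by the chain
  rule.\<close>

definition exp_entry :: "complex mat \<Rightarrow> nat \<Rightarrow> nat \<Rightarrow> complex \<Rightarrow> complex" where
  "exp_entry M i j z = (\<Sum>k. exp_term M i j z k)"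

lemma exp_entry_summable:
  assumes M: "(M :: complex mat) \<in> carrier_mat d d" and ij: "i < d" "j < d"
  shows "summable (exp_term M i j z)"
proof -
  let ?B = "\<Sum>i<d. \<Sum>j<d. cmod (M $$ (i, j))"
  have "norm (exp_term M i j z k) = cmod ((M ^\<^sub>m k) $$ (i, j)) * cmod z ^ k / fact k" for k
    by (simp add: norm_mult norm_divide norm_power)
  moreover have "cmod ((M ^\<^sub>m k) $$ (i, j)) * cmod z ^ k / fact k \<le> inverse (fact k) * (?B * cmod z) ^ k" for k
  proof -
    have "cmod ((M ^\<^sub>m k) $$ (i, j)) * cmod z ^ k / fact k \<le> ?B ^ k * cmod z ^ k / fact k"
      by (intro divide_right_mono mult_right_mono pow_mat_bound assms) auto
    then show ?thesis by (simp add: power_mult_distrib field_simps)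
  qed
  ultimately have "norm (exp_term M i j z k) \<le> inverse (fact k) * (?B * cmod z) ^ k" for k
    by simp
  then show ?thesis
    by (intro summable_comparison_test'[OF summable_exp[of "?B * cmod z"], of 0]) simp
qed

lemma exp_entry_deriv:
  assumes M: "M \<in> carrier_mat d d" and ij: "i < d" "j < d"
  shows "(exp_entry M i j has_field_derivative (\<Sum>k. (M ^\<^sub>m Suc k) $$ (i, j) / fact k * z ^ k)) (at z)"
proof -
  have "diffs (\<lambda>k. (M ^\<^sub>m k) $$ (i, j) / fact k) = (\<lambda>k. (M ^\<^sub>m Suc k) $$ (i, j) / fact k)"
  proof
    fix k
    show "diffs (\<lambda>k. (M ^\<^sub>m k) $$ (i, j) / fact k) k = (M ^\<^sub>m Suc k) $$ (i, j) / fact k"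
      by (simp only: diffs_def fact_Suc of_nat_mult)
         (simp add: divide_simps del: of_nat_Suc pow_mat.simps)
  qed
  then show ?thesis
    using termdiffs_strong_converges_everywhere[OF exp_entry_summable[OF assms], of z]
    unfolding exp_entry_def[abs_def] by simp
qed

lemma exp_entry_deriv_left:
  assumes M: "M \<in> carrier_mat d d" and ij: "i < d" "j < d"
  shows "(exp_entry M i j has_field_derivative (\<Sum>l<d. M $$ (i, l) * exp_entry M l j z)) (at z)"
proof -
  have "(\<Sum>k. (M ^\<^sub>m Suc k) $$ (i, j) / fact k * z ^ k)
      = (\<Sum>k. \<Sum>l<d. M $$ (i, l) * (exp_term M l j z k))"
    by (simp only: pow_mat_index(1)[OF assms])
      (simp add: sum_distrib_right sum_divide_distrib mult.assoc)
  also have "\<dots> = (\<Sum>l<d. \<Sum>k. M $$ (i, l) * (exp_term M l j z k))"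
    using assms by (intro suminf_sum summable_mult exp_entry_summable) auto
  also have "\<dots> = (\<Sum>l<d. M $$ (i, l) * exp_entry M l j z)"
    unfolding exp_entry_def using assms by (intro sum.cong refl suminf_mult exp_entry_summable) auto
  finally show ?thesis using exp_entry_deriv[OF assms, of z] by simp
qed

lemma exp_entry_deriv_right:
  assumes M: "M \<in> carrier_mat d d" and ij: "i < d" "j < d"
  shows "(exp_entry M i j has_field_derivative (\<Sum>l<d. exp_entry M i l z * M $$ (l, j))) (at z)"
proof -
  have "(\<Sum>k. (M ^\<^sub>m Suc k) $$ (i, j) / fact k * z ^ k)
      = (\<Sum>k. \<Sum>l<d. M $$ (l, j) * (exp_term M i l z k))"
    by (simp only: pow_mat_index(2)[OF assms])
      (simp add: sum_distrib_left sum_distrib_right sum_divide_distrib mult_ac)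
  also have "\<dots> = (\<Sum>l<d. \<Sum>k. M $$ (l, j) * (exp_term M i l z k))"
    using assms by (intro suminf_sum summable_mult exp_entry_summable) auto
  also have "\<dots> = (\<Sum>l<d. M $$ (l, j) * exp_entry M i l z)"
    unfolding exp_entry_def using assms by (intro sum.cong refl suminf_mult exp_entry_summable) auto
  finally show ?thesis using exp_entry_deriv[OF assms, of z] by (simp add: mult.commute)
qed

lemma evolution_index:
  assumes "M \<in> carrier_mat d d" "i < d" "j < d"
  shows "evolution s M $$ (i, j) = exp_entry M i j (- \<i> * complex_of_real s)"
  using assms by (simp add: evolution_def mat_exp_def exp_entry_def pow_smult_mat mult.commute)

lemma evolution_carrier: "M \<in> carrier_mat d d \<Longrightarrow> evolution s M \<in> carrier_mat d d"
  by (simp add: evolution_def mat_exp_def)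

lemma exp_entry_chain:
  assumes "(exp_entry M i j has_field_derivative D) (at (- \<i> * complex_of_real s))"
  shows "((\<lambda>s. exp_entry M i j (- \<i> * complex_of_real s)) has_vector_derivative - \<i> * D) (at s)"
proof -
  have "((\<lambda>s. - \<i> * complex_of_real s) has_derivative (\<lambda>h. h *\<^sub>R (- \<i>))) (at s)"
    by (auto intro!: derivative_eq_intros simp: scaleR_conv_of_real)
  from has_derivative_compose[OF this assms[unfolded has_field_derivative_def]]
  show ?thesis by (simp add: has_vector_derivative_def scaleR_conv_of_real mult_ac)
qed

lemma ip_mat_op: "ip d (app (mat_op d M) x) y = (\<Sum>i<d. \<Sum>j<d. M $$ (i, j) * (x j * cnj (y i)))"
  by (simp add: ip_def app_mat_op sum_distrib_right mult.assoc)

lemma op_deriv_mat_op: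
  assumes "\<And>i j. i < d \<Longrightarrow> j < d \<Longrightarrow> ((\<lambda>s. F s $$ (i, j)) has_vector_derivative F' $$ (i, j)) (at t)"
  shows "op_deriv d (\<lambda>s. mat_op d (F s)) (mat_op d F') t"
  unfolding op_deriv_def ip_mat_op
  by (intro allI has_vector_derivative_sum has_vector_derivative_mult_left) (use assms in auto)

lemma unitary_group_mat_op:
  assumes M: "M \<in> carrier_mat d d" and h: "mat_adjoint M = M"
  shows "unitary_group d (mat_op d M) (\<lambda>s. mat_op d (evolution s M))"
  unfolding unitary_group_def
proof (intro conjI allI)
  show "mat_op d (evolution 0 M) = proj d"
    unfolding proj_def
  proof (rule mat_op_cong)
    fix i j assume ij: "i < d" "j < d"
    have "exp_entry M i j 0 = (M ^\<^sub>m 0) $$ (i, j)"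
      unfolding exp_entry_def powser_zero by simp
    then show "evolution 0 M $$ (i, j) = 1\<^sub>m d $$ (i, j)"
      using M ij evolution_index[OF M ij, of 0] by simp
  qed
  fix s :: real
  let ?z = "- \<i> * complex_of_real s"
  note e = evolution_carrier[OF M, of s] evolution_index[OF M]
  have D: "op_deriv d (\<lambda>s. mat_op d (evolution s M)) (scal (- \<i>) * mat_op d X) s"
    if X: "X \<in> carrier_mat d d" and "\<And>i j. i < d \<Longrightarrow> j < d \<Longrightarrow> (exp_entry M i j has_field_derivative X $$ (i, j)) (at ?z)" for X
    unfolding mat_op_smult[OF X, symmetric]
    by (rule op_deriv_mat_op) (use exp_entry_chain that in \<open>simp add: e\<close>)
  show "op_deriv d (\<lambda>s. mat_op d (evolution s M)) (scal (- \<i>) * (mat_op d M * mat_op d (evolution s M))) s"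
    unfolding mat_op_mult[OF M e(1), symmetric]
  proof (rule D[OF mult_carrier_mat[OF M e(1)]])
    fix i j assume ij: "i < d" "j < d"
    then show "(exp_entry M i j has_field_derivative (M * evolution s M) $$ (i, j)) (at ?z)"
      using exp_entry_deriv_left[OF M ij] by (simp add: mult_mat_index[OF M e(1)] e del: index_mult_mat)
  qed
  show "op_deriv d (\<lambda>s. mat_op d (evolution s M)) (scal (- \<i>) * (mat_op d (evolution s M) * mat_op d M)) s"
    unfolding mat_op_mult[OF e(1) M, symmetric]
  proof (rule D[OF mult_carrier_mat[OF e(1) M]])
    fix i j assume ij: "i < d" "j < d"
    then show "(exp_entry M i j has_field_derivative (evolution s M * M) $$ (i, j)) (at ?z)"
      using exp_entry_deriv_right[OF M ij] by (simp add: mult_mat_index[OF e(1) M] e del: index_mult_mat)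
  qed
  fix x y
  \<comment> \<open>Powers of a Hermitian matrix are Hermitian: conjugation exchanges the two
    expansions in \<open>pow_mat_index\<close>. Conjugating the series termwise also reverses the
    sign of its imaginary argument, which gives the evolution for \<open>- s\<close>.\<close>
  have pow: "cnj ((M ^\<^sub>m k) $$ (j, i)) = (M ^\<^sub>m k) $$ (i, j)" if "i < d" "j < d" for i j k
    using that
  proof (induction k arbitrary: i j)
    case (Suc k)
    have "cnj ((M ^\<^sub>m Suc k) $$ (j, i)) = (\<Sum>l<d. cnj (M $$ (l, i)) * cnj ((M ^\<^sub>m k) $$ (j, l)))"
      by (simp only: pow_mat_index(2)[OF M Suc.prems(2,1)]) (simp add: mult.commute)
    also have "\<dots> = (\<Sum>l<d. M $$ (i, l) * (M ^\<^sub>m k) $$ (l, j))"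
    proof (intro sum.cong refl arg_cong2[where f = "(*)"])
      fix l assume "l \<in> {..<d}"
      then show "cnj (M $$ (l, i)) = M $$ (i, l)" "cnj ((M ^\<^sub>m k) $$ (j, l)) = (M ^\<^sub>m k) $$ (l, j)"
        using Suc mat_adjoint_index[OF M, unfolded h, of i l] by auto
    qed
    also have "\<dots> = (M ^\<^sub>m Suc k) $$ (i, j)"
      by (simp only: pow_mat_index(1)[OF M Suc.prems])
    finally show ?case .
  qed (use M in auto)
  show "ip d (app (mat_op d (evolution s M)) x) y = ip d x (app (mat_op d (evolution (- s) M)) y)"
  proof (rule ip_adjoint_mat_op)
    fix i j assume ij: "i < d" "j < d"
    have "(\<lambda>k. (M ^\<^sub>m k) $$ (j, i) / fact k * ?z ^ k) sums exp_entry M j i ?z"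
      unfolding exp_entry_def by (intro summable_sums exp_entry_summable[OF M] ij)
    then have "(\<lambda>k. cnj ((M ^\<^sub>m k) $$ (j, i) / fact k * ?z ^ k)) sums cnj (exp_entry M j i ?z)"
      by (simp only: sums_cnj)
    then have "(\<lambda>k. (M ^\<^sub>m k) $$ (i, j) / fact k * (- \<i> * complex_of_real (- s)) ^ k) sums cnj (exp_entry M j i ?z)"
      using pow[OF ij] by simp
    then show "evolution (- s) M $$ (i, j) = cnj (evolution s M $$ (j, i))"
      unfolding evolution_index[OF M ij] evolution_index[OF M ij(2,1)]
      by (simp only: exp_entry_def[of M i j] sums_iff)
  qed
qed simp_all

section \<open>Reduction of the error to nested commutators\<close>

lemma scal_scalar: "scal a * (scal b * Y) = scal (a * b) * Y"
  by (simp add: scal_mult mult.assoc)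

definition comm_op :: "op \<Rightarrow> op \<Rightarrow> op" where "comm_op X Y = X * Y - Y * X"

definition form_bd :: "nat \<Rightarrow> (nat \<Rightarrow> complex) set \<Rightarrow> real \<Rightarrow> op \<Rightarrow> bool" where
  "form_bd d W K X \<longleftrightarrow> (\<forall>x\<in>W. \<forall>y\<in>W. cmod (ip d (app X x) y) \<le> K * nrm d x * nrm d y)"

text \<open>All words of length p in the generators share one bound, because expanding a product of
  exponentials mixes the generators in every order.\<close>

primrec nested_bd :: "nat \<Rightarrow> (nat \<Rightarrow> complex) set \<Rightarrow> op set \<Rightarrow> nat \<Rightarrow> real \<Rightarrow> op \<Rightarrow> bool" where
  "nested_bd d W Hs 0 K X = form_bd d W K X"
| "nested_bd d W Hs (Suc p) K X = (\<forall>h\<in>Hs. nested_bd d W Hs p K (comm_op h X))"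

lemma form_bd_mono: "form_bd d W K X \<Longrightarrow> K \<le> K' \<Longrightarrow> form_bd d W K' X"
  unfolding form_bd_def by (meson mult_right_mono nrm_nonneg order_trans)

lemma form_bd_add: "form_bd d W K X \<Longrightarrow> form_bd d W L Y \<Longrightarrow> form_bd d W (K + L) (X + Y)"
  unfolding form_bd_def ip_app by (auto simp: distrib_right intro!: order_trans[OF norm_triangle_ineq] add_mono)

lemma form_bd_scalar: "form_bd d W K X \<Longrightarrow> form_bd d W (cmod c * K) (scal c * X)"
  unfolding form_bd_def ip_app by (auto simp: norm_mult mult.assoc intro!: mult_left_mono)

lemma form_bd_zero: "form_bd d W 0 0" by (simp add: form_bd_def)

lemma form_bd_sum: "(\<And>k. k \<in> A \<Longrightarrow> form_bd d W (K k) (X k)) \<Longrightarrow> form_bd d W (\<Sum>k\<in>A. K k) (\<Sum>k\<in>A. X k)"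
  by (induction A rule: infinite_finite_induct) (auto intro: form_bd_add form_bd_zero)

lemma nested_bd_mono: "nested_bd d W Hs p K X \<Longrightarrow> K \<le> K' \<Longrightarrow> nested_bd d W Hs p K' X"
  by (induction p arbitrary: X) (auto intro: form_bd_mono)

lemma nested_bd_funpow: "nested_bd d W Hs p K X \<Longrightarrow> q \<le> p \<Longrightarrow> h \<in> Hs \<Longrightarrow> nested_bd d W Hs (p - q) K ((comm_op h ^^ q) X)"
proof (induction q)
  case (Suc q)
  then have "nested_bd d W Hs (Suc (p - Suc q)) K ((comm_op h ^^ q) X)" by (simp add: Suc_diff_Suc)
  then show ?case using Suc.prems by simp
qed simp

definition invariant :: "nat \<Rightarrow> (real \<Rightarrow> op) \<Rightarrow> (nat \<Rightarrow> complex) set \<Rightarrow> bool" where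
  "invariant d U W \<longleftrightarrow> (\<forall>x\<in>W. app (proj d) x = x \<and> (\<forall>s. app (U s) x \<in> W))"

lemma power_vector_derivative:
  "((\<lambda>s. (z * complex_of_real s) ^ Suc q / fact (Suc q)) has_vector_derivative
     z * ((z * complex_of_real s) ^ q / fact q)) (at s)"
proof -
  have "(1 + of_nat q :: complex) \<noteq> 0" by (metis of_nat_Suc of_nat_neq_0)
  then have e: "(1 + of_nat q) * (z * (z * w) ^ q) / fact (Suc q) = z * ((z * w) ^ q / fact q)" for w
    by (simp only: fact_Suc of_nat_mult of_nat_Suc) (simp add: divide_simps)
  have "((\<lambda>w. z * w) has_field_derivative z) (at w)" for w
    by (auto intro!: derivative_eq_intros)
  from DERIV_cdivide[OF DERIV_power_Suc[OF this, of q], of "fact (Suc q)"]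
  show ?thesis unfolding e by (rule has_vector_derivative_real_field)
qed

text \<open>The derivative of the remainder of order \<open>Suc p\<close> for X is
  \<open>\<i> * c\<close> times the remainder of order p for \<open>comm_op h X\<close>, so
  induction and the mean value inequality give the bound. The usual factor \<open>1 / fact p\<close>
  is given away.\<close>

lemma conj_taylor:
  assumes U: "unitary_group d h U" and W: "invariant d U W" and N: "0 \<le> N"
  shows "form_bd d W N ((comm_op h ^^ p) X) \<Longrightarrow> 0 \<le> t \<Longrightarrow>
    form_bd d W (\<bar>c\<bar> ^ p * t ^ p * N) (U (- (c * t)) * X * U (c * t)
      - (\<Sum>q<p. scal ((\<i> * c * t) ^ q / fact q) * (comm_op h ^^ q) X))"
proof (induction p arbitrary: X t)
  case 0
  show ?case unfolding form_bd_def
  proof (intro ballI)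
    fix x y assume xy: "x \<in> W" "y \<in> W"
    have "ip d (app (U (- (c * t)) * X * U (c * t)) x) y = ip d (app X (app (U (c * t)) x)) (app (U (c * t)) y)"
      using U by (simp add: unitary_group_def app_mult)
    then show "cmod (ip d (app (U (- (c * t)) * X * U (c * t)
      - (\<Sum>q<0. scal ((\<i> * c * t) ^ q / fact q) * (comm_op h ^^ q) X)) x) y) \<le> \<bar>c\<bar> ^ 0 * t ^ 0 * N * nrm d x * nrm d y"
      using 0 W xy unitary_group_nrm[OF U, of "c * t"] unfolding form_bd_def invariant_def by simp metis
  qed
next
  case (Suc p)
  show ?case unfolding form_bd_def
  proof (intro ballI)
    fix x y assume xy: "x \<in> W" "y \<in> W"
    define a where "a q = ip d (app ((comm_op h ^^ q) X) x) y" for q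
    \<comment> \<open>The constant term is split off and the index shifted, so that differentiation
      lowers each power to the one in the remainder for \<open>comm_op h X\<close>.\<close>
    define f where "f s = ip d (app (U (- (c * s)) * X * U (c * s)) x) y
       - (a 0 + (\<Sum>q<p. (\<i> * c * complex_of_real s) ^ Suc q / fact (Suc q) * a (Suc q)))" for s
    define f' where "f' s = \<i> * c * ip d (app (U (- (c * s)) * comm_op h X * U (c * s)
      - (\<Sum>q<p. scal ((\<i> * c * s) ^ q / fact q) * (comm_op h ^^ q) (comm_op h X))) x) y" for s :: real
    have ev: "ip d (app (U (- (c * s)) * X * U (c * s)
      - (\<Sum>q<Suc p. scal ((\<i> * c * s) ^ q / fact q) * (comm_op h ^^ q) X)) x) y = f s" for s
      by (simp only: f_def a_def ip_app sum.lessThan_Suc_shift) simp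
    have "f 0 = ip d (app (proj d * X * proj d) x) y - a 0" using U by (simp add: f_def unitary_group_def)
    also have "\<dots> = 0" using W xy by (simp add: invariant_def a_def app_mult)
    finally have f0: "f 0 = 0" .
    have der: "(f has_vector_derivative f' s) (at s)" for s
    proof -
      have 1: "((\<lambda>s. ip d (app (U (- (c * s)) * X * U (c * s)) x) y) has_vector_derivative
          \<i> * c * ip d (app (U (- (c * s)) * comm_op h X * U (c * s)) x) y) (at s)"
        using unitary_group_conj[OF U, of c X s] unfolding op_deriv_def comm_op_def
        by (simp add: app_mult[of "scal _"] app_scalar ip_smult_left)
      have 2: "((\<lambda>s. \<Sum>q<p. (\<i> * c * complex_of_real s) ^ Suc q / fact (Suc q) * a (Suc q)) has_vector_derivative
         (\<Sum>q<p. \<i> * c * ((\<i> * c * complex_of_real s) ^ q / fact q) * a (Suc q))) (at s)"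
        by (intro has_vector_derivative_sum has_vector_derivative_mult_left power_vector_derivative)
      have "f' s = \<i> * c * ip d (app (U (- (c * s)) * comm_op h X * U (c * s)) x) y
         - (0 + (\<Sum>q<p. \<i> * c * ((\<i> * c * complex_of_real s) ^ q / fact q) * a (Suc q)))"
        by (simp only: f'_def a_def ip_app funpow_Suc_right o_apply right_diff_distrib sum_distrib_left mult.assoc add_0)
      then show ?thesis unfolding f_def[abs_def]
        using has_vector_derivative_diff[OF 1 has_vector_derivative_add[OF has_vector_derivative_const 2]] by simp
    qed
    have "form_bd d W N ((comm_op h ^^ p) (comm_op h X))" using Suc.prems by (simp add: funpow_swap1)
    note IH = Suc.IH[OF this]
    have "cmod (f t - f 0) \<le> (\<bar>c\<bar> * (\<bar>c\<bar> ^ p * t ^ p * N * nrm d x * nrm d y)) * (t - 0)"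
    proof (rule vector_derivative_bound[OF Suc.prems(2) der])
      fix s assume s: "0 \<le> s" "s \<le> t"
      have "cmod (f' s) \<le> \<bar>c\<bar> * (\<bar>c\<bar> ^ p * s ^ p * N * nrm d x * nrm d y)"
        using IH[OF s(1)] xy unfolding form_bd_def f'_def by (simp add: norm_mult mult_left_mono)
      also have "\<dots> \<le> \<bar>c\<bar> * (\<bar>c\<bar> ^ p * t ^ p * N * nrm d x * nrm d y)"
        using s N by (intro mult_left_mono mult_right_mono power_mono) auto
      finally show "cmod (f' s) \<le> \<bar>c\<bar> * (\<bar>c\<bar> ^ p * t ^ p * N * nrm d x * nrm d y)" .
    qed
    then show "cmod (ip d (app (U (- (c * t)) * X * U (c * t)
      - (\<Sum>q<Suc p. scal ((\<i> * c * t) ^ q / fact q) * (comm_op h ^^ q) X)) x) y)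
       \<le> \<bar>c\<bar> ^ Suc p * t ^ Suc p * N * nrm d x * nrm d y"
      unfolding ev f0 by (simp add: mult_ac)
  qed
qed

section \<open>Operator-valued polynomials in t of degree below p\<close>

definition poly_lt :: "nat \<Rightarrow> (real \<Rightarrow> op) \<Rightarrow> bool" where
  "poly_lt p Q \<longleftrightarrow> (\<exists>Y. \<forall>t. Q t = (\<Sum>q<p. scal (of_real (t ^ q)) * Y q))"

lemma poly_lt_add: "poly_lt p Q \<Longrightarrow> poly_lt p R \<Longrightarrow> poly_lt p (\<lambda>t. Q t + R t)"
  unfolding poly_lt_def
proof (elim exE)
  fix Y Z
  assume "\<forall>t. Q t = (\<Sum>q<p. scal (of_real (t ^ q)) * Y q)"
    "\<forall>t. R t = (\<Sum>q<p. scal (of_real (t ^ q)) * Z q)"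
  then show "\<exists>Y. \<forall>t. Q t + R t = (\<Sum>q<p. scal (of_real (t ^ q)) * Y q)"
    by (intro exI[of _ "\<lambda>q. Y q + Z q"]) (simp add: distrib_left sum.distrib)
qed

lemma poly_lt_zero: "poly_lt p (\<lambda>t. 0)"
  unfolding poly_lt_def by (intro exI[of _ "\<lambda>q. 0"]) simp

lemma poly_lt_sum: "(\<And>k. k \<in> A \<Longrightarrow> poly_lt p (Q k)) \<Longrightarrow> poly_lt p (\<lambda>t. \<Sum>k\<in>A. Q k t)"
  by (induction A rule: infinite_finite_induct) (auto intro: poly_lt_zero poly_lt_add)

lemma poly_lt_const: "0 < p \<Longrightarrow> poly_lt p (\<lambda>t. X)"
proof -
  assume "0 < p"
  then obtain k where p: "p = Suc k" by (cases p) auto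
  show ?thesis unfolding poly_lt_def p
    by (intro exI[of _ "\<lambda>q. if q = 0 then X else 0"]) (simp only: sum.lessThan_Suc_shift, simp)
qed

lemma poly_lt_shift:
  assumes "poly_lt (p - r) Q" "r \<le> p"
  shows "poly_lt p (\<lambda>t. scal (c * of_real t ^ r) * Q t)"
proof -
  obtain Y where Y: "\<And>t. Q t = (\<Sum>q<p - r. scal (of_real (t ^ q)) * Y q)"
    using assms by (auto simp: poly_lt_def)
  have "scal (c * of_real t ^ r) * Q t
      = (\<Sum>q<p. scal (of_real (t ^ q)) * (if q < r then 0 else scal c * Y (q - r)))" for t
  proof -
    have "(\<Sum>q<p. scal (of_real (t ^ q)) * (if q < r then 0 else scal c * Y (q - r)))
       = (\<Sum>q\<in>{r..<p}. scal (of_real (t ^ q)) * (scal c * Y (q - r)))"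
      by (rule sum.mono_neutral_cong_right) auto
    also have "\<dots> = (\<Sum>q<p - r. scal (of_real (t ^ (q + r))) * (scal c * Y q))"
      using assms(2) by (intro sum.reindex_bij_witness[of _ "\<lambda>q. q + r" "\<lambda>q. q - r"]) auto
    also have "\<dots> = (\<Sum>q<p - r. scal (c * of_real t ^ r) * (scal (of_real (t ^ q)) * Y q))"
      by (simp only: scal_scalar of_real_power power_add) (simp add: mult_ac)
    finally show ?thesis by (simp add: Y sum_distrib_left)
  qed
  then show ?thesis unfolding poly_lt_def
    by (intro exI[of _ "\<lambda>q. if q < r then 0 else scal c * Y (q - r)"] allI)
qed

lemma poly_lt_scalar:
  assumes "poly_lt p Q" shows "poly_lt p (\<lambda>t. scal c * Q t)"
  using poly_lt_shift[of p 0 Q c] assms by simp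

text \<open>The recursion mirrors the expansion in \<open>heis_taylor\<close>. The first summand is
  the remainder of the conjugation by g; the Taylor coefficient of index q has size at most |c|^q
  t^q and is expanded through the other factors to order \<open>p - q\<close> only. The value 1 for
  the empty product is the case \<open>p = 0\<close>, where nothing is expanded.\<close>

primrec heis_const :: "(real \<times> bool) list \<Rightarrow> nat \<Rightarrow> real" where
  "heis_const [] p = 1"
| "heis_const (g # gs) p = \<bar>fst g\<bar> ^ p + (\<Sum>q<p. \<bar>fst g\<bar> ^ q * heis_const gs (p - q))"

lemma heis_const_nonneg: "0 \<le> heis_const gs p"
  by (induction gs arbitrary: p) (auto intro!: add_nonneg_nonneg sum_nonneg mult_nonneg_nonneg)

primrec gen_const :: "(real \<times> bool) list \<Rightarrow> nat \<Rightarrow> real" where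
  "gen_const [] p = 0"
| "gen_const (g # gs) p = \<bar>fst g\<bar> * heis_const (g # gs) p + gen_const gs p"

lemma gen_const_nonneg: "0 \<le> gen_const gs p"
  by (induction gs) (auto intro!: add_nonneg_nonneg sum_nonneg mult_nonneg_nonneg heis_const_nonneg)

section \<open>Products of exponentials and conjugation by them\<close>

locale splitting =
  fixes d :: nat and h :: "bool \<Rightarrow> op" and U :: "bool \<Rightarrow> real \<Rightarrow> op" and UH :: "real \<Rightarrow> op"
  assumes U: "\<And>b. unitary_group d (h b) (U b)"
    and UH: "unitary_group d (h False + h True) UH"
begin

primrec S :: "(real \<times> bool) list \<Rightarrow> real \<Rightarrow> op" where
  "S [] t = proj d"
| "S (g # gs) t = U (snd g) (fst g * t) * S gs t"

primrec Sinv :: "(real \<times> bool) list \<Rightarrow> real \<Rightarrow> op" where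
  "Sinv [] t = proj d"
| "Sinv (g # gs) t = Sinv gs t * U (snd g) (- (fst g * t))"

definition Heis :: "(real \<times> bool) list \<Rightarrow> real \<Rightarrow> op \<Rightarrow> op" where
  "Heis gs t X = Sinv gs t * X * S gs t"

definition stable :: "(nat \<Rightarrow> complex) set \<Rightarrow> bool" where
  "stable W \<longleftrightarrow> (\<forall>b. invariant d (U b) W) \<and> invariant d UH W"

lemma UP: "proj d * U b s = U b s" "U b s * proj d = U b s"
  "proj d * h b = h b" "h b * proj d = h b" "proj d * UH s = UH s" "UH s * proj d = UH s"
  using U[of b] UH by (auto simp: unitary_group_def)

lemma UPZ: "proj d * (U b s * Z) = U b s * Z" "U b s * (proj d * Z) = U b s * Z"
  "proj d * (h b * Z) = h b * Z"  "proj d * (UH s * Z) = UH s * Z" "UH s * (proj d * Z) = UH s * Z"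
  by (simp_all add: UP flip: mult.assoc)

lemma S_P: "proj d * S gs t = S gs t" "S gs t * proj d = S gs t" "proj d * Sinv gs t = Sinv gs t" "Sinv gs t * proj d = Sinv gs t"
  by (induction gs) (simp_all add: UP UPZ mult.assoc flip: mult.assoc[of "proj d" "Sinv _ _"])

lemma S_Sinv: "S gs t * Sinv gs t = proj d"
proof (induction gs)
  case (Cons g gs)
  have "S (g # gs) t * Sinv (g # gs) t
     = U (snd g) (fst g * t) * (S gs t * Sinv gs t) * U (snd g) (- (fst g * t))"
    by (simp add: mult.assoc)
  then show ?case using Cons by (simp add: UP unitary_group_inverse[OF U])
qed simp

lemma ip_S: "ip d (app (S gs t) x) y = ip d x (app (Sinv gs t) y)"
proof (induction gs arbitrary: y)
  case (Cons g gs)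
  then show ?case using U[of "snd g"] by (simp add: app_mult unitary_group_def)
qed simp

lemma ip_Sinv: "ip d (app (Sinv gs t) x) y = ip d x (app (S gs t) y)"
  using ip_S[of gs t y x] by (metis ip_cnj)

lemma nrm_S: "nrm d (app (S gs t) x) = nrm d x"
  by (induction gs) (simp_all add: app_mult unitary_group_nrm[OF U])

lemma nrm_Sinv: "nrm d (app (Sinv gs t) x) = nrm d x"
  by (induction gs arbitrary: x) (simp_all add: app_mult unitary_group_nrm[OF U])

lemma S_inv: "stable W \<Longrightarrow> x \<in> W \<Longrightarrow> app (S gs t) x \<in> W"
  by (induction gs) (auto simp: app_mult stable_def invariant_def)

lemma Sinv_inv: "stable W \<Longrightarrow> x \<in> W \<Longrightarrow> app (Sinv gs t) x \<in> W"
  by (induction gs arbitrary: x) (auto simp: app_mult stable_def invariant_def)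

lemma Heis_add: "Heis gs t (X + Y) = Heis gs t X + Heis gs t Y"
  by (simp add: Heis_def distrib_left distrib_right)
lemma Heis_diff: "Heis gs t (X - Y) = Heis gs t X - Heis gs t Y"
  by (simp add: Heis_def right_diff_distrib left_diff_distrib)
lemma Heis_zero: "Heis gs t 0 = 0" by (simp add: Heis_def)
lemma Heis_sum: "Heis gs t (\<Sum>k\<in>A. X k) = (\<Sum>k\<in>A. Heis gs t (X k))"
  by (induction A rule: infinite_finite_induct) (auto simp: Heis_add Heis_zero)
lemma Heis_scalar: "Heis gs t (scal c * X) = scal c * Heis gs t X"
  by (simp add: Heis_def mult.assoc scal_left_commute[of "Sinv gs t"])

lemma Heis_Cons: "Heis (g # gs) t X = Heis gs t (U (snd g) (- (fst g * t)) * X * U (snd g) (fst g * t))"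
  by (simp add: Heis_def mult.assoc)

lemma form_bd_Heis:
  assumes "stable W" "form_bd d W N X"
  shows "form_bd d W N (Heis gs t X)"
  using assms S_inv[of W] unfolding form_bd_def Heis_def
  by (simp add: app_mult ip_Sinv) (metis nrm_S)

text \<open>The polynomial Q does not depend on the subspace W: it is shown to vanish on the whole space, but the
  remainder is used on the particle sector.\<close>

lemma heis_taylor:
  "\<exists>Q. poly_lt p Q \<and> (\<forall>W N t. stable W \<longrightarrow> 0 \<le> N \<longrightarrow> nested_bd d W (range h) p N X \<longrightarrow> 0 \<le> t \<longrightarrow>
     form_bd d W (heis_const gs p * t ^ p * N) (Heis gs t X - Q t))"
proof (induction gs arbitrary: p X)
  case Nil
  \<comment> \<open>For positive p the constant family is itself an admissible polynomial and the
    remainder is zero. For \<open>p = 0\<close> the only polynomial is zero, and the operator is its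
    own remainder.\<close>
  show ?case
  proof (cases "p = 0")
    case True
    then show ?thesis
      using form_bd_Heis[of _ _ X "[]"] by (intro exI[of _ "\<lambda>t. 0"]) (auto simp: poly_lt_zero)
  next
    case False
    then show ?thesis
      by (intro exI[of _ "\<lambda>t. Heis [] 0 X"])
        (auto simp: poly_lt_const Heis_def intro!: form_bd_mono[OF form_bd_zero])
  qed
next
  case (Cons g gs)
  obtain c b where g: "g = (c, b)" by (cases g)
  define ad where "ad q = (comm_op (h b) ^^ q) X" for q
  from Cons.IH have "\<forall>q. \<exists>Q. poly_lt (p - q) Q \<and> (\<forall>W N t. stable W \<longrightarrow> 0 \<le> N \<longrightarrow> nested_bd d W (range h) (p - q) N (ad q) \<longrightarrow> 0 \<le> t \<longrightarrow>
     form_bd d W (heis_const gs (p - q) * t ^ (p - q) * N) (Heis gs t (ad q) - Q t))" by blast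
  then obtain Q where Q: "\<And>q. poly_lt (p - q) (Q q)"
    and QB: "\<And>q W N t. stable W \<Longrightarrow> 0 \<le> N \<Longrightarrow> nested_bd d W (range h) (p - q) N (ad q) \<Longrightarrow> 0 \<le> t \<Longrightarrow>
     form_bd d W (heis_const gs (p - q) * t ^ (p - q) * N) (Heis gs t (ad q) - Q q t)"
    by metis
  \<comment> \<open>The coefficient of index q already carries \<open>t ^ q\<close>, so a polynomial
    of degree below \<open>p - q\<close> suffices for it, and all the remainders come out of order
    \<open>t ^ p\<close>.\<close>
  define R where "R t = (\<Sum>q<p. scal ((\<i> * c * of_real t) ^ q / fact q) * Q q t)" for t
  have "poly_lt p R"
    unfolding R_def[abs_def]
  proof (rule poly_lt_sum)
    fix q assume "q \<in> {..<p}"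
    then have "poly_lt p (\<lambda>t. scal ((\<i> * c) ^ q / fact q * of_real t ^ q) * Q q t)"
      by (intro poly_lt_shift Q) auto
    then show "poly_lt p (\<lambda>t. scal ((\<i> * c * of_real t) ^ q / fact q) * Q q t)"
      by (simp add: power_mult_distrib)
  qed
  moreover have "form_bd d W (heis_const (g # gs) p * t ^ p * N) (Heis (g # gs) t X - R t)"
    if W: "stable W" and N: "0 \<le> N" and nbX: "nested_bd d W (range h) p N X" and t: "0 \<le> t" for W N t
  proof -
    let ?s = "\<lambda>q. scal ((\<i> * c * of_real t) ^ q / fact q)"
    have nbq: "nested_bd d W (range h) (p - q) N (ad q)" if "q \<le> p" for q
      unfolding ad_def by (rule nested_bd_funpow[OF nbX that]) simp
    have 1: "form_bd d W (\<bar>c\<bar> ^ p * t ^ p * N) (Heis gs t (U b (- (c * t)) * X * U b (c * t) - (\<Sum>q<p. ?s q * ad q)))"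
      unfolding ad_def using W nbq[of p]
      by (intro form_bd_Heis conj_taylor[OF U _ N _ t]) (auto simp: stable_def ad_def)
    have 2: "form_bd d W (\<Sum>q<p. \<bar>c\<bar> ^ q * heis_const gs (p - q) * t ^ p * N) (\<Sum>q<p. ?s q * (Heis gs t (ad q) - Q q t))"
    proof (rule form_bd_sum)
      fix q assume q: "q \<in> {..<p}"
      have "cmod ((\<i> * c * of_real t) ^ q / fact q) \<le> \<bar>c\<bar> ^ q * t ^ q"
      proof -
        have "cmod ((\<i> * c * of_real t) ^ q / fact q) = \<bar>c\<bar> ^ q * t ^ q / fact q"
          using t by (simp add: norm_divide norm_power norm_mult power_mult_distrib)
        also have "\<dots> \<le> \<bar>c\<bar> ^ q * t ^ q / 1"
          using t by (intro divide_left_mono) auto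
        finally show ?thesis by simp
      qed
      then have "cmod ((\<i> * c * of_real t) ^ q / fact q) * (heis_const gs (p - q) * t ^ (p - q) * N)
         \<le> (\<bar>c\<bar> ^ q * t ^ q) * (heis_const gs (p - q) * t ^ (p - q) * N)"
        using N t heis_const_nonneg by (intro mult_right_mono) auto
      also have "\<dots> = \<bar>c\<bar> ^ q * heis_const gs (p - q) * (t ^ q * t ^ (p - q)) * N" by (simp add: mult_ac)
      also have "t ^ q * t ^ (p - q) = t ^ p" using q by (simp flip: power_add)
      finally show "form_bd d W (\<bar>c\<bar> ^ q * heis_const gs (p - q) * t ^ p * N) (?s q * (Heis gs t (ad q) - Q q t))"
        using form_bd_scalar[OF QB[OF W N nbq t], of q] q form_bd_mono by (simp add: less_imp_le) blast
    qed
    have "Heis (g # gs) t X - R t = Heis gs t (U b (- (c * t)) * X * U b (c * t) - (\<Sum>q<p. ?s q * ad q))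
       + (\<Sum>q<p. ?s q * (Heis gs t (ad q) - Q q t))"
      by (simp add: g Heis_Cons Heis_diff Heis_sum Heis_scalar R_def right_diff_distrib sum_subtractf)
    moreover have "heis_const (g # gs) p * t ^ p * N = \<bar>c\<bar> ^ p * t ^ p * N + (\<Sum>q<p. \<bar>c\<bar> ^ q * heis_const gs (p - q) * t ^ p * N)"
      by (simp add: g distrib_right sum_distrib_right)
    ultimately show ?thesis using form_bd_add[OF 1 2] by simp
  qed
  ultimately show ?case by blast
qed

end

section \<open>Vanishing of the polynomial part\<close>

text \<open>Letting t tend to 0 kills the constant coefficient; dividing by t leaves the same
  situation with one coefficient less.\<close>

lemma polynomial_coeffs_zero:
  fixes a :: "nat \<Rightarrow> complex"
  assumes "0 < e" and "\<And>t. 0 < t \<Longrightarrow> t < e \<Longrightarrow> cmod (\<Sum>q<p. complex_of_real (t ^ q) * a q) \<le> C * t ^ p"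
  shows "q < p \<Longrightarrow> a q = 0"
  using assms(2)
proof (induction p arbitrary: a q)
  case (Suc p)
  define B where "B = (\<Sum>q<p. cmod (a (Suc q)))"
  have B0: "0 \<le> B" by (simp add: B_def sum_nonneg)
  have split: "(\<Sum>q<Suc p. complex_of_real (t ^ q) * a q)
      = a 0 + complex_of_real t * (\<Sum>q<p. complex_of_real (t ^ q) * a (Suc q))" for t
    by (simp only: sum.lessThan_Suc_shift) (simp add: sum_distrib_left mult.assoc)
  have small: "cmod (a 0) \<le> t * (\<bar>C\<bar> + B)" if t: "0 < t" "t < e" "t \<le> 1" for t
  proof -
    have "a 0 = (\<Sum>q<Suc p. complex_of_real (t ^ q) * a q) - complex_of_real t * (\<Sum>q<p. complex_of_real (t ^ q) * a (Suc q))"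
      by (simp only: split) simp
    then have "cmod (a 0) \<le> cmod (\<Sum>q<Suc p. complex_of_real (t ^ q) * a q)
        + cmod (of_real t * (\<Sum>q<p. complex_of_real (t ^ q) * a (Suc q)))"
      by (metis norm_triangle_ineq4)
    also have "cmod (\<Sum>q<Suc p. complex_of_real (t ^ q) * a q) \<le> t * \<bar>C\<bar>"
    proof -
      have "cmod (\<Sum>q<Suc p. complex_of_real (t ^ q) * a q) \<le> C * t ^ Suc p" by (rule Suc.prems(2)[OF t(1,2)])
      also have "\<dots> \<le> \<bar>C\<bar> * (t * 1)"
        using t by (simp only: power_Suc) (intro mult_mono mult_left_mono power_le_one; simp)
      finally show ?thesis by (simp add: mult.commute)
    qed
    also have "cmod (of_real t * (\<Sum>q<p. complex_of_real (t ^ q) * a (Suc q))) \<le> t * B"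
    proof -
      have "cmod (\<Sum>q<p. complex_of_real (t ^ q) * a (Suc q)) \<le> B"
        unfolding B_def
      proof (rule sum_norm_le)
        fix q
        have "t ^ q * cmod (a (Suc q)) \<le> 1 * cmod (a (Suc q))"
          using t by (intro mult_right_mono power_le_one) auto
        then show "cmod (of_real (t ^ q) * a (Suc q)) \<le> cmod (a (Suc q))"
          using t by (simp add: norm_mult norm_power)
      qed
      then show ?thesis using t by (simp add: norm_mult)
    qed
    finally show ?thesis by (simp add: distrib_left)
  qed
  have "a 0 = 0"
  proof (rule ccontr)
    assume n: "a 0 \<noteq> 0"
    define K where "K = \<bar>C\<bar> + B + 1"
    have K: "0 < K" using B0 by (simp add: K_def)
    \<comment> \<open>Small enough for \<open>small\<close> to apply and for its right-hand side to
      be at most half of \<open>cmod (a 0)\<close>, which is the contradiction.\<close>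
    define t where "t = min (min (e / 2) 1) (cmod (a 0) / (2 * K))"
    have t: "0 < t" "t < e" "t \<le> 1" "t \<le> cmod (a 0) / (2 * K)"
    proof -
      show "0 < t" "t \<le> 1" "t \<le> cmod (a 0) / (2 * K)" using assms(1) n K by (simp_all add: t_def)
      have "t \<le> e / 2" by (simp add: t_def)
      then show "t < e" using assms(1) by simp
    qed
    have "cmod (a 0) \<le> t * (\<bar>C\<bar> + B)" by (rule small) fact+
    also have "\<dots> \<le> cmod (a 0) / (2 * K) * K" using t B0 by (intro mult_mono) (auto simp: K_def)
    also have "\<dots> = cmod (a 0) / 2" using K by simp
    finally show False using n by simp
  qed
  moreover have "a (Suc q) = 0" if "q < p" for q
  proof (rule Suc.IH[of q "\<lambda>q. a (Suc q)", OF that])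
    fix t :: real assume t: "0 < t" "t < e"
    have "cmod (of_real t * (\<Sum>q<p. complex_of_real (t ^ q) * a (Suc q))) \<le> C * t ^ Suc p"
      using Suc.prems(2)[OF t] by (simp only: split \<open>a 0 = 0\<close>) simp
    then show "cmod (\<Sum>q<p. complex_of_real (t ^ q) * a (Suc q)) \<le> C * t ^ p"
      using t by (simp add: norm_mult mult_ac)
  qed
  ultimately show ?case using Suc.prems(1) by (cases q) auto
qed simp

definition supported :: "nat \<Rightarrow> (nat \<Rightarrow> complex) set" where
  "supported d = {x. app (proj d) x = x}"

text \<open>Finite dimension: an operator is bounded by the sum of the norms of its columns. Only
  the existence of a bound is used later, never its value.\<close>

lemma form_bd_supported_exists: "\<exists>N\<ge>0. form_bd d (supported d) N X"
proof -
  let ?N = "\<Sum>k<d. nrm d (app X (unit_seq k))"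
  have "cmod (ip d (app X x) y) \<le> ?N * nrm d x * nrm d y" if "x \<in> supported d" for x y
  proof -
    have *: "ip d (app X x) y = ip d (app (X * proj d) x) y" using that by (simp add: supported_def app_mult)
    have "ip d (app (X * proj d) x) y = ip d (app (X * proj d * proj d) x) y" by (simp add: mult.assoc)
    also have "\<dots> = (\<Sum>k<d. ip d (app (X * proj d) (unit_seq k)) y * ip d (app (proj d) x) (unit_seq k))"
      by (rule ip_mult_expand) (simp add: mult.assoc)
    also have "cmod \<dots> \<le> (\<Sum>k<d. nrm d (app X (unit_seq k)) * nrm d x * nrm d y)"
    proof (rule sum_norm_le)
      fix k assume k: "k \<in> {..<d}"
      have P: "app (proj d) (unit_seq k) = unit_seq k" using k by (auto simp: app_proj unit_seq_def fun_eq_iff)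
      have "nrm d (unit_seq k) = 1" using k by (intro nrm_eq_1) (simp add: ip_unit_seq, simp add: unit_seq_def)
      moreover have "cmod (ip d (app (X * proj d) (unit_seq k)) y) \<le> nrm d (app X (unit_seq k)) * nrm d y"
        using cmod_ip_le[of d "app X (unit_seq k)" y] by (simp add: app_mult P)
      moreover have "cmod (ip d (app (proj d) x) (unit_seq k)) \<le> nrm d x * nrm d (unit_seq k)"
        using cmod_ip_le[of d x "unit_seq k"] by simp
      ultimately have "cmod (ip d (app (X * proj d) (unit_seq k)) y) * cmod (ip d (app (proj d) x) (unit_seq k))
         \<le> (nrm d (app X (unit_seq k)) * nrm d y) * (nrm d x * 1)"
        by (intro mult_mono) auto
      then show "cmod (ip d (app (X * proj d) (unit_seq k)) y * ip d (app (proj d) x) (unit_seq k))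
        \<le> nrm d (app X (unit_seq k)) * nrm d x * nrm d y"
        by (simp add: norm_mult mult_ac)
    qed
    finally show ?thesis unfolding * by (simp add: sum_distrib_right)
  qed
  then show ?thesis by (intro exI[of _ ?N]) (auto simp: form_bd_def sum_nonneg)
qed

context splitting
begin

lemma nested_bd_supported_exists: "\<exists>N\<ge>0. nested_bd d (supported d) (range h) p N X"
proof (induction p arbitrary: X)
  case 0
  then show ?case using form_bd_supported_exists by simp
next
  case (Suc p)
  obtain N1 N2 where "0 \<le> N1" "nested_bd d (supported d) (range h) p N1 (comm_op (h True) X)"
    "0 \<le> N2" "nested_bd d (supported d) (range h) p N2 (comm_op (h False) X)"
    using Suc by metis
  then show ?case
    by (intro exI[of _ "max N1 N2"]) (auto simp: UNIV_bool intro: nested_bd_mono)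
qed

lemma stable_supported: "stable (supported d)"
  by (simp add: stable_def invariant_def supported_def UP flip: app_mult)

section \<open>The generator of the error\<close>

primrec F0 :: "(real \<times> bool) list \<Rightarrow> real \<Rightarrow> op" where
  "F0 [] t = 0"
| "F0 (g # gs) t = Heis (g # gs) t (scal (- \<i> * fst g) * h (snd g)) + F0 gs t"

definition F :: "(real \<times> bool) list \<Rightarrow> real \<Rightarrow> op" where
  "F gs t = F0 gs t + Heis gs t (scal \<i> * (h False + h True))"

definition G :: "(real \<times> bool) list \<Rightarrow> real \<Rightarrow> op" where
  "G gs t = UH (- t) * S gs t"

text \<open>Differentiating the exponential of g inserts its generator next to it. Multiplying the
  conjugated generator by \<open>S (g # gs) t\<close> from the left cancels the inverse product and
  puts the generator in exactly this place, up to its commuting with its own exponential.\<close>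

lemma S_deriv: "op_deriv d (S gs) (S gs t * F0 gs t) t"
proof (induction gs)
  case Nil
  have "S [] = (\<lambda>t. proj d)" by (simp add: fun_eq_iff)
  then show ?case by (simp add: op_deriv_const)
next
  case (Cons g gs)
  obtain c b where g: "g = (c, b)" by (cases g)
  have "op_deriv d (\<lambda>s. U b (c * s)) (scal c * (scal (-\<i>) * (U b (c * t) * h b))) t"
    using U[of b] op_deriv_scale[of d "U b" _ c t] by (simp add: unitary_group_def)
  from op_deriv_mult[OF this Cons]
  have "op_deriv d (\<lambda>s. U b (c * s) * S gs s)
    (scal c * (scal (-\<i>) * (U b (c * t) * h b)) * S gs t + U b (c * t) * (S gs t * F0 gs t)) t"
    by (simp add: UP mult.assoc)
  moreover have "S (g # gs) = (\<lambda>s. U b (c * s) * S gs s)" by (simp add: g fun_eq_iff)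
  moreover have "S (g # gs) t * F0 (g # gs) t
     = scal c * (scal (-\<i>) * (U b (c * t) * h b)) * S gs t + U b (c * t) * (S gs t * F0 gs t)"
  proof -
    have "h b * U b (c * t) = U b (c * t) * h b"
      by (rule unitary_group_commute[OF U]) (simp_all add: UP)
    moreover have "S (g # gs) t * Heis (g # gs) t (scal (- \<i> * c) * h b)
        = scal (- \<i> * c) * ((S (g # gs) t * Sinv (g # gs) t) * h b * S (g # gs) t)"
      by (simp only: Heis_def mult.assoc scal_left_commute[of "Sinv (g # gs) t"] scal_left_commute[of "S (g # gs) t"])
    ultimately have "S (g # gs) t * Heis (g # gs) t (scal (- \<i> * c) * h b)
        = scal c * (scal (-\<i>) * (U b (c * t) * h b)) * S gs t"
      by (simp only: S_Sinv UP) (simp add: g mult.assoc scal_scalar mult.commute[of "complex_of_real c"] flip: mult.assoc[of "h b"])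
    then show ?thesis by (simp add: g distrib_left mult.assoc)
  qed
  ultimately show ?case by simp
qed

lemma UH_deriv: "op_deriv d (\<lambda>s. UH (- s)) (scal \<i> * (UH (- t) * (h False + h True))) t"
proof -
  have "op_deriv d (\<lambda>s. UH ((-1) * s)) (scal (complex_of_real (-1)) * (scal (-\<i>) * (UH ((-1) * t) * (h False + h True)))) t"
    by (rule op_deriv_scale) (use UH in \<open>simp add: unitary_group_def\<close>)
  then show ?thesis by (simp add: scal_scalar)
qed

lemma G_deriv: "op_deriv d (G gs) (G gs t * F gs t) t"
proof -
  have "op_deriv d (\<lambda>s. UH (- s) * S gs s)
     (scal \<i> * (UH (- t) * (h False + h True)) * S gs t + UH (- t) * (S gs t * F0 gs t)) t"
    by (rule op_deriv_mult[OF UH_deriv S_deriv]) (simp_all add: UP mult.assoc distrib_right)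
  moreover have "S gs t * Heis gs t (scal \<i> * (h False + h True))
     = scal \<i> * ((S gs t * Sinv gs t) * (h False + h True) * S gs t)"
    by (simp only: Heis_def mult.assoc scal_left_commute[of "Sinv gs t"] scal_left_commute[of "S gs t"])
  then have "G gs t * F gs t
     = scal \<i> * (UH (- t) * (h False + h True)) * S gs t + UH (- t) * (S gs t * F0 gs t)"
    by (simp add: G_def F_def distrib_left distrib_right mult.assoc S_Sinv UPZ scal_left_commute[of "UH (-t)"])
  moreover have "G gs = (\<lambda>s. UH (- s) * S gs s)" by (simp add: fun_eq_iff G_def)
  ultimately show ?thesis by simp
qed

text \<open>The conclusion of \<open>heis_taylor\<close> for a set of operators at once, in a form
  that is closed under sums and scalar multiples, so that it passes to F.\<close>

definition taylor :: "op set \<Rightarrow> nat \<Rightarrow> real \<Rightarrow> (real \<Rightarrow> op) \<Rightarrow> bool" where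
  "taylor Xs p K X \<longleftrightarrow> (\<exists>Q. poly_lt p Q \<and> (\<forall>W N t. stable W \<longrightarrow> 0 \<le> N \<longrightarrow>
     (\<forall>Y\<in>Xs. nested_bd d W (range h) p N Y) \<longrightarrow> 0 \<le> t \<longrightarrow> form_bd d W (K * t ^ p * N) (X t - Q t)))"

lemma taylor_zero: "taylor Xs p 0 (\<lambda>t. 0)"
  unfolding taylor_def by (intro exI[of _ "\<lambda>t. 0"]) (simp add: poly_lt_zero form_bd_zero)

lemma taylor_add:
  assumes "taylor Xs p K X" "taylor Xs p L Y"
  shows "taylor Xs p (K + L) (\<lambda>t. X t + Y t)"
proof -
  obtain Q where Q: "poly_lt p Q"
    and QB: "\<And>W N t. stable W \<Longrightarrow> 0 \<le> N \<Longrightarrow> (\<forall>Y\<in>Xs. nested_bd d W (range h) p N Y) \<Longrightarrow> 0 \<le> t \<Longrightarrow>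
      form_bd d W (K * t ^ p * N) (X t - Q t)" using assms(1) unfolding taylor_def by blast
  obtain R where R: "poly_lt p R"
    and RB: "\<And>W N t. stable W \<Longrightarrow> 0 \<le> N \<Longrightarrow> (\<forall>Y\<in>Xs. nested_bd d W (range h) p N Y) \<Longrightarrow> 0 \<le> t \<Longrightarrow>
      form_bd d W (L * t ^ p * N) (Y t - R t)" using assms(2) unfolding taylor_def by blast
  have "form_bd d W ((K + L) * t ^ p * N) (X t + Y t - (Q t + R t))"
    if "stable W" "0 \<le> N" "\<forall>Y\<in>Xs. nested_bd d W (range h) p N Y" "0 \<le> t" for W N t
    using form_bd_add[OF QB[OF that] RB[OF that]] by (simp add: distrib_right add_diff_add)
  then show ?thesis using poly_lt_add[OF Q R] unfolding taylor_def by blast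
qed

lemma taylor_scalar:
  assumes "taylor Xs p K X"
  shows "taylor Xs p (cmod c * K) (\<lambda>t. scal c * X t)"
proof -
  obtain Q where Q: "poly_lt p Q"
    and bd: "\<And>W N t. stable W \<Longrightarrow> 0 \<le> N \<Longrightarrow> (\<forall>Y\<in>Xs. nested_bd d W (range h) p N Y) \<Longrightarrow> 0 \<le> t \<Longrightarrow>
      form_bd d W (K * t ^ p * N) (X t - Q t)" using assms unfolding taylor_def by blast
  have "form_bd d W (cmod c * K * t ^ p * N) (scal c * X t - scal c * Q t)"
    if "stable W" "0 \<le> N" "\<forall>Y\<in>Xs. nested_bd d W (range h) p N Y" "0 \<le> t" for W N t
    using form_bd_scalar[OF bd[OF that], of c] by (simp add: right_diff_distrib mult.assoc)
  then show ?thesis using poly_lt_scalar[OF Q] unfolding taylor_def by blast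
qed

lemma taylor_Heis: "X \<in> Xs \<Longrightarrow> taylor Xs p (heis_const gs p) (\<lambda>t. Heis gs t X)"
  using heis_taylor[of p X gs] unfolding taylor_def by meson

lemma taylor_F0: "taylor (range h) p (gen_const gs p) (F0 gs)"
proof (induction gs)
  case Nil
  have "F0 [] = (\<lambda>t. 0)" by (simp add: fun_eq_iff)
  then show ?case by (simp add: taylor_zero)
next
  case (Cons g gs)
  have "F0 (g # gs) = (\<lambda>t. scal (- \<i> * fst g) * Heis (g # gs) t (h (snd g)) + F0 gs t)"
    by (simp add: fun_eq_iff Heis_scalar)
  moreover have "gen_const (g # gs) p = cmod (- \<i> * fst g) * heis_const (g # gs) p + gen_const gs p"
    by (simp add: norm_mult)
  ultimately show ?case
    by (simp only:) (intro taylor_add taylor_scalar taylor_Heis Cons rangeI)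
qed

lemma taylor_F: "taylor (range h) p (gen_const gs p + 2 * heis_const gs p) (F gs)"
proof -
  have "F gs = (\<lambda>t. F0 gs t + (scal \<i> * Heis gs t (h False) + scal \<i> * Heis gs t (h True)))"
    by (simp add: fun_eq_iff F_def Heis_scalar Heis_add distrib_left)
  moreover have "gen_const gs p + 2 * heis_const gs p
      = gen_const gs p + (cmod \<i> * heis_const gs p + cmod \<i> * heis_const gs p)" by simp
  ultimately show ?thesis
    by (simp only:) (intro taylor_add taylor_scalar taylor_Heis taylor_F0 rangeI)
qed

lemma ip_G: "ip d (app (G gs t) x) y = ip d x (app (Sinv gs t) (app (UH t) y))"
  using UH by (simp add: G_def app_mult ip_S unitary_group_def)

lemma UH_nrm: "nrm d (app (UH s) x) = nrm d x"
  by (rule unitary_group_nrm[OF UH])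

lemma G_0: "G gs 0 = proj d"
proof -
  have "S gs 0 = proj d"
    by (induction gs) (use U in \<open>auto simp: unitary_group_def\<close>)
  then show ?thesis using UH by (simp add: G_def unitary_group_def)
qed

lemma error_G: "ip d (app (S gs t - UH t) x) y = ip d (app (G gs t - proj d) x) (app (UH (- t)) y)"
proof -
  have "UH t * G gs t = S gs t"
    by (simp add: G_def unitary_group_inverse[OF UH] S_P flip: mult.assoc)
  then have "S gs t - UH t = UH t * (G gs t - proj d)" by (simp add: right_diff_distrib UP)
  then show ?thesis using UH by (simp add: app_mult unitary_group_def)
qed

lemma G_error: "ip d (app (G gs t - proj d) x) y = ip d (app (S gs t - UH t) x) (app (UH t) y)"
proof -
  have "G gs t - proj d = UH (- t) * (S gs t - UH t)"
    by (simp add: G_def right_diff_distrib unitary_group_inverse[OF UH])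
  then show ?thesis using UH by (simp add: app_mult unitary_group_def)
qed

text \<open>G is moved to the second vector, where it becomes a product of exponentials that
  preserves both W and the norm.\<close>

lemma form_bd_GF:
  assumes "stable W" "form_bd d W K X" "x \<in> W" "y \<in> W"
  shows "cmod (ip d (app (G gs s * X) x) y) \<le> K * nrm d x * nrm d y"
proof -
  have "app (Sinv gs s) (app (UH s) y) \<in> W"
    using assms by (intro Sinv_inv) (auto simp: stable_def invariant_def)
  then have "cmod (ip d (app X x) (app (Sinv gs s) (app (UH s) y))) \<le> K * nrm d x * nrm d (app (Sinv gs s) (app (UH s) y))"
    using assms by (simp add: form_bd_def)
  then show ?thesis by (simp add: app_mult ip_G nrm_Sinv UH_nrm)
qed

definition order_at_least :: "nat \<Rightarrow> (real \<times> bool) list \<Rightarrow> bool" where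
  "order_at_least p gs \<longleftrightarrow> (\<exists>c e. 0 < e \<and> (\<forall>t x y. 0 < t \<longrightarrow> t < e \<longrightarrow> x \<in> supported d \<longrightarrow> y \<in> supported d \<longrightarrow>
     cmod (ip d (app (S gs t - UH t) x) y) \<le> c * t ^ (p + 1) * nrm d x * nrm d y))"

text \<open>The order condition says that G differs from the identity by O(t^(p+1)), and F - Q is
  O(t^p). Hence G F - Q = (G - 1) Q + G (F - Q) is O(t^p). Integrating, the antiderivative of Q is
  O(t^(p+1)) although its degree is at most p, so its coefficients vanish, and with them those of
  Q.\<close>

lemma poly_part_vanishes:
  assumes ord: "order_at_least p gs" and p: "0 < p" and Q: "poly_lt p Q"
    and K: "0 \<le> K" "\<And>t. 0 \<le> t \<Longrightarrow> form_bd d (supported d) (K * t ^ p) (F gs t - Q t)"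
    and xy: "x \<in> supported d" "y \<in> supported d"
  shows "ip d (app (Q t) x) y = 0"
proof -
  obtain Y where Y: "\<And>t. Q t = (\<Sum>q<p. scal (of_real (t ^ q)) * Y q)"
    using Q by (auto simp: poly_lt_def)
  define z where "z q = ip d (app (Y q) x) y" for q
  have Qz: "ip d (app (Q t) x) y = (\<Sum>q<p. complex_of_real (t ^ q) * z q)" for t
    by (simp add: Y z_def ip_app)
  obtain c e where e: "0 < e" and c: "\<And>t x y. 0 < t \<Longrightarrow> t < e \<Longrightarrow> x \<in> supported d \<Longrightarrow> y \<in> supported d \<Longrightarrow>
     cmod (ip d (app (S gs t - UH t) x) y) \<le> c * t ^ (p + 1) * nrm d x * nrm d y"
    using ord unfolding order_at_least_def by blast
  define c' where "c' = \<bar>c\<bar>"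
  \<comment> \<open>Stated for every sequence u, because it will be applied to
    \<open>app (Q s) x\<close>, which is not known to be supported on the first d coordinates;
    \<open>proj d\<close> cuts it off.\<close>
  have GP: "cmod (ip d (app (G gs s - proj d) u) y) \<le> c' * s ^ (p + 1) * nrm d u * nrm d y"
    if s: "0 \<le> s" "s < e" for s u
  proof (cases "s = 0")
    case False
    have PG: "(G gs s - proj d) * proj d = G gs s - proj d" by (simp add: G_def left_diff_distrib mult.assoc S_P)
    have u: "app (proj d) u \<in> supported d" by (simp add: supported_def flip: app_mult)
    have y: "app (UH s) y \<in> supported d" by (simp add: supported_def UP flip: app_mult)
    have "ip d (app (G gs s - proj d) u) y = ip d (app (G gs s - proj d) (app (proj d) u)) y"
      by (metis PG app_mult)
    also have "\<dots> = ip d (app (S gs s - UH s) (app (proj d) u)) (app (UH s) y)" by (rule G_error)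
    also have "cmod \<dots> \<le> c * s ^ (p + 1) * nrm d (app (proj d) u) * nrm d (app (UH s) y)"
      by (rule c) (use s False u y in auto)
    also have "\<dots> \<le> c' * s ^ (p + 1) * nrm d u * nrm d y"
      using s by (simp add: UH_nrm c'_def mult_right_mono)
    finally show ?thesis .
  qed (simp add: G_0)
  define M where "M = (\<Sum>q<p. nrm d (app (Y q) x))"
  have QM: "nrm d (app (Q s) x) \<le> M" if s: "0 \<le> s" "s \<le> 1" for s
  proof -
    have "nrm d (\<lambda>i. \<Sum>q\<in>A. f q i) \<le> (\<Sum>q\<in>A. nrm d (f q))" for f and A :: "nat set"
      by (induction A rule: infinite_finite_induct) (auto intro: order_trans[OF nrm_triangle])
    then have "nrm d (app (Q s) x) \<le> (\<Sum>q<p. nrm d (app (scal (complex_of_real (s ^ q)) * Y q) x))"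
      by (simp add: Y app_sum)
    also have "\<dots> \<le> M" unfolding M_def
    proof (rule sum_mono)
      fix q
      have "s ^ q * nrm d (app (Y q) x) \<le> 1 * nrm d (app (Y q) x)"
        using s by (intro mult_right_mono power_le_one) auto
      then show "nrm d (app (scal (complex_of_real (s ^ q)) * Y q) x) \<le> nrm d (app (Y q) x)"
        using s by (simp add: app_mult app_scalar nrm_smult norm_power)
    qed
    finally show ?thesis .
  qed
  have M0: "0 \<le> M" by (simp add: M_def sum_nonneg)
  \<comment> \<open>This is G minus the antiderivative of Q. The coefficient
    \<open>z q / (q + 1)\<close> is written with two factorials so that
    \<open>power_vector_derivative\<close> applies with factor 1.\<close>
  define f where "f s = ip d (app (G gs s) x) y - (\<Sum>q<p. (1 * complex_of_real s) ^ Suc q / fact (Suc q) * (fact q * z q))" for s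
  define f' where "f' s = ip d (app (G gs s * F gs s) x) y - (\<Sum>q<p. complex_of_real (s ^ q) * z q)" for s
  have der: "(f has_vector_derivative f' s) (at s)" for s
  proof -
    have 1: "((\<lambda>s. ip d (app (G gs s) x) y) has_vector_derivative ip d (app (G gs s * F gs s) x) y) (at s)"
      using G_deriv by (simp add: op_deriv_def)
    have "((\<lambda>s. \<Sum>q<p. (1 * complex_of_real s) ^ Suc q / fact (Suc q) * (fact q * z q)) has_vector_derivative
       (\<Sum>q<p. 1 * ((1 * complex_of_real s) ^ q / fact q) * (fact q * z q))) (at s)"
      by (intro has_vector_derivative_sum has_vector_derivative_mult_left power_vector_derivative)
    then show ?thesis using has_vector_derivative_diff[OF 1] unfolding f_def[abs_def] f'_def by simp
  qed
  define B where "B = K * nrm d x * nrm d y + c' * M * nrm d y"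
  have bound: "cmod (f' s) \<le> B * s ^ p" if s: "0 \<le> s" "s < e" "s \<le> 1" for s
  proof -
    have "f' s = ip d (app (G gs s * (F gs s - Q s)) x) y + ip d (app (G gs s - proj d) (app (Q s) x)) y"
      by (simp only: f'_def Qz[symmetric] right_diff_distrib app_diff ip_diff_left) (simp add: app_mult)
    also have "cmod \<dots> \<le> K * s ^ p * nrm d x * nrm d y + c' * s ^ (p + 1) * nrm d (app (Q s) x) * nrm d y"
      by (intro order_trans[OF norm_triangle_ineq] add_mono form_bd_GF[OF stable_supported K(2)] GP s xy)
    also have "c' * s ^ (p + 1) * nrm d (app (Q s) x) * nrm d y \<le> c' * s ^ p * M * nrm d y"
    proof -
      have "s ^ (p + 1) \<le> s ^ p" using s by (intro power_decreasing) auto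
      then show ?thesis using QM[OF s(1,3)] s M0
        by (intro mult_right_mono mult_mono mult_left_mono) (auto simp: c'_def)
    qed
    finally show ?thesis by (simp add: B_def algebra_simps)
  qed
  have B0: "0 \<le> B" using K(1) M0 by (simp add: B_def c'_def)
  have f0: "f 0 = ip d x y"
  proof -
    have "f 0 = ip d (app (G gs 0) x) y" by (simp add: f_def)
    then show ?thesis by (simp add: G_0)
  qed
  have key: "cmod (\<Sum>q<p. complex_of_real (t ^ q) * (z q / of_nat (Suc q))) \<le> (B + c' * nrm d x * nrm d y) * t ^ p"
    if t: "0 < t" "t < min e 1" for t
  proof -
    have fb: "cmod (f t - f 0) \<le> (B * t ^ p) * (t - 0)"
    proof (rule vector_derivative_bound[OF _ der])
      fix s assume s: "0 \<le> s" "s \<le> t"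
      have "cmod (f' s) \<le> B * s ^ p" using s t by (intro bound) auto
      also have "\<dots> \<le> B * t ^ p" using s B0 by (intro mult_left_mono power_mono) auto
      finally show "cmod (f' s) \<le> B * t ^ p" .
    qed (use t in simp)
    have "complex_of_real t * (\<Sum>q<p. complex_of_real (t ^ q) * (z q / of_nat (Suc q)))
        = (\<Sum>q<p. (1 * of_real t) ^ Suc q / fact (Suc q) * (fact q * z q))"
      unfolding sum_distrib_left
      by (intro sum.cong refl) (simp only: fact_Suc of_nat_mult, simp add: divide_simps del: of_nat_Suc)
    also have "\<dots> = ip d (app (G gs t - proj d) x) y - (f t - f 0)"
      by (simp only: f0) (simp add: f_def app_diff ip_diff_left)
    also have "cmod \<dots> \<le> c' * t ^ (p + 1) * nrm d x * nrm d y + (B * t ^ p) * (t - 0)"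
      by (intro order_trans[OF norm_triangle_ineq4] add_mono fb GP) (use t in auto)
    finally have "t * cmod (\<Sum>q<p. complex_of_real (t ^ q) * (z q / of_nat (Suc q))) \<le> t * ((B + c' * nrm d x * nrm d y) * t ^ p)"
      using t by (simp add: norm_mult algebra_simps)
    then show ?thesis using t by simp
  qed
  have "z q = 0" if "q < p" for q
  proof -
    have "z q / of_nat (Suc q) = 0"
      by (rule polynomial_coeffs_zero[where e = "min e 1" and p = p and a = "\<lambda>q. z q / of_nat (Suc q)", OF _ key that]) (use e in auto)
    then show ?thesis by (simp del: of_nat_Suc)
  qed
  then show ?thesis by (simp add: Qz)
qed

theorem error_bound:
  assumes ord: "order_at_least p gs" and p: "0 < p" and W: "stable W" and N: "0 \<le> N"
    and nested_bd: "\<And>b. nested_bd d W (range h) p N (h b)" and t: "0 \<le> t"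
  shows "form_bd d W ((gen_const gs p + 2 * heis_const gs p) * t ^ (p + 1) * N) (S gs t - UH t)"
proof -
  let ?K = "gen_const gs p + 2 * heis_const gs p"
  have K: "0 \<le> ?K" by (simp add: gen_const_nonneg heis_const_nonneg)
  obtain Q where Q: "poly_lt p Q" and QB: "\<And>W N t. stable W \<Longrightarrow> 0 \<le> N \<Longrightarrow> (\<forall>Y\<in>range h. nested_bd d W (range h) p N Y) \<Longrightarrow> 0 \<le> t \<Longrightarrow>
     form_bd d W (?K * t ^ p * N) (F gs t - Q t)" using taylor_F[of p gs] unfolding taylor_def by blast
  obtain N1 N2 where N12: "0 \<le> N1" "nested_bd d (supported d) (range h) p N1 (h True)"
    "0 \<le> N2" "nested_bd d (supported d) (range h) p N2 (h False)"
    using nested_bd_supported_exists by metis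
  \<comment> \<open>A bound for the nested commutators on the whole space. It depends on the
    Hamiltonian, but it is used only to show that Q vanishes and does not enter the final
    estimate.\<close>
  define N0 where "N0 = max N1 N2"
  have N0: "0 \<le> N0" "nested_bd d (supported d) (range h) p N0 (h b)" for b
    using N12 by (cases b; auto simp: N0_def intro: nested_bd_mono)+
  have Q0: "ip d (app (Q s) x) y = 0" if "x \<in> supported d" "y \<in> supported d" for s x y
  proof (rule poly_part_vanishes[OF ord p Q _ _ that, of "?K * N0"])
    show "0 \<le> ?K * N0" using K N0 by simp
    show "form_bd d (supported d) (?K * N0 * t ^ p) (F gs t - Q t)" if "0 \<le> t" for t
      using QB[OF stable_supported N0(1) _ that] N0(2) by (simp add: mult_ac)
  qed
  have WW: "x \<in> supported d" if "x \<in> W" for x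
    using W that by (simp add: stable_def invariant_def supported_def)
  show ?thesis unfolding form_bd_def
  proof (intro ballI)
    fix x y assume xy: "x \<in> W" "y \<in> W"
    \<comment> \<open>With the exact evolution moved to the second vector, the error becomes the
      increment of G between 0 and t.\<close>
    define y' where "y' = app (UH (- t)) y"
    have y': "y' \<in> W" using W xy by (simp add: y'_def stable_def invariant_def)
    have "cmod (ip d (app (G gs t) x) y' - ip d (app (G gs 0) x) y') \<le> (?K * t ^ p * N * nrm d x * nrm d y') * (t - 0)"
    proof (rule vector_derivative_bound[where f' = "\<lambda>s. ip d (app (G gs s * F gs s) x) y'"])
      fix s assume s: "0 \<le> s" "s \<le> t"
      show "((\<lambda>s. ip d (app (G gs s) x) y') has_vector_derivative ip d (app (G gs s * F gs s) x) y') (at s)"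
        using G_deriv by (simp add: op_deriv_def)
      have "ip d (app (G gs s * Q s) x) y' = 0"
        unfolding app_mult ip_G
        using xy y' W Sinv_inv[OF W, of "app (UH s) y'" gs s]
        by (intro Q0 WW) (auto simp: stable_def invariant_def)
      then have "ip d (app (G gs s * F gs s) x) y' = ip d (app (G gs s * (F gs s - Q s)) x) y'"
        by (simp add: right_diff_distrib app_diff ip_diff_left)
      also have "cmod \<dots> \<le> ?K * s ^ p * N * nrm d x * nrm d y'"
        using nested_bd by (intro form_bd_GF[OF W QB[OF W N]] s xy y') auto
      also have "\<dots> \<le> ?K * t ^ p * N * nrm d x * nrm d y'"
        using s N K by (intro mult_right_mono mult_left_mono power_mono) auto
      finally show "cmod (ip d (app (G gs s * F gs s) x) y') \<le> ?K * t ^ p * N * nrm d x * nrm d y'" .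
    qed (use t in simp)
    then show "cmod (ip d (app (S gs t - UH t) x) y) \<le> ?K * t ^ (p + 1) * N * nrm d x * nrm d y"
      by (subst error_G) (simp add: app_diff ip_diff_left G_0 y'_def UH_nrm mult_ac)
  qed
qed

end

section \<open>Nested commutators on the particle sector\<close>

text \<open>Linear programming duality: a maximal set K of \<open>\<eta>\<close> indices consists of those above a threshold \<open>\<theta>\<close>,
  and weight outside K can be exchanged for missing weight inside K at price \<open>\<theta>\<close>.\<close>

lemma weighted_sum_le_top:
  fixes f w :: "nat \<Rightarrow> real"
  assumes f: "\<And>j. j < n \<Longrightarrow> 0 \<le> f j" and w: "\<And>j. j < n \<Longrightarrow> 0 \<le> w j \<and> w j \<le> 1"
    and sw: "(\<Sum>j<n. w j) \<le> real \<eta>" and \<eta>: "1 \<le> \<eta>" "\<eta> \<le> n"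
    and M: "\<And>K. K \<subseteq> {..<n} \<Longrightarrow> card K = \<eta> \<Longrightarrow> (\<Sum>j\<in>K. f j) \<le> M"
  shows "(\<Sum>j<n. f j * w j) \<le> M"
proof -
  define \<K> where "\<K> = {K. K \<subseteq> {..<n} \<and> card K = \<eta>}"
  have fin: "finite \<K>" unfolding \<K>_def by (rule finite_subset[of _ "Pow {..<n}"]) auto
  have ne: "\<K> \<noteq> {}"
    using obtain_subset_with_card_n[of \<eta> "{..<n}"] \<eta> by (auto simp: \<K>_def)
  have "Max ((\<lambda>K. \<Sum>j\<in>K. f j) ` \<K>) \<in> (\<lambda>K. \<Sum>j\<in>K. f j) ` \<K>"
    using fin ne by (intro Max_in) auto
  then obtain K where K: "K \<in> \<K>" and Kmax: "\<And>L. L \<in> \<K> \<Longrightarrow> (\<Sum>j\<in>L. f j) \<le> (\<Sum>j\<in>K. f j)"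
    using fin by (metis (no_types, lifting) Max_ge finite_imageI image_eqI imageE)
  have Kn: "K \<subseteq> {..<n}" "card K = \<eta>" and finK: "finite K" using K by (auto simp: \<K>_def intro: finite_subset)
  have Kne: "K \<noteq> {}" using Kn \<eta> by auto
  have swap: "f j \<le> f k" if "k \<in> K" "j < n" "j \<notin> K" for j k
  proof -
    have "insert j (K - {k}) \<in> \<K>"
      using that Kn finK \<eta> by (auto simp: \<K>_def)
    from Kmax[OF this] show ?thesis using that finK by (simp add: sum.remove[of K k])
  qed
  define \<theta> where "\<theta> = Min (f ` K)"
  have th1: "\<theta> \<le> f k" if "k \<in> K" for k using that finK by (simp add: \<theta>_def)
  have th2: "f j \<le> \<theta>" if "j < n" "j \<notin> K" for j
    using swap[OF _ that] finK Kne by (simp add: \<theta>_def)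
  have th0: "0 \<le> \<theta>" using f Kn finK Kne by (auto simp: \<theta>_def)
  have s: "(\<Sum>j<n. g j) = (\<Sum>j\<in>K. g j) + (\<Sum>j\<in>{..<n} - K. g j)" for g :: "nat \<Rightarrow> real"
    using sum.subset_diff[OF Kn(1), of g] by simp
  have "(\<Sum>j\<in>K. f j) - (\<Sum>j\<in>K. f j * w j) = (\<Sum>j\<in>K. f j * (1 - w j))"
    by (simp add: algebra_simps sum_subtractf)
  also have "\<dots> \<ge> (\<Sum>j\<in>K. \<theta> * (1 - w j))"
    using th1 w Kn by (intro sum_mono mult_right_mono) auto
  also have "(\<Sum>j\<in>K. \<theta> * (1 - w j)) = \<theta> * (real \<eta> - (\<Sum>j\<in>K. w j))"
    using Kn by (simp add: sum_distrib_left[symmetric] sum_subtractf)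
  finally have 1: "(\<Sum>j\<in>K. f j * w j) \<le> (\<Sum>j\<in>K. f j) - \<theta> * (real \<eta> - (\<Sum>j\<in>K. w j))" by simp
  have 2: "(\<Sum>j\<in>{..<n} - K. f j * w j) \<le> \<theta> * (\<Sum>j\<in>{..<n} - K. w j)"
    unfolding sum_distrib_left using th2 w by (intro sum_mono mult_right_mono) auto
  have "(\<Sum>j<n. f j * w j) \<le> (\<Sum>j\<in>K. f j) - \<theta> * (real \<eta> - (\<Sum>j<n. w j))"
    using 1 2 unfolding s by (simp add: algebra_simps)
  also have "\<dots> \<le> (\<Sum>j\<in>K. f j)" using th0 sw by simp
  also have "\<dots> \<le> M" by (rule M) (use Kn in auto)
  finally show ?thesis .
qed

text \<open>Cauchy-Schwarz with each entry of m split into two square roots: row sums control one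
  factor, and column sums the other after the sums are exchanged.\<close>

lemma schur_test:
  fixes m :: "nat \<Rightarrow> nat \<Rightarrow> real"
  assumes m: "\<And>j k. j < n \<Longrightarrow> k < n \<Longrightarrow> 0 \<le> m j k"
    and row: "\<And>j. j < n \<Longrightarrow> (\<Sum>k<n. m j k) \<le> K" and col: "\<And>k. k < n \<Longrightarrow> (\<Sum>j<n. m j k) \<le> K" and K: "0 \<le> K"
  shows "(\<Sum>j<n. (\<Sum>k<n. m j k * u k)\<^sup>2) \<le> K\<^sup>2 * (\<Sum>k<n. (u k)\<^sup>2)"
proof -
  have "(\<Sum>j<n. (\<Sum>k<n. m j k * u k)\<^sup>2) \<le> (\<Sum>j<n. K * (\<Sum>k<n. m j k * (u k)\<^sup>2))"
  proof (rule sum_mono)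
    fix j assume "j \<in> {..<n}"
    then have j: "j < n" by simp
    have "(\<Sum>k<n. m j k * u k) = (\<Sum>k<n. sqrt (m j k) * (sqrt (m j k) * u k))"
      using m j by (intro sum.cong refl) (simp flip: mult.assoc)
    then have "(\<Sum>k<n. m j k * u k)\<^sup>2 \<le> (\<Sum>k<n. (sqrt (m j k))\<^sup>2) * (\<Sum>k<n. (sqrt (m j k) * u k)\<^sup>2)"
      by (simp only: Cauchy_Schwarz_ineq_sum)
    also have "\<dots> = (\<Sum>k<n. m j k) * (\<Sum>k<n. m j k * (u k)\<^sup>2)"
      using m j by (simp add: power_mult_distrib)
    also have "\<dots> \<le> K * (\<Sum>k<n. m j k * (u k)\<^sup>2)"
      using m j row by (intro mult_right_mono sum_nonneg) auto
    finally show "(\<Sum>k<n. m j k * u k)\<^sup>2 \<le> K * (\<Sum>k<n. m j k * (u k)\<^sup>2)" .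
  qed
  also have "\<dots> = K * (\<Sum>k<n. (\<Sum>j<n. m j k) * (u k)\<^sup>2)"
    by (simp add: sum_distrib_left[symmetric] sum_distrib_right) (subst sum.swap, simp)
  also have "\<dots> \<le> K * (\<Sum>k<n. K * (u k)\<^sup>2)"
    using K col by (intro mult_left_mono sum_mono mult_right_mono) auto
  finally show ?thesis by (simp add: sum_distrib_left power2_eq_square mult.assoc)
qed

section \<open>Bounds on iterated derivations\<close>

text \<open>\<open>graded \<delta> \<mu> P p K X\<close>: up to p-fold derivatives of X under the derivations \<open>\<delta>\<close> satisfy the bound P,
  with an extra factor \<open>\<mu>\<close> per derivative.\<close>

primrec graded :: "(bool \<Rightarrow> 'b \<Rightarrow> 'b) \<Rightarrow> real \<Rightarrow> (real \<Rightarrow> 'b \<Rightarrow> bool) \<Rightarrow> nat \<Rightarrow> real \<Rightarrow> 'b \<Rightarrow> bool" where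
  "graded \<delta> \<mu> P 0 K X = P K X"
| "graded \<delta> \<mu> P (Suc p) K X = (P K X \<and> (\<forall>b. graded \<delta> \<mu> P p (K * \<mu>) (\<delta> b X)))"

lemma graded_mono:
  assumes "\<And>K L X. P K X \<Longrightarrow> K \<le> L \<Longrightarrow> P L X" "0 \<le> \<mu>"
  shows "graded \<delta> \<mu> P p K X \<Longrightarrow> K \<le> L \<Longrightarrow> graded \<delta> \<mu> P p L X"
proof (induction p arbitrary: K L X)
  case (Suc p)
  have "graded \<delta> \<mu> P p (L * \<mu>) (\<delta> b X)" for b
    by (rule Suc.IH[of "K * \<mu>"]) (use Suc.prems assms(2) in \<open>auto intro: mult_right_mono\<close>)
  moreover have "P L X" by (rule assms(1)[OF _ Suc.prems(2)]) (use Suc.prems in simp)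
  ultimately show ?case by simp
next
  case 0
  then show ?case using assms(1)[of K X L] by simp
qed

lemma graded_antimono: "graded \<delta> \<mu> P p K X \<Longrightarrow> q \<le> p \<Longrightarrow> graded \<delta> \<mu> P q K X"
proof (induction p arbitrary: q K X)
  case (Suc p)
  then show ?case by (cases q) auto
qed simp

lemma graded_imp:
  assumes "\<And>K X. 0 \<le> K \<Longrightarrow> P K X \<Longrightarrow> Q (a * K) X" "0 \<le> \<mu>"
  shows "0 \<le> K \<Longrightarrow> graded \<delta> \<mu> P p K X \<Longrightarrow> graded \<delta> \<mu> Q p (a * K) X"
proof (induction p arbitrary: K X)
  case (Suc p)
  have "graded \<delta> \<mu> Q p (a * (K * \<mu>)) (\<delta> b X)" for b
    using Suc.prems assms(2) by (intro Suc.IH) auto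
  then show ?case using Suc.prems assms(1) by (simp add: mult.assoc)
qed (use assms in auto)

lemma graded_add:
  assumes "\<And>K L X Y. P K X \<Longrightarrow> P L Y \<Longrightarrow> P (K + L) (pl X Y)" "\<And>b X Y. \<delta> b (pl X Y) = pl (\<delta> b X) (\<delta> b Y)"
  shows "graded \<delta> \<mu> P p K X \<Longrightarrow> graded \<delta> \<mu> P p L Y \<Longrightarrow> graded \<delta> \<mu> P p (K + L) (pl X Y)"
  by (induction p arbitrary: K L X Y) (auto simp: assms distrib_right)

lemma graded_map:
  assumes "\<And>K X. P K X \<Longrightarrow> P K (f X)" "\<And>b X. \<delta> b (f X) = f (\<delta> b X)"
  shows "graded \<delta> \<mu> P p K X \<Longrightarrow> graded \<delta> \<mu> P p K (f X)"
  by (induction p arbitrary: K X) (auto simp: assms)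

text \<open>For objects killed by every derivation, in practice scalars and matrices of scalars; z
  stands for the zero of the type, an operator in some uses and an operator-valued matrix in
  others.\<close>

lemma graded_const:
  assumes "\<And>K. 0 \<le> K \<Longrightarrow> P K z" "\<And>b. \<delta> b z = z" "\<And>b. \<delta> b X = z" "P K X" "0 \<le> K" "0 \<le> \<mu>"
  shows "graded \<delta> \<mu> P p K X"
proof -
  have "graded \<delta> \<mu> P q L z" if "0 \<le> L" for q L
    using that by (induction q arbitrary: L) (use assms in auto)
  then show ?thesis using assms by (cases p) auto
qed

text \<open>The Leibniz rule distributes p derivations over two factors in \<open>2 ^ p\<close>
  ways, each with the same number of factors \<open>\<mu>\<close>. The three bounds may differ, so
  that products of a Schur bound and a pairing bound are covered as well.\<close>

lemma graded_mult:
  assumes PQ: "\<And>K L X Y. 0 \<le> K \<Longrightarrow> 0 \<le> L \<Longrightarrow> P K X \<Longrightarrow> Q L Y \<Longrightarrow> R (K * L) (mu X Y)"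
    and ad: "\<And>K L X Y. R K X \<Longrightarrow> R L Y \<Longrightarrow> R (K + L) (pl X Y)"
    and mono: "\<And>K L X. R K X \<Longrightarrow> K \<le> L \<Longrightarrow> R L X"
    and \<delta>: "\<And>b X Y. \<delta> b (mu X Y) = pl (mu (\<delta> b X) Y) (mu X (\<delta> b Y))"
      "\<And>b X Y. \<delta> b (pl X Y) = pl (\<delta> b X) (\<delta> b Y)"
    and "0 \<le> \<mu>"
  shows "0 \<le> K \<Longrightarrow> 0 \<le> L \<Longrightarrow> graded \<delta> \<mu> P p K X \<Longrightarrow> graded \<delta> \<mu> Q p L Y \<Longrightarrow> graded \<delta> \<mu> R p (2 ^ p * (K * L)) (mu X Y)"
proof (induction p arbitrary: K L X Y)
  case 0
  then show ?case using PQ by simp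
next
  case (Suc p)
  have "R (K * L) (mu X Y)" using Suc.prems PQ by simp
  moreover have "K * L \<le> 2 ^ Suc p * (K * L)"
  proof -
    have "1 * (K * L) \<le> 2 ^ Suc p * (K * L)"
      using Suc.prems by (intro mult_right_mono one_le_power) auto
    then show ?thesis by simp
  qed
  ultimately have 1: "R (2 ^ Suc p * (K * L)) (mu X Y)" by (rule mono)
  have "graded \<delta> \<mu> R p (2 ^ Suc p * (K * L) * \<mu>) (\<delta> b (mu X Y))" for b
  proof -
    have "graded \<delta> \<mu> R p (2 ^ p * ((K * \<mu>) * L)) (mu (\<delta> b X) Y)"
      using Suc.prems assms(6) graded_antimono[of \<delta> \<mu> Q "Suc p" L Y p] by (intro Suc.IH) auto
    moreover have "graded \<delta> \<mu> R p (2 ^ p * (K * (L * \<mu>))) (mu X (\<delta> b Y))"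
      using Suc.prems assms(6) graded_antimono[of \<delta> \<mu> P "Suc p" K X p] by (intro Suc.IH) auto
    ultimately have "graded \<delta> \<mu> R p (2 ^ p * ((K * \<mu>) * L) + 2 ^ p * (K * (L * \<mu>))) (pl (mu (\<delta> b X) Y) (mu X (\<delta> b Y)))"
      by (rule graded_add[where pl = pl and \<delta> = \<delta> and P = R, rotated 2]) (auto intro: ad simp: \<delta>(2))
    then show ?thesis by (simp add: \<delta>(1) algebra_simps)
  qed
  then show ?case using 1 by simp
qed

lemma comm_op_add: "comm_op X (Y + Z) = comm_op X Y + comm_op X Z"
  by (simp add: comm_op_def algebra_simps)
lemma comm_op_uminus: "comm_op X (- Y) = - comm_op X Y"
  by (simp add: comm_op_def)
lemma comm_op_zero [simp]: "comm_op X 0 = 0"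
  by (simp add: comm_op_def)
lemma comm_op_self [simp]: "comm_op X X = 0"
  by (simp add: comm_op_def)
lemma comm_op_scalar [simp]: "comm_op X (scal c) = 0"
  by (simp add: comm_op_def scal_commute)
lemma comm_op_mult: "comm_op X (Y * Z) = comm_op X Y * Z + Y * comm_op X Z"
  by (simp add: comm_op_def algebra_simps)
lemma comm_op_sum: "comm_op X (\<Sum>k\<in>A. Y k) = (\<Sum>k\<in>A. comm_op X (Y k))"
  by (induction A rule: infinite_finite_induct) (auto simp: comm_op_add)

section \<open>Operator-valued matrices and second quantization\<close>

type_synonym block = "nat \<Rightarrow> nat \<Rightarrow> op"

definition badd :: "block \<Rightarrow> block \<Rightarrow> block" where "badd M M' = (\<lambda>j k. M j k + M' j k)"
definition buminus :: "block \<Rightarrow> block" where "buminus M = (\<lambda>j k. - M j k)"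
definition bmult :: "nat \<Rightarrow> block \<Rightarrow> block \<Rightarrow> block" where "bmult n M M' = (\<lambda>j k. \<Sum>l<n. M j l * M' l k)"
definition bdiag :: "(nat \<Rightarrow> op) \<Rightarrow> block" where "bdiag X = (\<lambda>j k. if j = k then X j else 0)"
definition bcomm :: "op \<Rightarrow> block \<Rightarrow> block" where "bcomm X M = (\<lambda>j k. comm_op X (M j k))"

text \<open>The creation operators are separate parameters tied to \<open>a\<close> by
  \<open>adj\<close>, as adjoints are expressed through the inner product only. The numbers
  \<open>tau\<close> and \<open>nu\<close> are upper bounds for the two norms, which is the form in
  which the norms are used.\<close>

locale fock =
  fixes d n \<eta> :: nat and a c :: "nat \<Rightarrow> op" and \<tau> :: "nat \<Rightarrow> nat \<Rightarrow> complex" and \<nu> :: "nat \<Rightarrow> nat \<Rightarrow> real"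
    and tau nu :: real
  assumes P: "proj d * a j = a j" "a j * proj d = a j" "proj d * c j = c j" "c j * proj d = c j"
    and adj: "j < n \<Longrightarrow> ip d (app (a j) x) y = ip d x (app (c j) y)"
    and ac: "j < n \<Longrightarrow> k < n \<Longrightarrow> a j * c k + c k * a j = (if j = k then proj d else 0)"
    and aa: "j < n \<Longrightarrow> k < n \<Longrightarrow> a j * a k + a k * a j = 0"
    and cc: "j < n \<Longrightarrow> k < n \<Longrightarrow> c j * c k + c k * c j = 0"
    and tau_herm: "j < n \<Longrightarrow> k < n \<Longrightarrow> \<tau> k j = cnj (\<tau> j k)"
    and nu_sym: "j < n \<Longrightarrow> k < n \<Longrightarrow> \<nu> k j = \<nu> j k"
    and tau_row: "j < n \<Longrightarrow> (\<Sum>k<n. cmod (\<tau> j k)) \<le> tau"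
    and nu_row: "k < n \<Longrightarrow> K \<subseteq> {..<n} \<Longrightarrow> card K = \<eta> \<Longrightarrow> (\<Sum>j\<in>K. \<bar>\<nu> k j\<bar>) \<le> nu"
    and eta: "1 \<le> \<eta>" "\<eta> \<le> n"
begin

definition num :: "nat \<Rightarrow> op" where "num l = c l * a l"
definition N :: op where "N = (\<Sum>l<n. num l)"
definition T :: op where "T = (\<Sum>j<n. \<Sum>k<n. scal (\<tau> j k) * (c j * a k))"
definition V :: op where "V = (\<Sum>l<n. \<Sum>m<n. scal (\<nu> l m) * (num l * num m))"
definition \<Phi> :: "nat \<Rightarrow> op" where "\<Phi> k = (\<Sum>m<n. scal (\<nu> k m) * num m)"
definition h :: "bool \<Rightarrow> op" where "h b = (if b then V else T)"
text \<open>The commutator of \<open>a j\<close> with \<open>h b\<close> is the sum over k of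
  \<open>R b j k * a k\<close>. For V it is diagonal: \<open>\<Phi> j\<close> arises once from each
  of the two number operators, by the symmetry of \<open>\<nu>\<close>, and \<open>\<nu> j j\<close>
  comes from the term in which both indices are j.\<close>

definition R :: "bool \<Rightarrow> block" where
  "R b = (if b then bdiag (\<lambda>j. \<Phi> j + \<Phi> j + scal (\<nu> j j)) else (\<lambda>j k. scal (\<tau> j k)))"
definition \<Gamma> :: "block \<Rightarrow> op" where "\<Gamma> M = (\<Sum>j<n. \<Sum>k<n. c j * M j k * a k)"

lemma nz: "0 \<le> tau" "0 \<le> nu"
proof -
  have n: "0 < n" using eta by simp
  have "0 \<le> (\<Sum>k<n. cmod (\<tau> 0 k))" by (simp add: sum_nonneg)
  then show "0 \<le> tau" using tau_row[OF n] by linarith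
  obtain K where K: "K \<subseteq> {..<n}" "card K = \<eta>"
    using obtain_subset_with_card_n[of \<eta> "{..<n}"] eta by auto
  have "0 \<le> (\<Sum>j\<in>K. \<bar>\<nu> 0 j\<bar>)" by (simp add: sum_nonneg)
  then show "0 \<le> nu" using nu_row[OF n K] by linarith
qed

text \<open>Passing one creation and one annihilation operator changes the sign twice, so only the
  contraction with \<open>c k\<close> remains.\<close>

lemma a_ca: "j < n \<Longrightarrow> k < n \<Longrightarrow> l < n \<Longrightarrow> a j * (c k * a l) = (c k * a l) * a j + (if j = k then a l else 0)"
proof -
  assume j: "j < n" "k < n" "l < n"
  have 1: "a j * c k = (if j = k then proj d else 0) - c k * a j" using ac[OF j(1,2)] by (simp add: eq_diff_eq)
  have 2: "a j * a l = - (a l * a j)" using aa[OF j(1,3)] by (simp add: eq_neg_iff_add_eq_0)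
  have "a j * (c k * a l) = (a j * c k) * a l" by (simp add: mult.assoc)
  also have "\<dots> = (if j = k then a l else 0) - c k * (a j * a l)" by (simp add: 1 left_diff_distrib P mult.assoc)
  finally show ?thesis by (simp add: 2 mult.assoc)
qed

lemma ca_c: "j < n \<Longrightarrow> k < n \<Longrightarrow> l < n \<Longrightarrow> (c k * a l) * c j = c j * (c k * a l) + (if j = l then c k else 0)"
proof -
  assume j: "j < n" "k < n" "l < n"
  have 1: "a l * c j = (if j = l then proj d else 0) - c j * a l" using ac[OF j(3,1)] by (auto simp: eq_diff_eq)
  have 2: "c k * c j = - (c j * c k)" using cc[OF j(2,1)] by (simp add: eq_neg_iff_add_eq_0)
  have "(c k * a l) * c j = c k * (a l * c j)" by (simp add: mult.assoc)
  also have "\<dots> = (if j = l then c k else 0) - (c k * c j) * a l" by (simp add: 1 right_diff_distrib P mult.assoc)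
  finally show ?thesis by (simp add: 2 mult.assoc)
qed

lemma a_num: "j < n \<Longrightarrow> k < n \<Longrightarrow> a j * num k = num k * a j + (if j = k then a j else 0)"
  unfolding num_def using a_ca[of j k k] by simp
lemma num_c: "j < n \<Longrightarrow> k < n \<Longrightarrow> num k * c j = c j * num k + (if j = k then c j else 0)"
  unfolding num_def using ca_c[of j k k] by simp

lemma a_N: "j < n \<Longrightarrow> a j * N = N * a j + a j"
  unfolding N_def sum_distrib_left sum_distrib_right by (simp add: a_num sum.distrib)
lemma N_c: "j < n \<Longrightarrow> N * c j = c j * N + c j"
  unfolding N_def sum_distrib_left sum_distrib_right by (simp add: num_c sum.distrib)

lemma a_T: "j < n \<Longrightarrow> a j * T = T * a j + (\<Sum>k<n. scal (\<tau> j k) * a k)"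
proof -
  assume j: "j < n"
  have "a j * T = (\<Sum>i<n. \<Sum>k<n. scal (\<tau> i k) * (a j * (c i * a k)))"
    unfolding T_def sum_distrib_left scal_left_commute[of "a j"] by simp
  also have "\<dots> = (\<Sum>i<n. \<Sum>k<n. scal (\<tau> i k) * ((c i * a k) * a j)) + (\<Sum>i<n. \<Sum>k<n. if j = i then scal (\<tau> i k) * a k else 0)"
    using j by (simp only: sum.distrib[symmetric]) (intro sum.cong refl, simp add: a_ca distrib_left)
  also have "(\<Sum>i<n. \<Sum>k<n. if j = i then scal (\<tau> i k) * a k else 0) = (\<Sum>k<n. scal (\<tau> j k) * a k)"
    using j by (subst sum.swap) simp
  also have "(\<Sum>i<n. \<Sum>k<n. scal (\<tau> i k) * ((c i * a k) * a j)) = T * a j"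
    by (simp add: T_def sum_distrib_right mult.assoc)
  finally show ?thesis .
qed

lemma a_V: "j < n \<Longrightarrow> a j * V = V * a j + (\<Phi> j + \<Phi> j + scal (\<nu> j j)) * a j"
proof -
  assume j: "j < n"
  have e: "a j * (num l * num m) = (num l * num m) * a j + ((if j = m then num l * a j else 0)
      + (if j = l then num m * a j else 0) + (if j = l then if j = m then a j else 0 else 0))" if "l < n" "m < n" for l m
  proof -
    have "a j * (num l * num m) = (a j * num l) * num m" by (simp add: mult.assoc)
    also have "\<dots> = num l * (a j * num m) + (if j = l then a j * num m else 0)"
      using j that by (simp add: a_num distrib_right mult.assoc)
    finally show ?thesis using j that by (simp add: a_num distrib_left mult.assoc)
  qed
  have "a j * V = (\<Sum>l<n. \<Sum>m<n. scal (\<nu> l m) * (a j * (num l * num m)))"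
    unfolding V_def sum_distrib_left scal_left_commute[of "a j"] by simp
  also have "\<dots> = (\<Sum>l<n. \<Sum>m<n. scal (\<nu> l m) * ((num l * num m) * a j))
     + ((\<Sum>l<n. \<Sum>m<n. if j = m then scal (\<nu> l m) * (num l * a j) else 0)
     + (\<Sum>l<n. \<Sum>m<n. if j = l then scal (\<nu> l m) * (num m * a j) else 0)
     + (\<Sum>l<n. \<Sum>m<n. if j = l then if j = m then scal (\<nu> l m) * a j else 0 else 0))"
    by (simp only: sum.distrib[symmetric]) (intro sum.cong refl, simp add: e distrib_left)
  also have "(\<Sum>l<n. \<Sum>m<n. scal (\<nu> l m) * ((num l * num m) * a j)) = V * a j"
    by (simp add: V_def sum_distrib_right mult.assoc)
  also have "(\<Sum>l<n. \<Sum>m<n. if j = m then scal (\<nu> l m) * (num l * a j) else 0) = (\<Sum>l<n. scal (\<nu> j l) * (num l * a j))"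
    using j nu_sym[OF j] by simp
  also have "\<dots> = \<Phi> j * a j" by (simp add: \<Phi>_def sum_distrib_right mult.assoc)
  also have "(\<Sum>l<n. \<Sum>m<n. if j = l then scal (\<nu> l m) * (num m * a j) else 0) = \<Phi> j * a j"
    using j by (subst sum.swap) (simp add: \<Phi>_def sum_distrib_right mult.assoc)
  also have "(\<Sum>l<n. \<Sum>m<n. if j = l then if j = m then scal (\<nu> l m) * a j else 0 else 0) = scal (\<nu> j j) * a j"
    using j by (subst sum.swap) simp
  finally show ?thesis by (simp add: distrib_right)
qed

lemma a_h: "j < n \<Longrightarrow> a j * h b = h b * a j + (\<Sum>k<n. R b j k * a k)"
  by (cases b) (simp_all add: h_def R_def bdiag_def a_V a_T if_distribR if_distrib[of "\<lambda>x. x * _"] cong: if_cong)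

lemma ip_c: "j < n \<Longrightarrow> ip d (app (c j) x) y = ip d x (app (a j) y)"
  using adj[of j y x] by (metis ip_cnj)

lemma ip_ca: "j < n \<Longrightarrow> k < n \<Longrightarrow> ip d (app (c j * a k) x) y = ip d x (app (c k * a j) y)"
  by (simp add: app_mult ip_c adj)

lemma T_selfadjoint: "ip d (app T x) y = ip d x (app T y)"
proof -
  have "ip d (app T x) y = (\<Sum>j<n. \<Sum>k<n. \<tau> j k * ip d (app (c j * a k) x) y)"
    by (simp add: T_def app_sum app_mult[of "scal _"] app_scalar ip_sum_left ip_smult_left)
  also have "\<dots> = (\<Sum>k<n. \<Sum>j<n. cnj (\<tau> k j) * ip d x (app (c k * a j) y))"
    by (subst sum.swap) (intro sum.cong refl, simp add: ip_ca tau_herm[of _ _, symmetric])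
  also have "\<dots> = ip d x (app T y)"
    by (simp add: T_def app_sum app_mult[of "scal _"] app_scalar ip_sum_right ip_smult_right)
  finally show ?thesis .
qed

lemma num_selfadjoint: "l < n \<Longrightarrow> ip d (app (num l) x) y = ip d x (app (num l) y)"
  unfolding num_def by (rule ip_ca)

lemma \<Phi>_selfadjoint: "ip d (app (\<Phi> k) x) y = ip d x (app (\<Phi> k) y)"
  by (simp add: \<Phi>_def ip_app ip_sum_right ip_smult_right num_selfadjoint)

lemma V_selfadjoint: "ip d (app V x) y = ip d x (app V y)"
proof -
  have "ip d (app V x) y = (\<Sum>l<n. \<Sum>m<n. \<nu> l m * ip d (app (num l * num m) x) y)"
    by (simp add: V_def app_sum app_mult[of "scal _"] app_scalar ip_sum_left ip_smult_left)
  also have "\<dots> = (\<Sum>m<n. \<Sum>l<n. \<nu> m l * ip d x (app (num m * num l) y))"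
    by (subst sum.swap) (intro sum.cong refl, simp add: app_mult num_selfadjoint, metis nu_sym)
  also have "\<dots> = ip d x (app V y)"
    by (simp add: V_def app_sum app_mult[of "scal _"] app_scalar ip_sum_right ip_smult_right)
  finally show ?thesis .
qed

lemma h_P: "proj d * h b = h b"
proof -
  have "proj d * (c j * Z) = c j * Z" for j Z by (simp add: P flip: mult.assoc)
  then show ?thesis
    by (simp add: h_def T_def V_def num_def sum_distrib_left scal_left_commute[of "proj d"] mult.assoc)
qed

text \<open>The adjoint of \<open>a_h\<close>, taken through inner products: the generators are
  self-adjoint, and the adjoint of \<open>R b j k\<close> is \<open>R b k j\<close>.\<close>

lemma h_c: "j < n \<Longrightarrow> h b * c j = c j * h b + (\<Sum>k<n. c k * R b k j)"
proof -
  assume j: "j < n"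
  have R: "ip d x (app (R b j k) (app (a k) y)) = ip d (app (c k) (app (R b k j) x)) y" if k: "k < n" for k x y
  proof (cases b)
    case True
    then show ?thesis
      by (simp add: R_def bdiag_def ip_c[OF k] ip_app ip_add_right ip_smult_right \<Phi>_selfadjoint)
  next
    case False
    then show ?thesis using tau_herm[OF j k]
      by (simp add: R_def ip_c[OF k] ip_app ip_smult_right)
  qed
  have "ip d (app (h b * c j) x) y = ip d (app (c j * h b + (\<Sum>k<n. c k * R b k j)) x) y" for x y
  proof -
    have "ip d (app (h b * c j) x) y = ip d x (app (a j * h b) y)"
      by (simp add: app_mult h_def T_selfadjoint V_selfadjoint ip_c[OF j])
    also have "\<dots> = ip d (app (c j * h b + (\<Sum>k<n. c k * R b k j)) x) y"
      by (simp add: a_h[OF j] ip_app ip_add_right ip_sum_right R ip_c[OF j]) (simp add: h_def T_selfadjoint V_selfadjoint)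
    finally show ?thesis .
  qed
  then have "proj d * (h b * c j) = proj d * (c j * h b + (\<Sum>k<n. c k * R b k j))" by (rule op_eq_of_ip)
  then show ?thesis by (simp add: distrib_left sum_distrib_left P h_P flip: mult.assoc)
qed

abbreviation drv :: "bool \<Rightarrow> block \<Rightarrow> block" where
  "drv b M \<equiv> badd (bcomm (h b) M) (badd (bmult n (R b) M) (buminus (bmult n M (R b))))"

text \<open>Carrying the generator past \<open>c j\<close> on the left produces R times M, and past
  \<open>a k\<close> on the right M times R; what is left in the middle is the commutator with the
  entry.\<close>

lemma comm_\<Gamma>:
  "comm_op (h b) (\<Gamma> M) = \<Gamma> (drv b M)"
proof -
  have "h b * (c j * M j k * a k) - (c j * M j k * a k) * h b
     = c j * comm_op (h b) (M j k) * a k + (\<Sum>i<n. c i * R b i j * M j k * a k) - (\<Sum>i<n. c j * M j k * R b k i * a i)"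
    if "j < n" "k < n" for j k
  proof -
    have "h b * (c j * M j k * a k) = (h b * c j) * M j k * a k" by (simp add: mult.assoc)
    also have "\<dots> = c j * (h b * M j k) * a k + (\<Sum>i<n. c i * R b i j * M j k * a k)"
      by (simp add: h_c[OF that(1)] distrib_right mult.assoc sum_distrib_right)
    finally have 1: "h b * (c j * M j k * a k) = \<dots>" .
    have "(c j * M j k * a k) * h b = c j * M j k * (a k * h b)" by (simp add: mult.assoc)
    also have "\<dots> = c j * (M j k * h b) * a k + (\<Sum>i<n. c j * M j k * R b k i * a i)"
      by (simp add: a_h[OF that(2)] distrib_left mult.assoc sum_distrib_left)
    finally have 2: "(c j * M j k * a k) * h b = \<dots>" .
    show ?thesis unfolding 1 2 by (simp add: comm_op_def algebra_simps)
  qed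
  then have "comm_op (h b) (\<Gamma> M) = (\<Sum>j<n. \<Sum>k<n. c j * comm_op (h b) (M j k) * a k)
      + (\<Sum>j<n. \<Sum>k<n. \<Sum>i<n. c i * R b i j * M j k * a k) - (\<Sum>j<n. \<Sum>k<n. \<Sum>i<n. c j * M j k * R b k i * a i)"
    by (simp add: \<Gamma>_def comm_op_sum) (simp add: comm_op_def[of "h b" "_ * _ * _"] sum.distrib sum_subtractf)
  also have "(\<Sum>j<n. \<Sum>k<n. \<Sum>i<n. c i * R b i j * M j k * a k) = (\<Sum>i<n. \<Sum>k<n. c i * bmult n (R b) M i k * a k)"
    by (simp add: bmult_def sum_distrib_left sum_distrib_right mult.assoc)
       (subst sum.swap, rule sum.swap[THEN trans], rule sum.cong[OF refl], subst sum.swap, rule refl)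
  also have "(\<Sum>j<n. \<Sum>k<n. \<Sum>i<n. c j * M j k * R b k i * a i) = (\<Sum>j<n. \<Sum>i<n. c j * bmult n M (R b) j i * a i)"
    by (simp add: bmult_def sum_distrib_left sum_distrib_right mult.assoc) (rule sum.cong[OF refl], subst sum.swap, rule refl)
  finally show ?thesis
    by (simp add: \<Gamma>_def badd_def bcomm_def buminus_def distrib_left distrib_right
        right_diff_distrib left_diff_distrib sum_subtractf sum.distrib sum_negf)
qed

section \<open>Particle-number sectors\<close>

definition E :: "real \<Rightarrow> (nat \<Rightarrow> complex) set" where
  "E e = {x. app (proj d) x = x \<and> app N x = (\<lambda>i. complex_of_real e * x i)}"

text \<open>The bound is imposed in all sectors with at most \<open>\<eta>\<close> particles, since the entries of \<open>M\<close> in \<open>\<Gamma> M\<close> act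
  after a particle has been removed. Real labels \<open>e\<close> let \<open>e - 1\<close> be negative, where the sector is zero.\<close>

definition op_bd :: "real \<Rightarrow> op \<Rightarrow> bool" where
  "op_bd K X \<longleftrightarrow> (\<forall>e\<le>real \<eta>. \<forall>x\<in>E e. app X x \<in> E e \<and> nrm d (app X x) \<le> K * nrm d x)"

lemma E_add: "x \<in> E e \<Longrightarrow> y \<in> E e \<Longrightarrow> (\<lambda>i. x i + y i) \<in> E e"
  by (simp add: E_def app_vec_add distrib_left)
lemma E_smult: "x \<in> E e \<Longrightarrow> (\<lambda>i. z * x i) \<in> E e"
  by (simp add: E_def app_vec_smult mult.left_commute)
lemma E_zero: "(\<lambda>i. 0) \<in> E e"
  by (simp add: E_def)
lemma E_sum: "(\<And>k. k \<in> A \<Longrightarrow> f k \<in> E e) \<Longrightarrow> (\<lambda>i. \<Sum>k\<in>A. f k i) \<in> E e"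
  by (induction A rule: infinite_finite_induct) (auto intro: E_add E_zero)

lemma op_bd_mono: "op_bd K X \<Longrightarrow> K \<le> L \<Longrightarrow> op_bd L X"
  unfolding op_bd_def by (meson mult_right_mono nrm_nonneg order_trans)

lemma op_bd_add: "op_bd K X \<Longrightarrow> op_bd L Y \<Longrightarrow> op_bd (K + L) (X + Y)"
  unfolding op_bd_def app_add by (auto simp: distrib_right intro!: E_add order_trans[OF nrm_triangle] add_mono)

lemma op_bd_mult:
  assumes "0 \<le> K" "op_bd K X" "op_bd L Y"
  shows "op_bd (K * L) (X * Y)"
  unfolding op_bd_def app_mult
proof (intro allI impI ballI conjI)
  fix e x assume e: "e \<le> real \<eta>" and x: "x \<in> E e"
  then show "app X (app Y x) \<in> E e" using assms by (simp add: op_bd_def)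
  have "nrm d (app X (app Y x)) \<le> K * nrm d (app Y x)" using assms e x by (simp add: op_bd_def)
  also have "\<dots> \<le> K * (L * nrm d x)" using assms e x by (intro mult_left_mono) (auto simp: op_bd_def)
  finally show "nrm d (app X (app Y x)) \<le> K * L * nrm d x" by simp
qed

lemma op_bd_scalar: "op_bd (cmod z) (scal z)"
  by (simp add: op_bd_def app_scalar nrm_smult E_smult)

lemma op_bd_zero: "0 \<le> K \<Longrightarrow> op_bd K 0"
  by (simp add: op_bd_def E_zero)

lemma op_bd_uminus: "op_bd K X \<Longrightarrow> op_bd K (- X)"
  using E_smult[of _ _ "-1"] by (auto simp: op_bd_def app_uminus nrm_uminus)

lemma op_bd_sum: "(\<And>k. k \<in> A \<Longrightarrow> op_bd (K k) (X k)) \<Longrightarrow> op_bd (\<Sum>k\<in>A. K k) (\<Sum>k\<in>A. X k)"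
  by (induction A rule: infinite_finite_induct) (auto intro: op_bd_add op_bd_zero)

text \<open>The anticommutation relation splits the squared norm of x into those of its images under
  \<open>c j\<close> and \<open>a j\<close>.\<close>

lemma nrm_a: "j < n \<Longrightarrow> nrm d (app (a j) x) \<le> nrm d x"
proof -
  assume j: "j < n"
  have "ip d (app (c j) x) (app (c j) x) + ip d (app (a j) x) (app (a j) x)
      = ip d (app (a j * c j + c j * a j) x) x"
    by (simp add: app_add app_mult ip_add_left adj[OF j] ip_c[OF j])
  also have "\<dots> = ip d x x" using ac[OF j j] by simp
  finally have "complex_of_real ((nrm d (app (c j) x))\<^sup>2 + (nrm d (app (a j) x))\<^sup>2) = complex_of_real ((nrm d x)\<^sup>2)"
    by (simp only: ip_self of_real_add)
  then have "(nrm d (app (c j) x))\<^sup>2 + (nrm d (app (a j) x))\<^sup>2 = (nrm d x)\<^sup>2"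
    by (simp only: of_real_eq_iff)
  then have "(nrm d (app (a j) x))\<^sup>2 \<le> (nrm d x)\<^sup>2"
    using zero_le_power2[of "nrm d (app (c j) x)"] by linarith
  then show ?thesis by (rule power2_le_imp_le) simp
qed

text \<open>Both sides are the expectation of N in x.\<close>

lemma sum_nrm_a:
  assumes "x \<in> E e"
  shows "(\<Sum>j<n. (nrm d (app (a j) x))\<^sup>2) = e * (nrm d x)\<^sup>2"
proof -
  have "complex_of_real (\<Sum>j<n. (nrm d (app (a j) x))\<^sup>2) = (\<Sum>j<n. ip d (app (num j) x) x)"
    by (simp only: of_real_sum ip_self[symmetric]) (intro sum.cong refl, simp add: num_def app_mult ip_c)
  also have "\<dots> = ip d (app N x) x" by (simp add: N_def ip_app)
  also have "\<dots> = complex_of_real (e * (nrm d x)\<^sup>2)"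
    using assms by (simp add: E_def ip_smult_left ip_self)
  finally show ?thesis by (simp only: of_real_eq_iff)
qed

lemma a_E: "j < n \<Longrightarrow> x \<in> E e \<Longrightarrow> app (a j) x \<in> E (e - 1)"
proof -
  assume j: "j < n" and x: "x \<in> E e"
  have "N * a j = a j * N - a j" using a_N[OF j] by simp
  then have "app N (app (a j) x) = app (a j * N - a j) x" by (simp flip: app_mult)
  also have "\<dots> = (\<lambda>i. complex_of_real (e - 1) * app (a j) x i)"
    using x by (simp add: E_def app_diff app_mult app_vec_smult algebra_simps)
  finally show ?thesis by (simp add: E_def P flip: app_mult)
qed

lemma c_E: "j < n \<Longrightarrow> x \<in> E (e - 1) \<Longrightarrow> app (c j) x \<in> E e"
proof -
  assume j: "j < n" and x: "x \<in> E (e - 1)"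
  have "app N (app (c j) x) = app (c j * N + c j) x" by (simp add: N_c[OF j] flip: app_mult)
  also have "\<dots> = (\<lambda>i. complex_of_real e * app (c j) x i)"
    using x by (simp add: E_def app_add app_mult app_vec_smult del: of_real_diff) (simp add: algebra_simps)
  finally show ?thesis by (simp add: E_def P flip: app_mult)
qed

section \<open>Schur bounds and pairing bounds\<close>

definition dominated :: "(nat \<Rightarrow> nat \<Rightarrow> real) \<Rightarrow> block \<Rightarrow> bool" where
  "dominated m M \<longleftrightarrow> (\<forall>j<n. \<forall>k<n. 0 \<le> m j k \<and> op_bd (m j k) (M j k))"

text \<open>As a map on occupation weights, the majorant m keeps them under their ceiling by its row
  sums, and bounds the sum of their squares by row and column sums together. The condition is
  symmetric, so m may act on either side of a pairing.\<close>

definition schur_bd :: "real \<Rightarrow> block \<Rightarrow> bool" where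
  "schur_bd K M \<longleftrightarrow> (\<exists>m. dominated m M \<and> (\<forall>j<n. (\<Sum>k<n. m j k) \<le> K) \<and> (\<forall>k<n. (\<Sum>j<n. m j k) \<le> K))"

text \<open>The weights are modelled on \<open>u j = nrm d (app (a j) x)\<close> for a vector x of norm b: each is at most b, and
  their squares sum to the particle number times \<open>b\<^sup>2\<close>. They are closed under matrices with bounded row and
  column sums; with operator norms in place of row sums the first property would be lost.\<close>

definition occ_weights :: "real \<Rightarrow> (nat \<Rightarrow> real) \<Rightarrow> bool" where
  "occ_weights b u \<longleftrightarrow> (\<forall>j<n. 0 \<le> u j \<and> u j \<le> b) \<and> (\<Sum>j<n. (u j)\<^sup>2) \<le> b\<^sup>2 * real \<eta>"

definition pairing_le :: "real \<Rightarrow> (nat \<Rightarrow> nat \<Rightarrow> real) \<Rightarrow> bool" where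
  "pairing_le K m \<longleftrightarrow> (\<forall>u v b b'. 0 \<le> b \<longrightarrow> 0 \<le> b' \<longrightarrow> occ_weights b u \<longrightarrow> occ_weights b' v \<longrightarrow>
     (\<Sum>j<n. \<Sum>k<n. u j * m j k * v k) \<le> K * (b * b'))"

text \<open>The majorant is tested as a bilinear form on occupation weights alone, since
  \<open>\<Gamma>\<close> produces no others. This is the bound that a row of \<open>\<nu>\<close>,
  placed on the diagonal, satisfies with the constant \<open>nu\<close>.\<close>

definition occ_bd :: "real \<Rightarrow> block \<Rightarrow> bool" where
  "occ_bd K M \<longleftrightarrow> (\<exists>m. dominated m M \<and> pairing_le K m)"

lemma pairing_leD:
  "pairing_le K m \<Longrightarrow> 0 \<le> b \<Longrightarrow> 0 \<le> b' \<Longrightarrow> occ_weights b u \<Longrightarrow> occ_weights b' v \<Longrightarrow>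
    (\<Sum>j<n. \<Sum>k<n. u j * m j k * v k) \<le> K * (b * b')"
  by (simp add: pairing_le_def)

lemma pairing_leI:
  assumes "\<And>u v b b'. 0 \<le> b \<Longrightarrow> 0 \<le> b' \<Longrightarrow> occ_weights b u \<Longrightarrow> occ_weights b' v \<Longrightarrow>
    (\<Sum>j<n. \<Sum>k<n. u j * m j k * v k) \<le> K * (b * b')"
  shows "pairing_le K m"
  using assms by (simp add: pairing_le_def)

lemma dominated_add: "dominated m M \<Longrightarrow> dominated m' M' \<Longrightarrow> dominated (\<lambda>j k. m j k + m' j k) (badd M M')"
  by (auto simp: dominated_def badd_def intro: op_bd_add)
lemma dominated_uminus: "dominated m M \<Longrightarrow> dominated m (buminus M)"
  by (auto simp: dominated_def buminus_def intro: op_bd_uminus)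
lemma dominated_mult: "dominated m M \<Longrightarrow> dominated m' M' \<Longrightarrow> dominated (\<lambda>j k. \<Sum>l<n. m j l * m' l k) (bmult n M M')"
  by (auto simp: dominated_def bmult_def intro!: op_bd_sum op_bd_mult sum_nonneg)

lemma schur_bd_mono: "schur_bd K M \<Longrightarrow> K \<le> L \<Longrightarrow> schur_bd L M"
  unfolding schur_bd_def by (meson order_trans)
lemma occ_bd_mono: "occ_bd K M \<Longrightarrow> K \<le> L \<Longrightarrow> occ_bd L M"
  unfolding occ_bd_def pairing_le_def by (meson order_trans mult_right_mono mult_nonneg_nonneg)

lemma schur_bd_add: "schur_bd K M \<Longrightarrow> schur_bd L M' \<Longrightarrow> schur_bd (K + L) (badd M M')"
  unfolding schur_bd_def
proof (elim exE conjE)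
  fix m m'
  assume "dominated m M" "dominated m' M'" "\<forall>j<n. (\<Sum>k<n. m j k) \<le> K" "\<forall>k<n. (\<Sum>j<n. m j k) \<le> K"
    "\<forall>j<n. (\<Sum>k<n. m' j k) \<le> L" "\<forall>k<n. (\<Sum>j<n. m' j k) \<le> L"
  then show "\<exists>m. dominated m (badd M M') \<and> (\<forall>j<n. (\<Sum>k<n. m j k) \<le> K + L) \<and> (\<forall>k<n. (\<Sum>j<n. m j k) \<le> K + L)"
    by (intro exI[of _ "\<lambda>j k. m j k + m' j k"]) (auto simp: sum.distrib intro: dominated_add add_mono)
qed

lemma occ_bd_add:
  assumes "occ_bd K M" "occ_bd L M'"
  shows "occ_bd (K + L) (badd M M')"
proof -
  obtain m m' where m: "dominated m M" "pairing_le K m" "dominated m' M'" "pairing_le L m'"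
    using assms by (auto simp: occ_bd_def)
  have "pairing_le (K + L) (\<lambda>j k. m j k + m' j k)"
  proof (rule pairing_leI)
    fix u v and b b' :: real assume b: "0 \<le> b" "0 \<le> b'" "occ_weights b u" "occ_weights b' v"
    from add_mono[OF pairing_leD[OF m(2) b] pairing_leD[OF m(4) b]]
    show "(\<Sum>j<n. \<Sum>k<n. u j * (m j k + m' j k) * v k) \<le> (K + L) * (b * b')"
      by (simp add: distrib_left distrib_right sum.distrib)
  qed
  then show ?thesis unfolding occ_bd_def using dominated_add[OF m(1,3)] by blast
qed

lemma schur_bd_uminus: "schur_bd K M \<Longrightarrow> schur_bd K (buminus M)"
  unfolding schur_bd_def using dominated_uminus by blast
lemma occ_bd_uminus: "occ_bd K M \<Longrightarrow> occ_bd K (buminus M)"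
  unfolding occ_bd_def using dominated_uminus by blast

lemma schur_bd_mult:
  assumes "0 \<le> K" "0 \<le> L" "schur_bd K M" "schur_bd L M'"
  shows "schur_bd (K * L) (bmult n M M')"
proof -
  obtain m where m: "dominated m M" "\<And>j. j < n \<Longrightarrow> (\<Sum>k<n. m j k) \<le> K" "\<And>k. k < n \<Longrightarrow> (\<Sum>j<n. m j k) \<le> K"
    using assms by (auto simp: schur_bd_def)
  obtain m' where m': "dominated m' M'" "\<And>j. j < n \<Longrightarrow> (\<Sum>k<n. m' j k) \<le> L" "\<And>k. k < n \<Longrightarrow> (\<Sum>j<n. m' j k) \<le> L"
    using assms by (auto simp: schur_bd_def)
  have p: "0 \<le> m j k" "0 \<le> m' j k" if "j < n" "k < n" for j k using that m(1) m'(1) by (auto simp: dominated_def)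
  have "(\<Sum>k<n. \<Sum>l<n. m j l * m' l k) \<le> K * L" if j: "j < n" for j
  proof -
    have "(\<Sum>k<n. \<Sum>l<n. m j l * m' l k) = (\<Sum>l<n. m j l * (\<Sum>k<n. m' l k))"
      by (subst sum.swap) (simp add: sum_distrib_left)
    also have "\<dots> \<le> (\<Sum>l<n. m j l * L)" using p m' j by (intro sum_mono mult_left_mono) auto
    also have "\<dots> \<le> K * L" using m(2)[OF j] assms by (simp add: sum_distrib_right[symmetric] mult_right_mono)
    finally show ?thesis .
  qed
  moreover have "(\<Sum>j<n. \<Sum>l<n. m j l * m' l k) \<le> K * L" if k: "k < n" for k
  proof -
    have "(\<Sum>j<n. \<Sum>l<n. m j l * m' l k) = (\<Sum>l<n. (\<Sum>j<n. m j l) * m' l k)"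
      by (subst sum.swap) (simp add: sum_distrib_right)
    also have "\<dots> \<le> (\<Sum>l<n. K * m' l k)" using p m k by (intro sum_mono mult_right_mono) auto
    also have "\<dots> \<le> K * L" using m'(3)[OF k] assms by (simp add: sum_distrib_left[symmetric] mult_left_mono)
    finally show ?thesis .
  qed
  ultimately show ?thesis unfolding schur_bd_def using dominated_mult[OF m(1) m'(1)] by blast
qed

lemma occ_weights_mult:
  assumes m: "\<And>j k. j < n \<Longrightarrow> k < n \<Longrightarrow> 0 \<le> m j k" "\<And>j. j < n \<Longrightarrow> (\<Sum>k<n. m j k) \<le> K" "\<And>k. k < n \<Longrightarrow> (\<Sum>j<n. m j k) \<le> K"
    and K: "0 \<le> K" and u: "occ_weights b u" "0 \<le> b"
  shows "occ_weights (K * b) (\<lambda>j. \<Sum>k<n. m j k * u k)"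
  unfolding occ_weights_def
proof (intro conjI allI impI)
  fix j assume j: "j < n"
  show "0 \<le> (\<Sum>k<n. m j k * u k)" using j m u by (intro sum_nonneg) (auto simp: occ_weights_def)
  have "(\<Sum>k<n. m j k * u k) \<le> (\<Sum>k<n. m j k * b)"
    using j m u by (intro sum_mono mult_left_mono) (auto simp: occ_weights_def)
  also have "\<dots> \<le> K * b" using m(2)[OF j] u by (simp add: sum_distrib_right[symmetric] mult_right_mono)
  finally show "(\<Sum>k<n. m j k * u k) \<le> K * b" .
next
  have "(\<Sum>j<n. (\<Sum>k<n. m j k * u k)\<^sup>2) \<le> K\<^sup>2 * (\<Sum>k<n. (u k)\<^sup>2)"
    by (rule schur_test) (use m K in auto)
  also have "\<dots> \<le> K\<^sup>2 * (b\<^sup>2 * real \<eta>)" using u by (intro mult_left_mono) (auto simp: occ_weights_def)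
  finally show "(\<Sum>j<n. (\<Sum>k<n. m j k * u k)\<^sup>2) \<le> (K * b)\<^sup>2 * real \<eta>" by (simp add: power_mult_distrib mult.assoc)
qed

text \<open>The multiplier is moved onto the weights v on its side, where it only raises their
  ceiling from b' to \<open>L * b'\<close>.\<close>

lemma occ_bd_mult_right:
  assumes "0 \<le> K" "0 \<le> L" "occ_bd K M" "schur_bd L M'"
  shows "occ_bd (K * L) (bmult n M M')"
proof -
  obtain m where m: "dominated m M" "pairing_le K m"
    using assms by (auto simp: occ_bd_def)
  obtain m' where m': "dominated m' M'" "\<And>j. j < n \<Longrightarrow> (\<Sum>k<n. m' j k) \<le> L" "\<And>k. k < n \<Longrightarrow> (\<Sum>j<n. m' j k) \<le> L"
    using assms by (auto simp: schur_bd_def)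
  have "pairing_le (K * L) (\<lambda>j k. \<Sum>l<n. m j l * m' l k)"
  proof (rule pairing_leI)
    fix u v and b b' :: real assume b: "0 \<le> b" "0 \<le> b'" "occ_weights b u" "occ_weights b' v"
    have "(\<Sum>j<n. \<Sum>k<n. u j * (\<Sum>l<n. m j l * m' l k) * v k) = (\<Sum>j<n. \<Sum>l<n. u j * m j l * (\<Sum>k<n. m' l k * v k))"
    proof (rule sum.cong[OF refl])
      fix j
      show "(\<Sum>k<n. u j * (\<Sum>l<n. m j l * m' l k) * v k) = (\<Sum>l<n. u j * m j l * (\<Sum>k<n. m' l k * v k))"
        unfolding sum_distrib_left sum_distrib_right by (subst sum.swap) (simp add: mult.assoc)
    qed
    also have "\<dots> \<le> K * (b * (L * b'))"
    proof (rule pairing_leD[OF m(2), where u = u and v = "\<lambda>j. \<Sum>k<n. m' j k * v k" and b = b and b' = "L * b'"])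
      show "occ_weights (L * b') (\<lambda>j. \<Sum>k<n. m' j k * v k)"
        by (rule occ_weights_mult) (use m' b assms in \<open>auto simp: dominated_def\<close>)
    qed (use b assms in auto)
    finally show "(\<Sum>j<n. \<Sum>k<n. u j * (\<Sum>l<n. m j l * m' l k) * v k) \<le> K * L * (b * b')"
      by (simp add: mult_ac)
  qed
  then show ?thesis unfolding occ_bd_def using dominated_mult[OF m(1) m'(1)] by blast
qed

text \<open>Here the transpose of the multiplier acts on the weights u, with row and column sums
  exchanged.\<close>

lemma occ_bd_mult_left:
  assumes "0 \<le> L" "0 \<le> K" "schur_bd L M'" "occ_bd K M"
  shows "occ_bd (L * K) (bmult n M' M)"
proof -
  obtain m where m: "dominated m M" "pairing_le K m"
    using assms by (auto simp: occ_bd_def)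
  obtain m' where m': "dominated m' M'" "\<And>j. j < n \<Longrightarrow> (\<Sum>k<n. m' j k) \<le> L" "\<And>k. k < n \<Longrightarrow> (\<Sum>j<n. m' j k) \<le> L"
    using assms by (auto simp: schur_bd_def)
  have "pairing_le (L * K) (\<lambda>j k. \<Sum>l<n. m' j l * m l k)"
  proof (rule pairing_leI)
    fix u v and b b' :: real assume b: "0 \<le> b" "0 \<le> b'" "occ_weights b u" "occ_weights b' v"
    have "(\<Sum>j<n. \<Sum>k<n. u j * (\<Sum>l<n. m' j l * m l k) * v k) = (\<Sum>k<n. \<Sum>j<n. \<Sum>l<n. u j * (m' j l * m l k) * v k)"
      unfolding sum_distrib_left sum_distrib_right by (rule sum.swap)
    also have "\<dots> = (\<Sum>k<n. \<Sum>l<n. (\<Sum>j<n. m' j l * u j) * m l k * v k)"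
    proof (rule sum.cong[OF refl])
      fix k
      show "(\<Sum>j<n. \<Sum>l<n. u j * (m' j l * m l k) * v k) = (\<Sum>l<n. (\<Sum>j<n. m' j l * u j) * m l k * v k)"
        unfolding sum_distrib_left sum_distrib_right by (subst sum.swap) (simp add: mult_ac)
    qed
    also have "\<dots> = (\<Sum>l<n. \<Sum>k<n. (\<Sum>j<n. m' j l * u j) * m l k * v k)" by (rule sum.swap)
    also have "\<dots> \<le> K * ((L * b) * b')"
    proof (rule pairing_leD[OF m(2), where u = "\<lambda>l. \<Sum>j<n. m' j l * u j" and v = v and b = "L * b" and b' = b'])
      show "occ_weights (L * b) (\<lambda>l. \<Sum>j<n. m' j l * u j)"
        by (rule occ_weights_mult[where m = "\<lambda>l j. m' j l"]) (use m' b assms in \<open>auto simp: dominated_def\<close>)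
    qed (use b assms in auto)
    finally show "(\<Sum>j<n. \<Sum>k<n. u j * (\<Sum>l<n. m' j l * m l k) * v k) \<le> L * K * (b * b')"
      by (simp add: mult_ac)
  qed
  then show ?thesis unfolding occ_bd_def using dominated_mult[OF m'(1) m(1)] by blast
qed

lemma occ_weights_product:
  fixes u v :: "nat \<Rightarrow> real" and b b' :: real
  assumes "occ_weights b u" "occ_weights b' v" "0 \<le> b" "0 \<le> b'"
  shows "(\<Sum>j<n. u j * v j) \<le> real \<eta> * (b * b')"
proof -
  have "(\<Sum>j<n. u j * v j)\<^sup>2 \<le> (\<Sum>j<n. (u j)\<^sup>2) * (\<Sum>j<n. (v j)\<^sup>2)" by (rule Cauchy_Schwarz_ineq_sum)
  also have "\<dots> \<le> (b\<^sup>2 * real \<eta>) * (b'\<^sup>2 * real \<eta>)" using assms by (intro mult_mono) (auto simp: occ_weights_def sum_nonneg)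
  also have "\<dots> = (real \<eta> * (b * b'))\<^sup>2" by (simp add: power2_eq_square mult_ac)
  finally show ?thesis by (rule power2_le_imp_le) (use assms in simp)
qed

text \<open>The step that costs the factor \<open>\<eta>\<close>: once the matrix is absorbed into
  v, two families of weights are left, and Cauchy-Schwarz is applied to the sums of their
  squares.\<close>

lemma schur_bd_imp_occ_bd:
  assumes "0 \<le> K" "schur_bd K M"
  shows "occ_bd (real \<eta> * K) M"
proof -
  obtain m where m: "dominated m M" "\<And>j. j < n \<Longrightarrow> (\<Sum>k<n. m j k) \<le> K" "\<And>k. k < n \<Longrightarrow> (\<Sum>j<n. m j k) \<le> K"
    using assms by (auto simp: schur_bd_def)
  have "pairing_le (real \<eta> * K) m"
  proof (rule pairing_leI)
    fix u v and b b' :: real assume b: "0 \<le> b" "0 \<le> b'" "occ_weights b u" "occ_weights b' v"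
    have "occ_weights (K * b') (\<lambda>j. \<Sum>k<n. m j k * v k)"
      by (rule occ_weights_mult) (use m b assms in \<open>auto simp: dominated_def\<close>)
    from occ_weights_product[OF b(3) this b(1)] b(2) assms(1)
    show "(\<Sum>j<n. \<Sum>k<n. u j * m j k * v k) \<le> real \<eta> * K * (b * b')"
      by (simp add: sum_distrib_left mult_ac)
  qed
  then show ?thesis unfolding occ_bd_def using m(1) by blast
qed

text \<open>The image y of x is paired with itself. Moving each \<open>c j\<close> to the other side
  turns the pairing into a sum over the entries of M between \<open>app (a k) x\<close> and
  \<open>app (a j) y\<close>, whose norms are occupation weights with ceilings
  \<open>nrm d x\<close> and \<open>nrm d y\<close>.\<close>

lemma occ_bd_imp_op_bd_\<Gamma>:
  assumes "0 \<le> K" "occ_bd K M"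
  shows "op_bd K (\<Gamma> M)"
  unfolding op_bd_def
proof (intro allI impI ballI)
  fix e x assume e: "e \<le> real \<eta>" and x: "x \<in> E e"
  obtain m where m: "dominated m M" "pairing_le K m"
    using assms by (auto simp: occ_bd_def)
  define y where "y = app (\<Gamma> M) x"
  have eq: "y = (\<lambda>i. \<Sum>j<n. \<Sum>k<n. app (c j) (app (M j k) (app (a k) x)) i)"
    by (simp add: y_def \<Gamma>_def app_sum app_mult)
  have obM: "app (M j k) (app (a k) x) \<in> E (e - 1)" "nrm d (app (M j k) (app (a k) x)) \<le> m j k * nrm d (app (a k) x)"
    if "j < n" "k < n" for j k
  proof -
    have "op_bd (m j k) (M j k)" using that m(1) by (simp add: dominated_def)
    moreover have "e - 1 \<le> real \<eta>" using e by simp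
    ultimately show "app (M j k) (app (a k) x) \<in> E (e - 1)" "nrm d (app (M j k) (app (a k) x)) \<le> m j k * nrm d (app (a k) x)"
      using a_E[OF that(2) x] unfolding op_bd_def by blast+
  qed
  have yE: "y \<in> E e" unfolding eq by (intro E_sum c_E obM) auto
  have U: "occ_weights (nrm d z) (\<lambda>j. nrm d (app (a j) z))" if "z \<in> E e" for z
    using that e by (auto simp: occ_weights_def nrm_a sum_nrm_a mult.commute[of e] intro!: mult_left_mono)
  have "cmod (ip d y y) \<le> (\<Sum>j<n. \<Sum>k<n. nrm d (app (a j) y) * m j k * nrm d (app (a k) x))"
  proof -
    have "ip d y y = (\<Sum>j<n. \<Sum>k<n. ip d (app (M j k) (app (a k) x)) (app (a j) y))"
      by (subst (1) eq) (simp add: ip_sum_left ip_c)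
    moreover have "cmod (\<Sum>j<n. \<Sum>k<n. ip d (app (M j k) (app (a k) x)) (app (a j) y))
        \<le> (\<Sum>j<n. \<Sum>k<n. nrm d (app (a j) y) * m j k * nrm d (app (a k) x))"
    proof (intro sum_norm_le)
      fix j k assume jk: "j \<in> {..<n}" "k \<in> {..<n}"
      have "cmod (ip d (app (M j k) (app (a k) x)) (app (a j) y)) \<le> nrm d (app (M j k) (app (a k) x)) * nrm d (app (a j) y)"
        by (rule cmod_ip_le)
      also have "\<dots> \<le> (m j k * nrm d (app (a k) x)) * nrm d (app (a j) y)"
        using jk by (intro mult_right_mono obM) auto
      finally show "cmod (ip d (app (M j k) (app (a k) x)) (app (a j) y)) \<le> nrm d (app (a j) y) * m j k * nrm d (app (a k) x)"
        by (simp add: mult_ac)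
    qed
    ultimately show ?thesis by (simp only:)
  qed
  also have "\<dots> \<le> K * (nrm d y * nrm d x)" by (rule pairing_leD[OF m(2)]) (use U yE x in auto)
  finally have "nrm d y \<le> K * nrm d x" using assms(1) by (intro nrm_le_of_ip) (simp_all add: mult_ac)
  then show "app (\<Gamma> M) x \<in> E e \<and> nrm d (app (\<Gamma> M) x) \<le> K * nrm d x" using yE by (simp add: y_def)
qed

text \<open>Divided by \<open>b * b'\<close>, the products \<open>u j * v j\<close> lie between 0
  and 1 and sum to at most \<open>\<eta>\<close>, as \<open>weighted_sum_le_top\<close>
  requires.\<close>

lemma nu_weighted:
  assumes "k < n" "occ_weights b u" "occ_weights b' v" "0 \<le> b" "0 \<le> b'"
  shows "(\<Sum>j<n. \<bar>\<nu> k j\<bar> * (u j * v j)) \<le> nu * (b * b')"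
proof (cases "b * b' = 0")
  case True
  then have "b = 0 \<or> b' = 0" by simp
  then have "u j * v j = 0" if "j < n" for j using assms(2,3) that by (force simp: occ_weights_def)
  then have "(\<Sum>j<n. \<bar>\<nu> k j\<bar> * (u j * v j)) = 0" by (intro sum.neutral) auto
  then show ?thesis by (simp only: True mult_zero_right order_refl)
next
  case False
  then have bb: "0 < b * b'" using assms by (simp add: less_le)
  have "(\<Sum>j<n. \<bar>\<nu> k j\<bar> * (u j * v j / (b * b'))) \<le> nu"
  proof (rule weighted_sum_le_top[where \<eta> = \<eta>])
    show "0 \<le> u j * v j / (b * b') \<and> u j * v j / (b * b') \<le> 1" if "j < n" for j
      using that assms bb by (auto simp: occ_weights_def intro!: mult_mono)
    have "(\<Sum>j<n. u j * v j / (b * b')) = (\<Sum>j<n. u j * v j) / (b * b')" by (simp add: sum_divide_distrib)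
    also have "\<dots> \<le> \<eta>" using occ_weights_product[OF assms(2,3,4,5)] bb by (simp add: divide_le_eq)
    finally show "(\<Sum>j<n. u j * v j / (b * b')) \<le> real \<eta>" .
  qed (use eta nu_row assms in auto)
  then have "(\<Sum>j<n. \<bar>\<nu> k j\<bar> * (u j * v j)) / (b * b') \<le> nu" by (simp add: sum_divide_distrib)
  then show ?thesis using bb by (simp add: divide_le_eq)
qed

lemma dominated_bdiag:
  assumes "\<And>j. j < n \<Longrightarrow> 0 \<le> w j \<and> op_bd (w j) (X j)"
  shows "dominated (\<lambda>j k. if j = k then w j else 0) (bdiag X)"
  using assms by (auto simp: dominated_def bdiag_def intro: op_bd_zero)

lemma occ_bd_nu_diag: "k < n \<Longrightarrow> occ_bd nu (bdiag (\<lambda>j. scal (\<nu> k j)))"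
  unfolding occ_bd_def
proof (intro exI conjI)
  assume k: "k < n"
  show "dominated (\<lambda>j l. if j = l then \<bar>\<nu> k j\<bar> else 0) (bdiag (\<lambda>j. scal (\<nu> k j)))"
    using op_bd_scalar[of "complex_of_real _"] by (intro dominated_bdiag) auto
  show "pairing_le nu (\<lambda>j l. if j = l then \<bar>\<nu> k j\<bar> else 0)"
  proof (rule pairing_leI)
    fix u v and b b' :: real assume b: "0 \<le> b" "0 \<le> b'" "occ_weights b u" "occ_weights b' v"
    have "(\<Sum>j<n. \<Sum>l<n. u j * (if j = l then \<bar>\<nu> k j\<bar> else 0) * v l) = (\<Sum>j<n. \<bar>\<nu> k j\<bar> * (u j * v j))"
    proof (intro sum.cong refl)
      fix j assume j: "j \<in> {..<n}"
      have "(\<Sum>l<n. u j * (if j = l then \<bar>\<nu> k j\<bar> else 0) * v l) = (\<Sum>l<n. if j = l then u j * \<bar>\<nu> k j\<bar> * v l else 0)"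
        by (intro sum.cong) auto
      then show "(\<Sum>l<n. u j * (if j = l then \<bar>\<nu> k j\<bar> else 0) * v l) = \<bar>\<nu> k j\<bar> * (u j * v j)" using j by simp
    qed
    then show "(\<Sum>j<n. \<Sum>l<n. u j * (if j = l then \<bar>\<nu> k j\<bar> else 0) * v l) \<le> nu * (b * b')"
      using nu_weighted[OF k b(3,4,1,2)] by simp
  qed
qed

text \<open>The indicator of j is an admissible weight because \<open>1 \<le> \<eta>\<close>; in
  other words, j can be completed to a set of \<open>\<eta>\<close> indices.\<close>

lemma nu_diag: "j < n \<Longrightarrow> \<bar>\<nu> j j\<bar> \<le> nu"
proof -
  assume j: "j < n"
  have "(\<Sum>l<n. \<bar>\<nu> j l\<bar> * (if l = j then 1 else 0)) \<le> nu"
    by (rule weighted_sum_le_top[where \<eta> = \<eta>]) (use eta nu_row j in auto)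
  moreover have "(\<Sum>l<n. \<bar>\<nu> j l\<bar> * (if l = j then 1 else 0)) = (\<Sum>l<n. if l = j then \<bar>\<nu> j l\<bar> else 0)"
    by (intro sum.cong) auto
  ultimately show ?thesis using j by simp
qed

lemma schur_bd_bdiag:
  assumes "0 \<le> K" "\<And>j. j < n \<Longrightarrow> op_bd K (X j)"
  shows "schur_bd K (bdiag X)"
  unfolding schur_bd_def using dominated_bdiag[of "\<lambda>_. K" X] assms
  by (intro exI[of _ "\<lambda>j k. if j = k then K else 0"]) auto

lemma schur_bd_tau: "schur_bd tau (R False)"
  unfolding schur_bd_def
proof (intro exI conjI allI impI)
  show "dominated (\<lambda>j k. cmod (\<tau> j k)) (R False)" by (simp add: dominated_def R_def op_bd_scalar)
  show "(\<Sum>k<n. cmod (\<tau> j k)) \<le> tau" if "j < n" for j using that by (rule tau_row)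
  show "(\<Sum>j<n. cmod (\<tau> j k)) \<le> tau" if "k < n" for k
  proof -
    have "cmod (\<tau> j k) = cmod (\<tau> k j)" if "j < n" for j
      using tau_herm[OF that \<open>k < n\<close>] by simp
    then have "(\<Sum>j<n. cmod (\<tau> j k)) = (\<Sum>j<n. cmod (\<tau> k j))" by (intro sum.cong) auto
    then show ?thesis using tau_row[OF that] by simp
  qed
qed

lemma schur_bd_zero: "0 \<le> K \<Longrightarrow> schur_bd K (\<lambda>j k. 0)"
  unfolding schur_bd_def by (intro exI[of _ "\<lambda>j k. 0"]) (auto simp: dominated_def op_bd_zero)
lemma occ_bd_zero: "0 \<le> K \<Longrightarrow> occ_bd K (\<lambda>j k. 0)"
  unfolding occ_bd_def by (intro exI[of _ "\<lambda>j k. 0"]) (auto simp: dominated_def op_bd_zero pairing_le_def)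

section \<open>Iterated commutators of operator-valued matrices\<close>

abbreviation "rate \<equiv> tau + nu"
abbreviation "graded_op \<equiv> graded (\<lambda>b. comm_op (h b)) rate op_bd"
abbreviation "graded_schur \<equiv> graded (\<lambda>b. bcomm (h b)) rate schur_bd"
abbreviation "graded_occ \<equiv> graded (\<lambda>b. bcomm (h b)) rate occ_bd"

lemma rate: "0 \<le> rate" using nz by simp

lemma bcomm_badd: "bcomm X (badd M M') = badd (bcomm X M) (bcomm X M')"
  by (simp add: bcomm_def badd_def comm_op_add)
lemma bcomm_buminus: "bcomm X (buminus M) = buminus (bcomm X M)"
  by (simp add: bcomm_def buminus_def comm_op_uminus)
lemma bcomm_bmult: "bcomm X (bmult n M M') = badd (bmult n (bcomm X M) M') (bmult n M (bcomm X M'))"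
  by (simp add: bcomm_def badd_def bmult_def comm_op_sum comm_op_mult sum.distrib)
lemma bcomm_zero: "bcomm X (\<lambda>j k. 0) = (\<lambda>j k. 0)"
  by (simp add: bcomm_def)

lemma graded_schur_mult: "0 \<le> K \<Longrightarrow> 0 \<le> L \<Longrightarrow> graded_schur p K M \<Longrightarrow> graded_schur p L M' \<Longrightarrow> graded_schur p (2 ^ p * (K * L)) (bmult n M M')"
  by (rule graded_mult[where P = schur_bd and Q = schur_bd and pl = badd]) (auto intro: schur_bd_mult schur_bd_add schur_bd_mono bcomm_bmult bcomm_badd simp: nz)
lemma graded_occ_mult_right: "0 \<le> K \<Longrightarrow> 0 \<le> L \<Longrightarrow> graded_occ p K M \<Longrightarrow> graded_schur p L M' \<Longrightarrow> graded_occ p (2 ^ p * (K * L)) (bmult n M M')"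
  by (rule graded_mult[where P = occ_bd and Q = schur_bd and pl = badd]) (auto intro: occ_bd_mult_right occ_bd_add occ_bd_mono bcomm_bmult bcomm_badd simp: nz)
lemma graded_occ_mult_left: "0 \<le> K \<Longrightarrow> 0 \<le> L \<Longrightarrow> graded_schur p K M \<Longrightarrow> graded_occ p L M' \<Longrightarrow> graded_occ p (2 ^ p * (K * L)) (bmult n M M')"
  by (rule graded_mult[where P = schur_bd and Q = occ_bd and pl = badd]) (auto intro: occ_bd_mult_left occ_bd_add occ_bd_mono bcomm_bmult bcomm_badd simp: nz)
lemma graded_schur_add: "graded_schur p K M \<Longrightarrow> graded_schur p L M' \<Longrightarrow> graded_schur p (K + L) (badd M M')"
  by (rule graded_add[where pl = badd]) (auto intro: schur_bd_add bcomm_badd)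
lemma graded_occ_add: "graded_occ p K M \<Longrightarrow> graded_occ p L M' \<Longrightarrow> graded_occ p (K + L) (badd M M')"
  by (rule graded_add[where pl = badd]) (auto intro: occ_bd_add bcomm_badd)
lemma graded_schur_uminus: "graded_schur p K M \<Longrightarrow> graded_schur p K (buminus M)"
  by (rule graded_map[where f = buminus]) (auto intro: schur_bd_uminus bcomm_buminus)
lemma graded_occ_uminus: "graded_occ p K M \<Longrightarrow> graded_occ p K (buminus M)"
  by (rule graded_map[where f = buminus]) (auto intro: occ_bd_uminus bcomm_buminus)
lemma graded_op_add: "graded_op p K X \<Longrightarrow> graded_op p L Y \<Longrightarrow> graded_op p (K + L) (X + Y)"
  by (rule graded_add[where pl = "(+)"]) (auto intro: op_bd_add comm_op_add)
lemma graded_schur_mono: "graded_schur p K X \<Longrightarrow> K \<le> L \<Longrightarrow> graded_schur p L X"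
  by (rule graded_mono[OF schur_bd_mono rate])
lemma graded_occ_mono: "graded_occ p K X \<Longrightarrow> K \<le> L \<Longrightarrow> graded_occ p L X"
  by (rule graded_mono[OF occ_bd_mono rate])

lemma graded_op_scalar: "cmod z \<le> K \<Longrightarrow> graded_op p K (scal z)"
  by (rule graded_const[where z = 0]) (use op_bd_mono[OF op_bd_scalar] nz in \<open>auto intro: op_bd_zero order_trans[OF norm_ge_zero]\<close>)

lemma graded_schur_tau: "graded_schur p tau (R False)"
  by (rule graded_const[where z = "\<lambda>j k. 0"]) (use schur_bd_tau nz in \<open>auto intro: schur_bd_zero simp: bcomm_def R_def\<close>)

lemma graded_occ_nu_diag: "k < n \<Longrightarrow> graded_occ p nu (bdiag (\<lambda>j. scal (\<nu> k j)))"
  by (rule graded_const[where z = "\<lambda>j k. 0"]) (use occ_bd_nu_diag nz in \<open>auto intro: occ_bd_zero simp: bcomm_def bdiag_def fun_eq_iff\<close>)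

lemma graded_schur_bdiag: "0 \<le> K \<Longrightarrow> (\<And>j. j < n \<Longrightarrow> graded_op p K (X j)) \<Longrightarrow> graded_schur p K (bdiag X)"
proof (induction p arbitrary: K X)
  case 0
  then show ?case by (auto intro: schur_bd_bdiag)
next
  case (Suc p)
  have "bcomm (h b) (bdiag X) = bdiag (\<lambda>j. comm_op (h b) (X j))" for b
    by (simp add: bcomm_def bdiag_def fun_eq_iff)
  moreover have "graded_schur p (K * rate) (bdiag (\<lambda>j. comm_op (h b) (X j)))" for b
    by (rule Suc.IH) (use Suc.prems rate in auto)
  ultimately show ?case using Suc.prems by (auto intro: schur_bd_bdiag)
qed

text \<open>Each commutator replaces M by \<open>drv b M\<close>. The entrywise commutator costs
  \<open>rate\<close> and each of the two products with R costs \<open>2 ^ p * rate * r\<close>,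
  hence the factor \<open>1 + 2 ^ Suc q * r\<close> beyond \<open>rate\<close>. Control of R up to q
  derivations yields \<open>Suc q\<close> commutators of \<open>\<Gamma> M\<close>, since the first
  of them is spent on bringing in R. This gain of one drives the induction for
  \<open>\<Phi>\<close>.\<close>

lemma graded_occ_\<Gamma>:
  assumes r: "0 \<le> r" and Rb: "\<And>b. graded_schur q (rate * r) (R b)"
  shows "p \<le> Suc q \<Longrightarrow> 0 \<le> K \<Longrightarrow> graded_occ p K M \<Longrightarrow> graded_op p (K * (1 + 2 ^ Suc q * r) ^ p) (\<Gamma> M)"
proof (induction p arbitrary: K M)
  case 0
  then show ?case by (simp add: occ_bd_imp_op_bd_\<Gamma>)
next
  case (Suc p)
  let ?L = "1 + 2 ^ Suc q * r"
  have L: "1 \<le> ?L" using r by simp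
  have "op_bd (K * ?L ^ Suc p) (\<Gamma> M)"
  proof (rule op_bd_mono)
    show "op_bd K (\<Gamma> M)" using Suc.prems by (intro occ_bd_imp_op_bd_\<Gamma>) auto
    have "K * 1 \<le> K * ?L ^ Suc p" using Suc.prems by (intro mult_left_mono one_le_power L) auto
    then show "K \<le> K * ?L ^ Suc p" by simp
  qed
  moreover have "graded_op p (K * ?L ^ Suc p * rate) (comm_op (h b) (\<Gamma> M))" for b
  proof -
    have Rp: "graded_schur p (rate * r) (R b)" by (rule graded_antimono[OF Rb]) (use Suc.prems in simp)
    have Mp: "graded_occ p K M" by (rule graded_antimono[OF Suc.prems(3)]) simp
    have "graded_occ p (K * rate + (2 ^ p * ((rate * r) * K) + 2 ^ p * (K * (rate * r))))
       (drv b M)"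
      using Suc.prems r rate Rp Mp
      by (intro graded_occ_add graded_occ_uminus graded_occ_mult_left graded_occ_mult_right) auto
    then have 1: "graded_occ p (K * rate * ?L) (drv b M)"
    proof (rule graded_occ_mono)
      have "(2::real) ^ Suc p \<le> 2 ^ Suc q" using Suc.prems by (intro power_increasing) auto
      then have "K * rate * (2 ^ Suc p * r) \<le> K * rate * (2 ^ Suc q * r)"
        using Suc.prems rate r by (intro mult_left_mono mult_right_mono) auto
      then show "K * rate + (2 ^ p * ((rate * r) * K) + 2 ^ p * (K * (rate * r))) \<le> K * rate * ?L"
        by (simp add: algebra_simps)
    qed
    have "graded_op p (K * rate * ?L * ?L ^ p) (\<Gamma> (drv b M))"
      by (rule Suc.IH[OF _ _ 1]) (use Suc.prems rate L in auto)
    then show ?thesis by (simp only: comm_\<Gamma>) (simp add: mult_ac)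
  qed
  ultimately show ?case by simp
qed

lemma \<Phi>_\<Gamma>: "\<Phi> k = \<Gamma> (bdiag (\<lambda>j. scal (\<nu> k j)))"
proof -
  have "(\<Sum>l<n. c j * bdiag (\<lambda>j. scal (\<nu> k j)) j l * a l) = scal (\<nu> k j) * num j" if "j < n" for j
  proof -
    have "(\<Sum>l<n. c j * bdiag (\<lambda>j. scal (\<nu> k j)) j l * a l) = (\<Sum>l<n. if j = l then c j * scal (\<nu> k j) * a l else 0)"
      by (intro sum.cong) (auto simp: bdiag_def)
    then show ?thesis using that by (simp add: num_def scal_left_commute[of "c _"] mult.assoc)
  qed
  then show ?thesis by (simp add: \<Phi>_def \<Gamma>_def)
qed

end

text \<open>The constant of \<open>graded_occ_\<Gamma>\<close> for \<open>p = Suc q\<close> and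
  \<open>r = 2 * nest_const q + 1\<close>, where 2 counts the copies of \<open>\<Phi>\<close> in
  \<open>R True\<close> and 1 accounts for its scalar part.\<close>

primrec nest_const :: "nat \<Rightarrow> real" where
  "nest_const 0 = 1"
| "nest_const (Suc q) = (1 + 2 ^ Suc q * (2 * nest_const q + 1)) ^ Suc q"

lemma nest_const_ge_1: "1 \<le> nest_const q"
proof (induction q)
  case (Suc q)
  then have "1 \<le> 1 + 2 ^ Suc q * (2 * nest_const q + 1)" by simp
  then show ?case unfolding nest_const.simps by (rule one_le_power)
qed simp

context fock
begin

lemma graded_schur_RV:
  assumes "\<And>k. k < n \<Longrightarrow> graded_op q (nest_const q * nu) (\<Phi> k)"
  shows "graded_schur q ((2 * nest_const q + 1) * nu) (R True)"
proof -
  have "graded_op q ((2 * nest_const q + 1) * nu) (\<Phi> j + \<Phi> j + scal (\<nu> j j))" if j: "j < n" for j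
  proof -
    have "graded_op q (nest_const q * nu + nest_const q * nu + nu) (\<Phi> j + \<Phi> j + scal (\<nu> j j))"
      using assms[OF j] nu_diag[OF j] by (intro graded_op_add graded_op_scalar) auto
    then show ?thesis by (simp add: algebra_simps)
  qed
  then have "graded_schur q ((2 * nest_const q + 1) * nu) (bdiag (\<lambda>j. \<Phi> j + \<Phi> j + scal (\<nu> j j)))"
    using nest_const_ge_1[of q] nz by (intro graded_schur_bdiag) auto
  then show ?thesis by (simp add: R_def)
qed

lemma graded_schur_R:
  assumes "\<And>k. k < n \<Longrightarrow> graded_op q (nest_const q * nu) (\<Phi> k)"
  shows "graded_schur q (rate * (2 * nest_const q + 1)) (R b)"
proof (cases b)
  case True
  have "(2 * nest_const q + 1) * nu \<le> rate * (2 * nest_const q + 1)"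
    using nest_const_ge_1[of q] nz by (simp add: algebra_simps)
  then show ?thesis using graded_schur_mono[OF graded_schur_RV[OF assms]] True by simp
next
  case False
  have "tau * 1 \<le> rate * (2 * nest_const q + 1)" using nest_const_ge_1[of q] nz by (intro mult_mono) auto
  then show ?thesis using graded_schur_mono[OF graded_schur_tau] False by simp
qed

text \<open>Bounds on \<open>\<Phi>\<close> up to q commutators control R to the same order, and R
  so controlled bounds \<open>\<Phi>\<close>, being \<open>\<Gamma>\<close> of a diagonal matrix of
  scalars, one order further. No factor \<open>\<eta>\<close> arises, because the pairing bound of
  that matrix is \<open>nu\<close> itself.\<close>

lemma graded_op_\<Phi>: "k < n \<Longrightarrow> graded_op q (nest_const q * nu) (\<Phi> k)"
proof (induction q arbitrary: k)
  case 0
  then show ?case using occ_bd_imp_op_bd_\<Gamma>[OF nz(2) occ_bd_nu_diag] by (simp add: \<Phi>_\<Gamma>)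
next
  case (Suc q)
  have "graded_op (Suc q) (nu * (1 + 2 ^ Suc q * (2 * nest_const q + 1)) ^ Suc q) (\<Gamma> (bdiag (\<lambda>j. scal (\<nu> k j))))"
    by (rule graded_occ_\<Gamma>[OF _ graded_schur_R[OF Suc.IH] order.refl nz(2) graded_occ_nu_diag[OF Suc.prems]])
      (use nest_const_ge_1[of q] in simp_all)
  then show ?case by (simp add: \<Phi>_\<Gamma> mult.commute)
qed

lemma T_\<Gamma>: "T = \<Gamma> (R False)"
  by (simp add: T_def \<Gamma>_def R_def scal_left_commute[of "c _"] mult.assoc)

text \<open>The entries of \<open>R False\<close> are scalars, so the entrywise commutator vanishes
  and only products of \<open>R True\<close> with \<open>R False\<close> remain; this is the origin
  of \<open>tau * nu\<close>. They are estimated as Schur bounds first, so that the passage to a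
  pairing bound, with its factor \<open>\<eta>\<close>, is made once.\<close>

lemma graded_op_comm_VT:
  "graded_op q (2 ^ Suc q * (2 * nest_const q + 1) * (1 + 2 ^ Suc q * (2 * nest_const q + 1)) ^ q * (real \<eta> * (tau * nu))) (comm_op V T)"
proof -
  let ?r = "2 * nest_const q + 1"
  have r: "0 \<le> ?r" using nest_const_ge_1[of q] by simp
  have z: "graded_schur q 0 (\<lambda>j k. 0)"
    by (rule graded_const[where z = "\<lambda>j k. 0"]) (use nz in \<open>auto intro: schur_bd_zero simp: bcomm_zero\<close>)
  have "bcomm (h True) (R False) = (\<lambda>j k. 0)" by (simp add: bcomm_def R_def)
  moreover have "graded_schur q (0 + (2 ^ q * ((?r * nu) * tau) + 2 ^ q * (tau * (?r * nu))))
     (badd (\<lambda>j k. 0) (badd (bmult n (R True) (R False)) (buminus (bmult n (R False) (R True)))))"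
    using nz r by (intro graded_schur_add graded_schur_uminus graded_schur_mult z graded_schur_RV[OF graded_op_\<Phi>] graded_schur_tau) auto
  ultimately have "graded_schur q (2 ^ Suc q * ?r * (tau * nu))
     (drv True (R False))"
    by (simp add: mult_ac)
  then have "graded_occ q (real \<eta> * (2 ^ Suc q * ?r * (tau * nu)))
     (drv True (R False))"
    by (rule graded_imp[rotated -1]) (use schur_bd_imp_occ_bd nz r in auto)
  from graded_occ_\<Gamma>[where q = q and p = q, OF r graded_schur_R[OF graded_op_\<Phi>] _ _ this]
  have "graded_op q (real \<eta> * (2 ^ Suc q * ?r * (tau * nu)) * (1 + 2 ^ Suc q * ?r) ^ q) (comm_op (h True) (\<Gamma> (R False)))"
    unfolding comm_\<Gamma> using nz r by simp
  then show ?thesis by (simp add: h_def T_\<Gamma> mult_ac)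
qed

lemma graded_op_imp_nested_bd:
  "graded_op q K X \<Longrightarrow> nested_bd d (E (real \<eta>)) (range h) q (K * rate ^ q) X"
proof (induction q arbitrary: K X)
  case 0
  have "cmod (ip d (app X x) y) \<le> K * nrm d x * nrm d y" if "x \<in> E (real \<eta>)" for x y
  proof -
    have "cmod (ip d (app X x) y) \<le> nrm d (app X x) * nrm d y" by (rule cmod_ip_le)
    also have "\<dots> \<le> K * nrm d x * nrm d y" using 0 that by (intro mult_right_mono) (auto simp: op_bd_def)
    finally show ?thesis .
  qed
  then show ?case by (simp add: form_bd_def)
next
  case (Suc q)
  show ?case using Suc.IH[of "K * rate"] Suc.prems by (auto simp: mult_ac)
qed

text \<open>The innermost commutator is zero or, up to sign, that of V and T, which contributes
  \<open>tau * nu * real \<eta>\<close>; each of the other q commutators contributes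
  \<open>rate\<close>.\<close>

theorem nested_commutator_bound:
  "nested_bd d (E (real \<eta>)) (range h) (Suc q)
     (2 ^ Suc q * (2 * nest_const q + 1) * (1 + 2 ^ Suc q * (2 * nest_const q + 1)) ^ q * (rate ^ q * tau * nu * real \<eta>)) (h b)"
proof -
  let ?K = "2 ^ Suc q * (2 * nest_const q + 1) * (1 + 2 ^ Suc q * (2 * nest_const q + 1)) ^ q * (real \<eta> * (tau * nu))"
  have K0: "0 \<le> ?K" using nest_const_ge_1[of q] nz by simp
  have VT: "graded_op q ?K (comm_op V T)" by (rule graded_op_comm_VT)
  have "graded_op q ?K (- comm_op V T)"
    by (rule graded_map[where f = uminus, OF _ _ VT]) (auto intro: op_bd_uminus comm_op_uminus)
  then have TV: "graded_op q ?K (comm_op T V)" by (simp add: comm_op_def)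
  have Z: "graded_op q ?K 0"
    by (rule graded_const[where z = 0]) (use K0 nz in \<open>auto intro: op_bd_zero\<close>)
  have "graded_op q ?K (comm_op (h b') (h b))" for b'
    using VT TV Z by (cases b; cases b') (simp_all add: h_def)
  then have "nested_bd d (E (real \<eta>)) (range h) q (?K * rate ^ q) (comm_op (h b') (h b))" for b'
    by (rule graded_op_imp_nested_bd)
  then show ?thesis by (auto simp: mult_ac)
qed

section \<open>Conservation of the particle number and occupation states\<close>

lemma N_ca: "j < n \<Longrightarrow> k < n \<Longrightarrow> N * (c j * a k) = (c j * a k) * N"
proof -
  assume jk: "j < n" "k < n"
  have "N * (c j * a k) = (c j * N + c j) * a k" by (simp add: N_c[OF jk(1)] flip: mult.assoc)
  also have "\<dots> = c j * (N * a k + a k)" by (simp add: distrib_left distrib_right mult.assoc)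
  also have "\<dots> = (c j * a k) * N" by (simp add: a_N[OF jk(2)] mult.assoc)
  finally show ?thesis .
qed

lemma N_num: "l < n \<Longrightarrow> N * num l = num l * N"
  unfolding num_def by (rule N_ca)

lemma N_h: "N * h b = h b * N"
proof (cases b)
  case False
  have "N * T = T * N"
    unfolding T_def sum_distrib_left sum_distrib_right scal_left_commute[of N]
    by (intro sum.cong refl) (simp add: N_ca mult.assoc)
  then show ?thesis using False by (simp add: h_def)
next
  case True
  have "N * (num l * num m) = (num l * num m) * N" if "l < n" "m < n" for l m
    using N_num[OF that(1)] N_num[OF that(2)] by (metis mult.assoc)
  then have "N * V = V * N"
    unfolding V_def sum_distrib_left sum_distrib_right scal_left_commute[of N]
    by (intro sum.cong refl) (simp add: mult.assoc)
  then show ?thesis using True by (simp add: h_def)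
qed

lemma N_P: "proj d * N = N" "N * proj d = N"
  unfolding N_def num_def sum_distrib_left sum_distrib_right
  by (simp_all add: P mult.assoc flip: mult.assoc[of "proj d"])

lemma E_invariant:
  assumes U: "unitary_group d H U" and H: "N * H = H * N"
  shows "invariant d U (E e)"
  unfolding invariant_def
proof (intro ballI conjI allI)
  fix x s assume x: "x \<in> E e"
  then show "app (proj d) x = x" by (simp add: E_def)
  have "N * U s = U s * N" by (rule unitary_group_commute[OF U H[symmetric] N_P])
  then have "app N (app (U s) x) = app (U s) (app N x)" by (metis app_mult)
  also have "\<dots> = (\<lambda>i. complex_of_real e * app (U s) x i)" using x by (simp add: E_def app_vec_smult)
  finally show "app (U s) x \<in> E e" using U by (simp add: E_def unitary_group_def flip: app_mult)
qed

lemma double_zero: "(X :: op) + X = 0 \<Longrightarrow> X = 0"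
proof (rule op_eqI)
  fix x assume "X + X = 0"
  then have "app (X + X) x = app 0 x" by simp
  then show "app X x = app 0 x" by (simp add: app_add fun_eq_iff)
qed

lemma num_commute: "l < n \<Longrightarrow> m < n \<Longrightarrow> l \<noteq> m \<Longrightarrow> num l * a m = a m * num l \<and> num l * c m = c m * num l"
  using a_num[of m l] num_c[of m l] by simp

lemma num_a_self: "m < n \<Longrightarrow> num m * a m = 0"
  using double_zero[OF aa[of m m]] by (simp add: num_def mult.assoc)
lemma num_c_self: "m < n \<Longrightarrow> num m * c m = c m"
proof -
  assume m: "m < n"
  have "c m * num m = 0" using double_zero[OF cc[OF m m]] by (simp add: num_def flip: mult.assoc)
  then show ?thesis using num_c[OF m m] by simp
qed

text \<open>Needed because the supremum over an empty set of states is an unspecified real number.\<close>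

lemma joint_eigenvector:
  assumes "0 < d"
  shows "m \<le> n \<Longrightarrow> \<exists>x. app (proj d) x = x \<and> x \<noteq> (\<lambda>i. 0) \<and> (\<forall>l<m. app (num l) x = (if l \<in> S then x else (\<lambda>i. 0)))"
proof (induction m)
  case 0
  have "unit_seq 0 0 \<noteq> 0" by (simp add: unit_seq_def)
  then have "unit_seq 0 \<noteq> (\<lambda>i. 0)" by metis
  then show ?case using assms by (intro exI[of _ "unit_seq 0"]) (auto simp: app_proj unit_seq_def fun_eq_iff)
next
  case (Suc m)
  then obtain x where x: "app (proj d) x = x" "x \<noteq> (\<lambda>i. 0)" "\<And>l. l < m \<Longrightarrow> app (num l) x = (if l \<in> S then x else (\<lambda>i. 0))"
    by auto
  have m: "m < n" using Suc.prems by simp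
  have keep: "app (num l) (app X x) = (if l \<in> S then app X x else (\<lambda>i. 0))" if "X = a m \<or> X = c m" "l < m" for X l
  proof -
    have "num l * X = X * num l" using num_commute[of l m] that m by auto
    then have "app (num l) (app X x) = app X (app (num l) x)" by (metis app_mult)
    then show ?thesis using x(3)[OF that(2)] by simp
  qed
  show ?case
  proof (cases "m \<in> S")
    case True
    \<comment> \<open>If \<open>c m\<close> annihilates x, the anticommutation relation shows that
      mode m is already occupied in x; otherwise the image is nonzero and occupied there. In the
      unoccupied case \<open>a m\<close> takes over this role.\<close>
    show ?thesis
    proof (cases "app (c m) x = (\<lambda>i. 0)")
      case z: True
      have "app (a m * c m + c m * a m) x = x" using ac[OF m m] x by simp
      then have "app (num m) x = x" using z by (simp add: app_add app_mult num_def)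
      then show ?thesis using x True by (intro exI[of _ x]) (auto simp: less_Suc_eq)
    next
      case False
      have "app (num m) (app (c m) x) = app (c m) x" by (simp add: num_c_self[OF m] flip: app_mult)
      then show ?thesis using False True keep by (intro exI[of _ "app (c m) x"]) (auto simp: less_Suc_eq P simp flip: app_mult)
    qed
  next
    case nS: False
    show ?thesis
    proof (cases "app (a m) x = (\<lambda>i. 0)")
      case True
      then have "app (num m) x = (\<lambda>i. 0)" by (simp add: num_def app_mult)
      then show ?thesis using x nS by (intro exI[of _ x]) (auto simp: less_Suc_eq)
    next
      case False
      have "app (num m) (app (a m) x) = (\<lambda>i. 0)" by (simp add: num_a_self[OF m] flip: app_mult)
      then show ?thesis using False nS keep by (intro exI[of _ "app (a m) x"]) (auto simp: less_Suc_eq P simp flip: app_mult)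
    qed
  qed
qed

end

section \<open>Return to matrices, vectors and the restricted norm\<close>

lemma mat_op_index: "i < d \<Longrightarrow> j < d \<Longrightarrow> ip d (app (mat_op d M) (unit_seq j)) (unit_seq i) = M $$ (i, j)"
proof -
  assume ij: "i < d" "j < d"
  have "(\<Sum>k<d. M $$ (i, k) * unit_seq j k) = (\<Sum>k<d. if k = j then M $$ (i, k) else 0)"
    by (intro sum.cong) (auto simp: unit_seq_def)
  then show ?thesis using ij by (simp add: ip_unit_seq app_mat_op)
qed

lemma mat_adjoint_selfadjoint:
  assumes M: "M \<in> carrier_mat d d" and sa: "\<And>x y. ip d (app (mat_op d M) x) y = ip d x (app (mat_op d M) y)"
  shows "mat_adjoint M = M"
proof (rule eq_matI)
  fix i j assume "i < dim_row M" "j < dim_col M"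
  then have ij: "i < d" "j < d" using M by auto
  have "M $$ (i, j) = ip d (app (mat_op d M) (unit_seq j)) (unit_seq i)" by (simp add: mat_op_index ij)
  also have "\<dots> = cnj (ip d (app (mat_op d M) (unit_seq i)) (unit_seq j))" by (simp add: sa[of "unit_seq j"] ip_cnj)
  also have "\<dots> = cnj (M $$ (j, i))" by (simp add: mat_op_index ij)
  finally show "mat_adjoint M $$ (i, j) = M $$ (i, j)" by (simp add: mat_adjoint_index[OF M ij])
qed (use mat_adjoint_carrier[OF M] M in auto)

lemma vec_seq_supported: "v \<in> carrier_vec d \<Longrightarrow> vec_seq v \<in> supported d"
  by (auto simp: supported_def app_proj vec_seq_def fun_eq_iff)

lemma nrm_vec_seq: "v \<in> carrier_vec d \<Longrightarrow> v \<bullet>c v = 1 \<Longrightarrow> nrm d (vec_seq v) = 1"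
  by (simp add: nrm_eq_1 flip: ip_vec_seq)

lemma vec_seq_vec: "app (proj d) x = x \<Longrightarrow> vec_seq (vec d x) = x"
proof
  fix i assume "app (proj d) x = x"
  then have "app (proj d) x i = x i" by simp
  then show "vec_seq (vec d x) i = x i" by (auto simp: vec_seq_def app_proj split: if_splits)
qed

lemma vec_seq_inj: "v \<in> carrier_vec d \<Longrightarrow> w \<in> carrier_vec d \<Longrightarrow> vec_seq v = vec_seq w \<Longrightarrow> v = w"
proof (rule eq_vecI)
  fix i assume "v \<in> carrier_vec d" "w \<in> carrier_vec d" "vec_seq v = vec_seq w" "i < dim_vec w"
  then have "vec_seq v i = vec_seq w i" "i < dim_vec v" by auto
  then show "v $ i = w $ i" using \<open>i < dim_vec w\<close> by (simp add: vec_seq_def)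
qed auto

lemma vec_seq_smult: "v \<in> carrier_vec d \<Longrightarrow> vec_seq (z \<cdot>\<^sub>v v) = (\<lambda>i. z * vec_seq v i)"
  by (auto simp: vec_seq_def fun_eq_iff)
lemma vec_seq_add: "v \<in> carrier_vec d \<Longrightarrow> w \<in> carrier_vec d \<Longrightarrow> vec_seq (v + w) = (\<lambda>i. vec_seq v i + vec_seq w i)"
  by (auto simp: vec_seq_def fun_eq_iff)
lemma vec_seq_zero: "vec_seq (0\<^sub>v d) = (\<lambda>i. 0)"
  by (auto simp: vec_seq_def fun_eq_iff)

lemma restricted_norm_element:
  assumes "M \<in> carrier_mat d d" "\<psi> \<in> carrier_vec d" "\<phi> \<in> carrier_vec d"
  shows "(M *\<^sub>v \<psi>) \<bullet>c \<phi> = ip d (app (mat_op d M) (vec_seq \<psi>)) (vec_seq \<phi>)"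
  using assms ip_vec_seq[of "M *\<^sub>v \<psi>" d \<phi>] by (simp add: vec_seq_mult)

text \<open>A supremum dominates the elements only of a set that is bounded above, which finite
  dimension provides.\<close>

lemma restricted_norm_upper:
  assumes M: "M \<in> carrier_mat d d" and W: "W \<subseteq> carrier_vec d"
    and u: "\<psi> \<in> W" "\<phi> \<in> W" "\<psi> \<bullet>c \<psi> = 1" "\<phi> \<bullet>c \<phi> = 1"
  shows "cmod ((M *\<^sub>v \<psi>) \<bullet>c \<phi>) \<le> restricted_norm W M"
  unfolding restricted_norm_def
proof (rule cSup_upper)
  obtain N where N: "form_bd d (supported d) N (mat_op d M)" using form_bd_supported_exists by blast
  let ?S = "{cmod ((M *\<^sub>v \<psi>) \<bullet>c \<phi>) | \<psi> \<phi>. \<psi> \<in> W \<and> \<phi> \<in> W \<and> \<psi> \<bullet>c \<psi> = 1 \<and> \<phi> \<bullet>c \<phi> = 1}"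
  show "bdd_above ?S"
  proof (rule bdd_aboveI[of _ N])
    fix r assume "r \<in> ?S"
    then obtain \<psi> \<phi> where r: "r = cmod ((M *\<^sub>v \<psi>) \<bullet>c \<phi>)" and *: "\<psi> \<in> carrier_vec d" "\<phi> \<in> carrier_vec d" "\<psi> \<bullet>c \<psi> = 1" "\<phi> \<bullet>c \<phi> = 1"
      using W by auto
    have "r \<le> N * nrm d (vec_seq \<psi>) * nrm d (vec_seq \<phi>)"
      unfolding r restricted_norm_element[OF M *(1,2)] using N vec_seq_supported *(1,2) by (simp add: form_bd_def)
    then show "r \<le> N" using nrm_vec_seq * by simp
  qed
qed (use u in blast)

text \<open>Each pair contributes its V exponential and then its T exponential, in the left-to-right
  order of the product; \<open>True\<close> labels V, as in \<open>h\<close>.\<close>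

definition gens :: "(real \<times> real) list \<Rightarrow> (real \<times> bool) list" where
  "gens cs = concat (map (\<lambda>(a, b). [(b, True), (a, False)]) cs)"

lemma op_sum_carrier: "op_sum d F I \<in> carrier_mat d d"
  by (simp add: op_sum_def)

lemma split_product_carrier:
  assumes "T \<in> carrier_mat d d" "V \<in> carrier_mat d d"
  shows "split_product cs T V t \<in> carrier_mat d d"
proof (induction cs)
  case Nil
  then show ?case using assms by (simp add: split_product_def)
next
  case (Cons g cs)
  obtain a b where g: "g = (a, b)" by (cases g)
  have "split_product (g # cs) T V t = evolution (t * b) V * evolution (t * a) T * split_product cs T V t"
    by (simp add: split_product_def g)
  then show ?case using Cons assms by (simp add: mult_carrier_mat[of _ d d] evolution_carrier)
qed

lemma occupation_in_E:
  assumes "fock d n \<eta> a c \<tau> \<nu> tau nu" "\<And>l. l < n \<Longrightarrow> app (fock.num a c l) x = (if l \<in> S then x else (\<lambda>i. 0))"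
    "app (proj d) x = x" "S \<subseteq> {..<n}"
  shows "x \<in> fock.E d n a c (real (card S))"
proof -
  interpret fock d n \<eta> a c \<tau> \<nu> tau nu by (rule assms(1))
  have "app N x = (\<lambda>i. \<Sum>l<n. if l \<in> S then x i else 0)"
    using assms(2) by (simp add: N_def app_sum fun_eq_iff) (auto intro!: sum.cong)
  also have "\<dots> = (\<lambda>i. complex_of_real (card S) * x i)"
    using assms(4) by (simp add: Int_absorb1 flip: sum.inter_restrict)
  finally show ?thesis using assms(3) by (simp add: E_def)
qed

lemma mat_op_eq_zero:
  assumes "\<And>x y. ip d (app X x) y = 0" "proj d * X = X"
  shows "X = 0"
proof -
  have "proj d * X = proj d * 0" by (rule op_eq_of_ip) (simp add: assms(1))
  then show ?thesis using assms(2) by simp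
qed

lemma ip_adjoint_mat:
  assumes "A \<in> carrier_mat d d"
  shows "ip d (app (mat_op d A) x) y = ip d x (app (mat_op d (mat_adjoint A)) y)"
  by (rule ip_adjoint_mat_op) (simp add: mat_adjoint_index[OF assms])

lemma electronic_fock:
  assumes data: "electronic_data n A \<tau> \<nu>" and \<eta>: "1 \<le> \<eta>" "\<eta> \<le> n"
  shows "fock (2 ^ n) n \<eta> (\<lambda>j. mat_op (2 ^ n) (A j)) (\<lambda>j. mat_op (2 ^ n) (mat_adjoint (A j)))
     (\<lambda>j k. \<tau> $$ (j, k)) (\<lambda>j k. \<nu> $$ (j, k)) (induced_1norm n \<tau>) (restricted_1norm n \<eta> \<nu>)"
proof -
  let ?d = "2 ^ n :: nat" and ?a = "\<lambda>j. mat_op (2 ^ n) (A j)" and ?c = "\<lambda>j. mat_op (2 ^ n) (mat_adjoint (A j))"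
  have A: "A j \<in> carrier_mat ?d ?d" if "j < n" for j
    using data that by (simp add: electronic_data_def fermionic_modes_def)
  note Ac = mat_adjoint_carrier[OF A]
  have ac: "?a j * ?c k + ?c k * ?a j = (if j = k then proj ?d else 0)" if jk: "j < n" "k < n" for j k
  proof -
    have "mat_op ?d (A j * mat_adjoint (A k) + mat_adjoint (A k) * A j) = mat_op ?d (if j = k then 1\<^sub>m ?d else 0\<^sub>m ?d ?d)"
      using data jk by (simp add: electronic_data_def fermionic_modes_def)
    then show ?thesis using A[OF jk(1)] Ac[OF jk(2)] by (simp add: mat_op_add mat_op_mult mat_op_zero proj_def split: if_splits)
  qed
  have aa: "?a j * ?a k + ?a k * ?a j = 0" if jk: "j < n" "k < n" for j k
  proof -
    have "mat_op ?d (A j * A k + A k * A j) = mat_op ?d (0\<^sub>m ?d ?d)"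
      using data jk by (simp add: electronic_data_def fermionic_modes_def)
    then show ?thesis using A[OF jk(1)] A[OF jk(2)] by (simp add: mat_op_add mat_op_mult mat_op_zero)
  qed
  have adj: "ip ?d (app (?a j) x) y = ip ?d x (app (?c j) y)" if "j < n" for j x y
    by (rule ip_adjoint_mat[OF A[OF that]])
  have adj': "ip ?d (app (?c j) x) y = ip ?d x (app (?a j) y)" if "j < n" for j x y
    using adj[OF that, of y x] by (metis ip_cnj)
  \<comment> \<open>The adjoint of \<open>aa\<close>, as \<open>fermionic_modes\<close> states this
    relation for annihilation operators.\<close>
  have cc: "?c j * ?c k + ?c k * ?c j = 0" if jk: "j < n" "k < n" for j k
  proof (rule mat_op_eq_zero)
    fix x y
    have "ip ?d (app (?c j * ?c k + ?c k * ?c j) x) y = ip ?d x (app (?a k * ?a j + ?a j * ?a k) y)"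
      using jk by (simp add: app_add app_mult ip_add_left ip_add_right adj')
    then show "ip ?d (app (?c j * ?c k + ?c k * ?c j) x) y = 0" by (simp add: aa jk)
    show "proj ?d * (?c j * ?c k + ?c k * ?c j) = ?c j * ?c k + ?c k * ?c j"
      by (simp add: distrib_left flip: mult.assoc)
  qed
  have tau: "\<tau> \<in> carrier_mat n n" "mat_adjoint \<tau> = \<tau>" and nu: "\<nu> \<in> carrier_mat n n" "transpose_mat \<nu> = \<nu>"
    using data by (auto simp: electronic_data_def)
  show ?thesis
  proof
    fix j k assume jk: "j < n" "k < n"
    show "\<tau> $$ (k, j) = cnj (\<tau> $$ (j, k))" using mat_adjoint_index[OF tau(1) jk(2,1)] tau(2) by simp
    show "\<nu> $$ (k, j) = \<nu> $$ (j, k)"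
    proof -
      have "transpose_mat \<nu> $$ (j, k) = \<nu> $$ (k, j)" using nu(1) jk by (intro index_transpose_mat) auto
      then show ?thesis using nu(2) by simp
    qed
  next
    fix j assume j: "j < n"
    show "(\<Sum>k<n. cmod (\<tau> $$ (j, k))) \<le> induced_1norm n \<tau>"
      unfolding induced_1norm_def by (rule Max_ge) (use j in auto)
  next
    fix k K assume k: "k < n" and K: "K \<subseteq> {..<n}" "card K = \<eta>"
    have fin: "finite {K. K \<subseteq> {..<n} \<and> card K = \<eta>}"
      by (rule finite_subset[of _ "Pow {..<n}"]) auto
    have "(\<Sum>j\<in>K. \<bar>\<nu> $$ (k, j)\<bar>) \<le> (MAX K\<in>{K. K \<subseteq> {..<n} \<and> card K = \<eta>}. \<Sum>j\<in>K. \<bar>\<nu> $$ (k, j)\<bar>)"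
      by (rule Max_ge) (use K fin in auto)
    also have "\<dots> \<le> restricted_1norm n \<eta> \<nu>"
      unfolding restricted_1norm_def by (rule Max_ge) (use k in auto)
    finally show "(\<Sum>j\<in>K. \<bar>\<nu> $$ (k, j)\<bar>) \<le> restricted_1norm n \<eta> \<nu>" .
  qed (use ac aa cc adj \<eta> in auto)
qed

locale electronic =
  fixes n \<eta> :: nat and A :: "nat \<Rightarrow> complex mat" and \<tau> :: "complex mat" and \<nu> :: "real mat"
  assumes data: "electronic_data n A \<tau> \<nu>" and \<eta>: "1 \<le> \<eta>" "\<eta> \<le> n"

sublocale electronic \<subseteq> fock "2 ^ n" n \<eta> "\<lambda>j. mat_op (2 ^ n) (A j)" "\<lambda>j. mat_op (2 ^ n) (mat_adjoint (A j))"
     "\<lambda>j k. \<tau> $$ (j, k)" "\<lambda>j k. \<nu> $$ (j, k)" "induced_1norm n \<tau>" "restricted_1norm n \<eta> \<nu>"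
  by (rule electronic_fock[OF data \<eta>])

context electronic
begin

abbreviation "hdim \<equiv> 2 ^ n :: nat"

lemma A_carrier: "j < n \<Longrightarrow> A j \<in> carrier_mat hdim hdim"
  using data by (simp add: electronic_data_def fermionic_modes_def)

lemma mat_op_number_op: "l < n \<Longrightarrow> mat_op hdim (number_op A l) = num l"
  by (simp add: number_op_def num_def mat_op_mult A_carrier mat_adjoint_carrier)

lemma number_op_carrier: "l < n \<Longrightarrow> number_op A l \<in> carrier_mat hdim hdim"
  using A_carrier[of l] mat_adjoint_carrier[OF A_carrier, of l] by (simp add: number_op_def)

lemma mat_op_kinetic: "mat_op hdim (kinetic n A \<tau>) = h False"
proof -
  have "mat_op hdim (kinetic n A \<tau>) = (\<Sum>(j, k)\<in>{..<n} \<times> {..<n}. scal (\<tau> $$ (j, k)) * (mat_op hdim (mat_adjoint (A j)) * mat_op hdim (A k)))"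
    unfolding kinetic_def mat_op_op_sum
  proof (intro sum.cong refl)
    fix i assume "i \<in> {..<n} \<times> {..<n}"
    then obtain j k where i: "i = (j, k)" "j < n" "k < n" by auto
    then show "mat_op hdim ((\<lambda>(j, k). \<tau> $$ (j, k) \<cdot>\<^sub>m (mat_adjoint (A j) * A k)) i)
       = (case i of (j, k) \<Rightarrow> scal (\<tau> $$ (j, k)) * (mat_op hdim (mat_adjoint (A j)) * mat_op hdim (A k)))"
      using A_carrier mat_adjoint_carrier[OF A_carrier]
      by (simp add: mat_op_smult[of _ hdim] mat_op_mult mult_carrier_mat[of _ hdim hdim])
  qed
  then show ?thesis by (simp add: h_def T_def sum.cartesian_product)
qed

lemma mat_op_potential: "mat_op hdim (potential n A \<nu>) = h True"
proof -
  have "mat_op hdim (potential n A \<nu>) = (\<Sum>(l, m)\<in>{..<n} \<times> {..<n}. scal (complex_of_real (\<nu> $$ (l, m))) * (num l * num m))"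
    unfolding potential_def mat_op_op_sum
  proof (intro sum.cong refl)
    fix i assume "i \<in> {..<n} \<times> {..<n}"
    then obtain l m where i: "i = (l, m)" "l < n" "m < n" by auto
    then show "mat_op hdim ((\<lambda>(l, m). complex_of_real (\<nu> $$ (l, m)) \<cdot>\<^sub>m (number_op A l * number_op A m)) i)
       = (case i of (l, m) \<Rightarrow> scal (complex_of_real (\<nu> $$ (l, m))) * (num l * num m))"
      using number_op_carrier
      by (simp add: mat_op_smult[of _ hdim] mat_op_mult mat_op_number_op mult_carrier_mat[of _ hdim hdim])
  qed
  then show ?thesis by (simp add: h_def V_def sum.cartesian_product)
qed

abbreviation "Tm \<equiv> kinetic n A \<tau>"
abbreviation "Vm \<equiv> potential n A \<nu>"

lemma carriers: "Tm \<in> carrier_mat hdim hdim" "Vm \<in> carrier_mat hdim hdim" "Tm + Vm \<in> carrier_mat hdim hdim"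
  by (simp_all add: kinetic_def potential_def op_sum_carrier)

lemma mat_op_H: "mat_op hdim (Tm + Vm) = h False + h True"
  by (simp add: mat_op_add[OF carriers(1,2)] mat_op_kinetic mat_op_potential)

lemma selfadjoint: "mat_adjoint Tm = Tm" "mat_adjoint Vm = Vm" "mat_adjoint (Tm + Vm) = Tm + Vm"
  by (rule mat_adjoint_selfadjoint[OF carriers(1)], simp add: mat_op_kinetic h_def T_selfadjoint)
     (rule mat_adjoint_selfadjoint[OF carriers(2)], simp add: mat_op_potential h_def V_selfadjoint,
      rule mat_adjoint_selfadjoint[OF carriers(3)],
      simp add: mat_op_H h_def app_add ip_add_left ip_add_right T_selfadjoint V_selfadjoint)

definition Ub :: "bool \<Rightarrow> real \<Rightarrow> op" where
  "Ub b s = mat_op hdim (evolution s (if b then Vm else Tm))"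

lemma Ub_simps: "Ub True s = mat_op hdim (evolution s Vm)" "Ub False s = mat_op hdim (evolution s Tm)"
  by (simp_all add: Ub_def)

definition UH :: "real \<Rightarrow> op" where
  "UH s = mat_op hdim (evolution s (Tm + Vm))"

sublocale splitting hdim h Ub UH
proof
  show "unitary_group hdim (h b) (Ub b)" for b
    using unitary_group_mat_op[OF carriers(1) selfadjoint(1)] unitary_group_mat_op[OF carriers(2) selfadjoint(2)]
    by (cases b) (simp_all add: Ub_def[abs_def] mat_op_kinetic mat_op_potential)
  show "unitary_group hdim (h False + h True) UH"
    using unitary_group_mat_op[OF carriers(3) selfadjoint(3)] by (simp add: UH_def[abs_def] mat_op_H)
qed

lemma mat_op_split_product: "mat_op hdim (split_product cs Tm Vm t) = S (gens cs) t"
proof (induction cs)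
  case Nil
  then show ?case using carriers(1) by (simp add: split_product_def gens_def proj_def)
next
  case (Cons g cs)
  obtain a b where g: "g = (a, b)" by (cases g)
  have "split_product (g # cs) Tm Vm t = evolution (t * b) Vm * evolution (t * a) Tm * split_product cs Tm Vm t"
    by (simp add: split_product_def g)
  also have "mat_op hdim \<dots> = mat_op hdim (evolution (t * b) Vm) * mat_op hdim (evolution (t * a) Tm) * mat_op hdim (split_product cs Tm Vm t)"
    using carriers split_product_carrier[OF carriers(1,2), of cs t]
    by (simp add: mat_op_mult mult_carrier_mat[of _ hdim hdim] evolution_carrier)
  also have "\<dots> = S (gens (g # cs)) t"
    using Cons by (simp add: g gens_def Ub_simps mult.assoc mult.commute[of t])
  finally show ?case .
qed

abbreviation "err cs t \<equiv> split_product cs Tm Vm t - evolution t (Tm + Vm)"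

lemma err_carrier: "err cs t \<in> carrier_mat hdim hdim"
  by (rule minus_carrier_mat[OF evolution_carrier[OF carriers(3)]])

lemma mat_op_err: "mat_op hdim (err cs t) = S (gens cs) t - UH t"
  by (simp add: mat_op_diff[OF split_product_carrier[OF carriers(1,2)] evolution_carrier[OF carriers(3)]]
      mat_op_split_product UH_def)

text \<open>The order condition speaks of unit vectors; scaling carries it over to all supported
  ones. The witnesses C and e depend on the Hamiltonian.\<close>

lemma order_condition:
  assumes "product_formula_of_order p cs"
  shows "order_at_least p (gens cs)"
proof -
  let ?f = "\<lambda>t. restricted_norm (carrier_vec hdim) (err cs t)"
  have "?f \<in> O[at 0](\<lambda>t. t ^ (p + 1))"
    using assms data unfolding product_formula_of_order_def by blast
  then obtain C where C: "0 < C" "eventually (\<lambda>t. norm (?f t) \<le> C * norm (t ^ (p + 1))) (at 0)"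
    by (elim landau_o.bigE)
  then obtain e where e: "0 < e" "\<And>t. t \<noteq> 0 \<Longrightarrow> dist t 0 < e \<Longrightarrow> norm (?f t) \<le> C * norm (t ^ (p + 1))"
    by (auto simp: eventually_at)
  show ?thesis unfolding order_at_least_def
  proof (rule exI[of _ C], rule exI[of _ e], intro conjI allI impI)
    fix t x y assume t: "0 < t" "t < e" and xy: "x \<in> supported hdim" "y \<in> supported hdim"
    have f: "?f t \<le> C * t ^ (p + 1)" using e(2)[of t] t by simp
    show "cmod (ip hdim (app (S (gens cs) t - UH t) x) y) \<le> C * t ^ (p + 1) * nrm hdim x * nrm hdim y"
    \<comment> \<open>A vector of norm zero cannot be normalized; for it any bound on the form makes
      the left-hand side zero.\<close>
    proof (cases "nrm hdim x = 0 \<or> nrm hdim y = 0")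
      case True
      obtain N where "form_bd hdim (supported hdim) N (S (gens cs) t - UH t)"
        using form_bd_supported_exists by blast
      then have "cmod (ip hdim (app (S (gens cs) t - UH t) x) y) \<le> N * nrm hdim x * nrm hdim y"
        using xy by (simp add: form_bd_def)
      then show ?thesis using True by auto
    next
      case False
      then have pos: "0 < nrm hdim x" "0 < nrm hdim y" by (auto simp: less_le)
      define unit where "unit z = vec hdim (\<lambda>i. complex_of_real (1 / nrm hdim z) * z i)" for z
      have unit: "unit z \<in> carrier_vec hdim" "vec_seq (unit z) = (\<lambda>i. complex_of_real (1 / nrm hdim z) * z i)" "unit z \<bullet>c unit z = 1"
        if "z \<in> supported hdim" "0 < nrm hdim z" for z
      proof -
        show c: "unit z \<in> carrier_vec hdim" by (simp add: unit_def)
        show v: "vec_seq (unit z) = (\<lambda>i. complex_of_real (1 / nrm hdim z) * z i)"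
          unfolding unit_def using that(1) by (intro vec_seq_vec) (simp only: app_vec_smult supported_def mem_Collect_eq)
        have "nrm hdim (vec_seq (unit z)) = 1"
          unfolding v nrm_smult using that(2) by (simp add: norm_divide)
        then show "unit z \<bullet>c unit z = 1" by (simp add: ip_vec_seq[OF c c] ip_self)
      qed
      have "cmod ((err cs t *\<^sub>v unit x) \<bullet>c unit y) \<le> ?f t"
        by (rule restricted_norm_upper[OF err_carrier]) (use unit xy pos in auto)
      then have "cmod ((err cs t *\<^sub>v unit x) \<bullet>c unit y) \<le> C * t ^ (p + 1)" using f by linarith
      moreover have "(err cs t *\<^sub>v unit x) \<bullet>c unit y
          = complex_of_real (1 / nrm hdim x) * complex_of_real (1 / nrm hdim y) * ip hdim (app (S (gens cs) t - UH t) x) y"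
        by (simp only: restricted_norm_element[OF err_carrier unit(1)[OF xy(1) pos(1)] unit(1)[OF xy(2) pos(2)]]
            unit(2)[OF xy(1) pos(1)] unit(2)[OF xy(2) pos(2)] mat_op_err app_vec_smult ip_smult_left ip_smult_right
            complex_cnj_complex_of_real mult.assoc)
      ultimately have "cmod (ip hdim (app (S (gens cs) t - UH t) x) y) / (nrm hdim x * nrm hdim y) \<le> C * t ^ (p + 1)"
        by (simp add: norm_mult norm_divide)
      then show ?thesis using pos by (simp add: divide_le_eq mult.assoc)
    qed
  qed (use e in auto)
qed

lemma stable_E: "stable (E (real \<eta>))"
  unfolding stable_def
proof (intro conjI allI)
  show "invariant hdim (Ub b) (E (real \<eta>))" for b by (rule E_invariant[OF U N_h])
  show "invariant hdim UH (E (real \<eta>))"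
    by (rule E_invariant[OF UH]) (simp add: distrib_left distrib_right N_h)
qed

lemma occupation_state_E:
  assumes "occupation_state n A X v" "X \<subseteq> {..<n}"
  shows "v \<in> carrier_vec hdim" "vec_seq v \<in> E (real (card X))"
proof -
  show v: "v \<in> carrier_vec hdim" using assms by (simp add: occupation_state_def)
  have "app (num l) (vec_seq v) = (if l \<in> X then vec_seq v else (\<lambda>i. 0))" if l: "l < n" for l
  proof -
    have "app (num l) (vec_seq v) = vec_seq (number_op A l *\<^sub>v v)"
      using vec_seq_mult[OF number_op_carrier[OF l] v] by (simp add: mat_op_number_op[OF l])
    also have "number_op A l *\<^sub>v v = (if l \<in> X then 1 else 0) \<cdot>\<^sub>v v"
      using assms l by (simp add: occupation_state_def)
    finally show ?thesis by (simp add: vec_seq_smult[OF v] split: if_splits)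
  qed
  moreover have "app (proj hdim) (vec_seq v) = vec_seq v" using vec_seq_supported[OF v] by (simp add: supported_def)
  ultimately show "vec_seq v \<in> E (real (card X))"
    using occupation_in_E[OF fock_axioms] assms(2) by blast
qed

text \<open>Being an eigenvector of N for the value \<open>\<eta>\<close> is a linear condition, so
  it passes from occupation states to their span.\<close>

lemma particle_sector_subset: "particle_sector n A \<eta> \<subseteq> {v \<in> carrier_vec hdim. vec_seq v \<in> E (real \<eta>)}"
proof -
  interpret m: Module.module "class_ring :: complex ring" "module_vec TYPE(complex) hdim" by (rule vec_module)
  have "submodule class_ring {v \<in> carrier_vec hdim. vec_seq v \<in> E (real \<eta>)} (module_vec TYPE(complex) hdim)"
    by unfold_locales
      (auto simp: module_vec_simps vec_seq_add[where d = hdim] vec_seq_smult[where d = hdim] vec_seq_zero intro: E_add E_smult E_zero)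
  then show ?thesis
    unfolding particle_sector_def using occupation_state_E by (intro m.span_is_subset) auto
qed

text \<open>The modes below \<open>\<eta>\<close> are filled, which is possible as
  \<open>\<eta> \<le> n\<close>. The set under the supremum is thereby nonempty, and
  \<open>cSup_least\<close> applies.\<close>

lemma particle_sector_unit: "\<exists>v. v \<in> particle_sector n A \<eta> \<and> v \<bullet>c v = 1"
proof -
  interpret m: Module.module "class_ring :: complex ring" "module_vec TYPE(complex) hdim" by (rule vec_module)
  obtain x where x: "app (proj hdim) x = x" "x \<noteq> (\<lambda>i. 0)"
    "\<And>l. l < n \<Longrightarrow> app (num l) x = (if l \<in> {..<\<eta>} then x else (\<lambda>i. 0))"
    using joint_eigenvector[of n "{..<\<eta>}"] by auto
  have "nrm hdim x \<noteq> 0"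
  proof
    assume "nrm hdim x = 0"
    then have "app (proj hdim) x = (\<lambda>i. 0)" by (auto simp: app_proj nrm_def L2_set_eq_0_iff)
    then show False using x by simp
  qed
  then have pos: "0 < nrm hdim x" by (simp add: less_le)
  define z where "z = complex_of_real (1 / nrm hdim x)"
  define v where "v = vec hdim (\<lambda>i. z * x i)"
  have v: "v \<in> carrier_vec hdim" by (simp add: v_def)
  have vv: "vec_seq v = (\<lambda>i. z * x i)"
    unfolding v_def using x(1) by (intro vec_seq_vec) (simp only: app_vec_smult)
  have "nrm hdim (vec_seq v) = 1" unfolding vv nrm_smult using pos by (simp add: z_def norm_divide)
  then have u: "v \<bullet>c v = 1" by (simp add: ip_vec_seq[OF v v] ip_self)
  have "number_op A l *\<^sub>v v = (if l \<in> {..<\<eta>} then 1 else 0) \<cdot>\<^sub>v v" if l: "l < n" for l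
  proof (rule vec_seq_inj[of _ hdim])
    show "number_op A l *\<^sub>v v \<in> carrier_vec hdim" using number_op_carrier[OF l] v by (rule mult_mat_vec_carrier)
    show "(if l \<in> {..<\<eta>} then 1 else 0) \<cdot>\<^sub>v v \<in> carrier_vec hdim" using v by simp
    have "vec_seq (number_op A l *\<^sub>v v) = app (num l) (vec_seq v)"
      using vec_seq_mult[OF number_op_carrier[OF l] v] by (simp add: mat_op_number_op[OF l])
    also have "\<dots> = (\<lambda>i. z * app (num l) x i)" by (simp only: vv app_vec_smult)
    also have "\<dots> = vec_seq ((if l \<in> {..<\<eta>} then 1 else 0) \<cdot>\<^sub>v v)"
      by (simp add: x(3)[OF l] vec_seq_smult[OF v] vv)
    finally show "vec_seq (number_op A l *\<^sub>v v) = vec_seq ((if l \<in> {..<\<eta>} then 1 else 0) \<cdot>\<^sub>v v)" .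
  qed
  then have "occupation_state n A {..<\<eta>} v" using v u by (simp add: occupation_state_def)
  then have mem: "v \<in> {v. \<exists>S. S \<subseteq> {..<n} \<and> card S = \<eta> \<and> occupation_state n A S v}"
    using \<eta> by (intro CollectI exI[of _ "{..<\<eta>}"]) auto
  have "{v. \<exists>S. S \<subseteq> {..<n} \<and> card S = \<eta> \<and> occupation_state n A S v} \<subseteq> carrier (module_vec TYPE(complex) hdim)"
    by (auto simp: module_vec_simps occupation_state_def)
  from m.in_own_span[OF this] mem have "v \<in> particle_sector n A \<eta>"
    unfolding particle_sector_def by blast
  then show ?thesis using u by blast
qed

lemma restricted_norm_sector_le:
  assumes M: "M \<in> carrier_mat hdim hdim" and K: "form_bd hdim (E (real \<eta>)) K (mat_op hdim M)"
  shows "restricted_norm (particle_sector n A \<eta>) M \<le> K"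
  unfolding restricted_norm_def
proof (rule cSup_least)
  let ?S = "{cmod ((M *\<^sub>v \<psi>) \<bullet>c \<phi>) | \<psi> \<phi>. \<psi> \<in> particle_sector n A \<eta> \<and> \<phi> \<in> particle_sector n A \<eta> \<and> \<psi> \<bullet>c \<psi> = 1 \<and> \<phi> \<bullet>c \<phi> = 1}"
  show "?S \<noteq> {}"
    using particle_sector_unit by blast
  fix r assume "r \<in> ?S"
  then obtain \<psi> \<phi> where r: "r = cmod ((M *\<^sub>v \<psi>) \<bullet>c \<phi>)" and
    s: "\<psi> \<in> carrier_vec hdim" "\<phi> \<in> carrier_vec hdim" "vec_seq \<psi> \<in> E (real \<eta>)" "vec_seq \<phi> \<in> E (real \<eta>)" "\<psi> \<bullet>c \<psi> = 1" "\<phi> \<bullet>c \<phi> = 1"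
    using particle_sector_subset by blast
  have "r \<le> K * nrm hdim (vec_seq \<psi>) * nrm hdim (vec_seq \<phi>)"
    unfolding r restricted_norm_element[OF M s(1,2)] using K s(3,4) by (simp add: form_bd_def)
  then show "r \<le> K" using nrm_vec_seq s by simp
qed

end

theorem theorem4:
  fixes p :: nat and cs :: "(real \<times> real) list"
  assumes "p \<ge> 1" and "product_formula_of_order p cs"
  shows "\<exists>C::real. \<forall>(n::nat) (\<eta>::nat) (A::nat \<Rightarrow> complex mat) (\<tau>::complex mat) (\<nu>::real mat) (t::real).
    electronic_data n A \<tau> \<nu> \<longrightarrow> 1 \<le> \<eta> \<longrightarrow> \<eta> \<le> n \<longrightarrow> 0 \<le> t \<longrightarrow>
    restricted_norm (particle_sector n A \<eta>)
      (split_product cs (kinetic n A \<tau>) (potential n A \<nu>) t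
       - evolution t (kinetic n A \<tau> + potential n A \<nu>))
    \<le> C * ((induced_1norm n \<tau> + restricted_1norm n \<eta> \<nu>) ^ (p - 1)
            * induced_1norm n \<tau> * restricted_1norm n \<eta> \<nu> * real \<eta> * t ^ (p + 1))"
proof -
  obtain q where p: "p = Suc q" using assms(1) by (cases p) auto
  \<comment> \<open>D comes from the nested commutators and depends on p only; K comes from
    expanding the product and depends on its coefficients too. Both are fixed before the
    Hamiltonian, so \<open>K * D\<close> is a uniform constant.\<close>
  define D where "D = 2 ^ Suc q * (2 * nest_const q + 1) * (1 + 2 ^ Suc q * (2 * nest_const q + 1)) ^ q"
  define K where "K = gen_const (gens cs) p + 2 * heis_const (gens cs) p"
  show ?thesis
  proof (intro exI[of _ "K * D"] allI impI)
    fix n \<eta> A and \<tau> :: "complex mat" and \<nu> :: "real mat" and t :: real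
    assume a: "electronic_data n A \<tau> \<nu>" "1 \<le> \<eta>" "\<eta> \<le> n" "0 \<le> t"
    interpret electronic n \<eta> A \<tau> \<nu> by unfold_locales (use a in auto)
    let ?N = "D * (rate ^ q * induced_1norm n \<tau> * restricted_1norm n \<eta> \<nu> * real \<eta>)"
    have nested_bd: "nested_bd hdim (E (real \<eta>)) (range h) p ?N (h b)" for b
      unfolding p D_def by (rule nested_commutator_bound)
    have "0 \<le> D" using nest_const_ge_1[of q] by (simp add: D_def)
    then have N0: "0 \<le> ?N" using nz by simp
    have "form_bd hdim (E (real \<eta>)) (K * t ^ (p + 1) * ?N) (S (gens cs) t - UH t)"
      unfolding K_def
      by (rule error_bound[OF order_condition[OF assms(2)] _ stable_E N0 nested_bd a(4)]) (simp add: p)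
    then have "restricted_norm (particle_sector n A \<eta>) (err cs t) \<le> K * t ^ (p + 1) * ?N"
      by (intro restricted_norm_sector_le err_carrier) (simp add: mat_op_err)
    then show "restricted_norm (particle_sector n A \<eta>)
        (split_product cs (kinetic n A \<tau>) (potential n A \<nu>) t
         - evolution t (kinetic n A \<tau> + potential n A \<nu>))
      \<le> K * D * ((induced_1norm n \<tau> + restricted_1norm n \<eta> \<nu>) ^ (p - 1)
              * induced_1norm n \<tau> * restricted_1norm n \<eta> \<nu> * real \<eta> * t ^ (p + 1))"
      by (simp add: p mult_ac)
  qed
qed

end
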